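(* For any positive integers $k$, $\Delta$ and $s$ there is a constant $C=C(k,\Delta,s)$ such that for every positive integer $n$ and every $n$-vertex tree $T$ with maximum degree $\Delta(T)\leq \Delta$ we have $\hat{r}_s(T^k)\leq Cn$; that is, $\hat{r}_s(T^k)=O_{k,\Delta,s}(n)$.
   Context: For graphs $G,H$ and a positive integer $s$, $G\to(H)_s$ means that every colouring of the edges of $G$ with $s$ colours contains a monochromatic copy of $H$. The $s$-colour size-Ramsey number of $H$ is $\hat{r}_s(H)=\min\{e(G)\colon G\to(H)_s\}$. For a graph $H$ and a positive integer $k$, the $k$th power $H^k$ is the graph on $V(H)$ in which distinct vertices $u,v$ are adjacent if and only if their distance in $H$ is at most $k$. *)

theory Defs
  imports "HOL-Library.Extended_Nat" "HOL-Library.Ramsey"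
begin

type_synonym 'a ugraph = "'a set \<times> 'a set set"

abbreviation vertices :: "'a ugraph \<Rightarrow> 'a set" where
  "vertices G \<equiv> fst G"

abbreviation edges :: "'a ugraph \<Rightarrow> 'a set set" where
  "edges G \<equiv> snd G"

definition simple_graph :: "'a ugraph \<Rightarrow> bool" where
  "simple_graph G \<longleftrightarrow> finite (vertices G) \<and> edges G \<subseteq> [vertices G]\<^bsup>2\<^esup>"

definition degree :: "'a ugraph \<Rightarrow> 'a \<Rightarrow> nat" where
  "degree G v = card {e \<in> edges G. v \<in> e}"

definition max_degree :: "'a ugraph \<Rightarrow> nat" where
  "max_degree G = Max (degree G ` vertices G)"

text \<open>A walk is given by its list of vertices, so the number of its edges is one less than
  the length of the list.\<close>

definition is_walk :: "'a ugraph \<Rightarrow> 'a list \<Rightarrow> bool" where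
  "is_walk G xs \<longleftrightarrow> xs \<noteq> [] \<and> set xs \<subseteq> vertices G \<and> successively (\<lambda>u v. {u, v} \<in> edges G) xs"

definition walks_between :: "'a ugraph \<Rightarrow> 'a \<Rightarrow> 'a \<Rightarrow> 'a list set" where
  "walks_between G u v = {xs. is_walk G xs \<and> hd xs = u \<and> last xs = v}"

text \<open>The infimum is taken in \<^typ>\<open>enat\<close>, so vertices in different components have infinite distance.\<close>

definition graph_dist :: "'a ugraph \<Rightarrow> 'a \<Rightarrow> 'a \<Rightarrow> enat" where
  "graph_dist G u v = (INF xs \<in> walks_between G u v. enat (length xs - 1))"

definition connected_graph :: "'a ugraph \<Rightarrow> bool" where
  "connected_graph G \<longleftrightarrow>
     vertices G \<noteq> {} \<and> (\<forall>u \<in> vertices G. \<forall>v \<in> vertices G. walks_between G u v \<noteq> {})"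

definition is_cycle :: "'a ugraph \<Rightarrow> 'a list \<Rightarrow> bool" where
  "is_cycle G xs \<longleftrightarrow> is_walk G xs \<and> distinct xs \<and> length xs \<ge> 3 \<and> {last xs, hd xs} \<in> edges G"

definition is_tree :: "'a ugraph \<Rightarrow> bool" where
  "is_tree G \<longleftrightarrow> simple_graph G \<and> connected_graph G \<and> (\<nexists>xs. is_cycle G xs)"

definition graph_power :: "'a ugraph \<Rightarrow> nat \<Rightarrow> 'a ugraph" where
  "graph_power H k =
     (vertices H,
      {{u, v} | u v. u \<in> vertices H \<and> v \<in> vertices H \<and> u \<noteq> v \<and> graph_dist H u v \<le> enat k})"

text \<open>A copy is a subgraph isomorphic to \<open>H\<close>, not necessarily induced.\<close>

definition mono_copy :: "'b ugraph \<Rightarrow> ('b set \<Rightarrow> nat) \<Rightarrow> nat \<Rightarrow> 'a ugraph \<Rightarrow> bool" where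
  "mono_copy G c i H \<longleftrightarrow>
     (\<exists>f. inj_on f (vertices H) \<and> f ` vertices H \<subseteq> vertices G \<and>
          (\<forall>e \<in> edges H. f ` e \<in> edges G \<and> c (f ` e) = i))"

definition arrows :: "'b ugraph \<Rightarrow> 'a ugraph \<Rightarrow> nat \<Rightarrow> bool" where
  "arrows G H s \<longleftrightarrow> (\<forall>c. c ` edges G \<subseteq> {..<s} \<longrightarrow> (\<exists>i < s. mono_copy G c i H))"

text \<open>Every finite graph has an isomorphic copy with vertices in \<^typ>\<open>nat\<close>, so it is enough to
  take host graphs there. The infimum is taken in \<^typ>\<open>enat\<close> so that it would be \<open>\<infinity>\<close>,
  rather than \<open>0\<close>, if there were no host graph.\<close>

definition size_ramsey :: "nat \<Rightarrow> 'a ugraph \<Rightarrow> enat" where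
  "size_ramsey s H = (INF G \<in> {G :: nat ugraph. simple_graph G \<and> arrows G H s}. enat (card (edges G)))"

lemma size_ramsey_le_iff:
  "size_ramsey s H \<le> enat m \<longleftrightarrow>
     (\<exists>G :: nat ugraph. simple_graph G \<and> arrows G H s \<and> card (edges G) \<le> m)"
proof
  let ?S = "{G :: nat ugraph. simple_graph G \<and> arrows G H s}"
  let ?A = "(\<lambda>G. enat (card (edges G))) ` ?S"
  assume le: "size_ramsey s H \<le> enat m"
  have "?A \<noteq> {}"
  proof
    assume "?A = {}"
    then have "size_ramsey s H = \<infinity>"
      unfolding size_ramsey_def by (simp add: Inf_enat_def)
    with le show False by simp
  qed
  then obtain a where "a \<in> ?A" by blast
  then have "Inf ?A \<in> ?A"
    unfolding Inf_enat_def by (metis (no_types, lifting) LeastI empty_iff)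
  then obtain G where "G \<in> ?S" "size_ramsey s H = enat (card (edges G))"
    unfolding size_ramsey_def by blast
  with le show "\<exists>G :: nat ugraph. simple_graph G \<and> arrows G H s \<and> card (edges G) \<le> m"
    by (intro exI[of _ G]) simp
next
  assume "\<exists>G :: nat ugraph. simple_graph G \<and> arrows G H s \<and> card (edges G) \<le> m"
  then obtain G :: "nat ugraph" where "simple_graph G" "arrows G H s" "card (edges G) \<le> m"
    by blast
  then show "size_ramsey s H \<le> enat m"
    unfolding size_ramsey_def by (intro INF_lower2[of G]) auto
qed

lemma simple_graph_power: "simple_graph H \<Longrightarrow> simple_graph (graph_power H k)"
  by (auto simp: simple_graph_def graph_power_def nsets_def)

end

theory Submission
  imports Defs Complex_Main
begin

text \<open>Grouping \<open>k\<close> consecutive levels of the rooted tree shows that \<open>T\<^sup>k\<close> lies in a blow-up of a bounded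
  degree tree, in which every vertex becomes a clique of bounded size \<open>m\<close>, so it suffices to find
  such blow-ups. The host is obtained from a sparse graph \<open>E\<close> in which any two sets of a
  \<open>1/h\<close>-fraction of the vertices are joined by an edge: replace every vertex by a clique of constant
  size \<open>t\<close> and connect the cliques at distance at most \<open>r\<close>. Induct on the number of colours. By Ramsey's
  theorem every clique contains a monochromatic one; keep the vertices of the majority colour, say
  red, and shrink the cliques so that every pair of close cliques is joined either only by red edges or
  without any red edge. If the graph of red pairs contains the tree, we are done. Otherwise the theorem of
  Friedman and Pippenger yields many linear-sized sets with no red pair between different ones. Tuples
  with one vertex in each of these sets and all vertices close together give large cliques without red,
  and these tuples become the vertices of a new host, coloured with one colour less.

  The order of the constants is delicate: the clique size must exceed a function of the degree of
  the new host, so this degree must not depend on how sparse the tuples are. Hence the edges of the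
  new host are a random sample from \<open>E\<close>, taken between two sets \<open>A\<close> and \<open>B\<close> that minimise
  \<open>e(A, B) / |A|\<^sup>\<gamma>\<close>; minimality bounds from below the proportion of the edges that run between large
  subsets. For this the degree of \<open>E\<close> has to be polynomial in \<open>h\<close>, and the exponent increases
  from each step of the induction to the next.\<close>

section \<open>Friedman and Pippenger embedding of trees\<close>

text \<open>The dependence of the constants looks circular. Parts without red pairs between them may
  contain red pairs inside, so two close tuples must not use entries from the same part. Making
  their index sets disjoint may halve a tuple once per close tuple, so the tuple length
  \<open>q\<close> depends on the degree of the new host. The parts have density about
  \<open>1 / y\<close> with \<open>y\<close> exponential in \<open>q\<close>, and the parameter
  \<open>h = w^2\<close> of the old graph must be large compared with \<open>y\<close>. Hence the
  new degree has to be known before \<open>w\<close>. The exponent \<open>\<gamma>\<close> achieves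
  this. Inside a set \<open>Y\<close> the minimising pair is compared with \<open>(Y, Y)\<close>:
  \<open>e(A, B)\<close> is at least \<open>|X| / h\<close> and \<open>e(Y, Y)\<close> at most
  \<open>D |Y|\<close>, so \<open>D * h \<le> w ^ \<gamma>\<close> lets \<open>A\<close> lose at
  most a factor \<open>w\<close> against \<open>Y\<close>. A \<open>1 / l\<close> fraction of both
  sides, if not too small, then carries a \<open>1 / l ^ \<gamma>\<close> fraction of the edges,
  whatever \<open>w\<close> is. For \<open>D = B * h ^ b\<close> the choice
  \<open>\<gamma> = 2 * (b + 2)\<close> suffices once \<open>B \<le> w\<close>, and the new degree
  is at most \<open>8 * (4 * h') ^ \<gamma>\<close>, polynomial in the new parameter
  \<open>h'\<close> with exponent \<open>\<gamma>\<close> instead of \<open>b\<close>.\<close>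

text \<open>Parents precede children, so the vertices can be embedded in the order of their indices.
  The root is 0, where \<open>par\<close> is arbitrary.\<close>

definition rooted_tree :: "nat \<Rightarrow> nat \<Rightarrow> (nat \<Rightarrow> nat) \<Rightarrow> bool" where
  "rooted_tree d n par \<longleftrightarrow>
     0 < n \<and> (\<forall>i. 0 < i \<and> i < n \<longrightarrow> par i < i) \<and>
     (\<forall>j. card {i. 0 < i \<and> i < n \<and> par i = j} \<le> d)"

definition tree_embeds :: "nat \<Rightarrow> (nat \<Rightarrow> nat) \<Rightarrow> 'x set \<Rightarrow> ('x \<times> 'x) set \<Rightarrow> bool" where
  "tree_embeds n par W R \<longleftrightarrow>
     (\<exists>\<phi>. inj_on \<phi> {..<n} \<and> \<phi> ` {..<n} \<subseteq> W \<and> (\<forall>i. 0 < i \<and> i < n \<longrightarrow> (\<phi> (par i), \<phi> i) \<in> R))"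

lemma tree_embeds_mono: "tree_embeds n par W R \<Longrightarrow> W \<subseteq> W' \<Longrightarrow> R \<subseteq> R' \<Longrightarrow> tree_embeds n par W' R'"
  unfolding tree_embeds_def by (meson subset_iff)

text \<open>The invariant of Friedman and Pippenger: \<open>U\<close> is the set of vertices used so far, and
  \<open>f x\<close> is the number of further neighbours that \<open>x\<close> may still be asked to provide.\<close>

definition reserves :: "'x set \<Rightarrow> ('x \<times> 'x) set \<Rightarrow> nat \<Rightarrow> 'x set \<Rightarrow> ('x \<Rightarrow> nat) \<Rightarrow> bool" where
  "reserves W R N U f \<longleftrightarrow> (\<forall>X \<subseteq> W. card X \<le> N \<longrightarrow> sum f X \<le> card (R `` X \<inter> W - U))"

lemma reserves_tight_Un:
  assumes fin: "finite W" and res: "reserves W R N U f"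
    and X: "X \<subseteq> W" "card (R `` X \<inter> W - U) = sum f X"
    and Y: "Y \<subseteq> W" "card (R `` Y \<inter> W - U) = sum f Y"
    and small: "card (X \<union> Y) \<le> N"
  shows "card (R `` (X \<union> Y) \<inter> W - U) = sum f (X \<union> Y)"
proof -
  let ?g = "\<lambda>X. R `` X \<inter> W - U"
  have finX: "finite X" "finite Y" using fin X Y finite_subset by auto
  have fing: "finite (?g Z)" for Z using fin by auto
  have "card (X \<inter> Y) \<le> card (X \<union> Y)"
    using finX by (intro card_mono) auto
  then have "card (X \<inter> Y) \<le> N" using small by simp
  then have 1: "sum f (X \<inter> Y) \<le> card (?g (X \<inter> Y))"
    using res X Y unfolding reserves_def by (meson inf.coboundedI1)
  have 2: "card (?g (X \<inter> Y)) \<le> card (?g X \<inter> ?g Y)"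
    using fing by (intro card_mono) auto
  have 3: "?g (X \<union> Y) = ?g X \<union> ?g Y" by auto
  have 4: "card (?g X) + card (?g Y) = card (?g X \<union> ?g Y) + card (?g X \<inter> ?g Y)"
    using fing by (intro card_Un_Int) auto
  have 5: "sum f X + sum f Y = sum f (X \<union> Y) + sum f (X \<inter> Y)"
    using finX by (simp add: sum.union_inter)
  have 6: "sum f (X \<union> Y) \<le> card (?g (X \<union> Y))"
    using res X Y small unfolding reserves_def by auto
  show ?thesis using 1 2 3 4 5 6 X(2) Y(2) by simp
qed

lemma reserves_extend:
  assumes fin: "finite W" and U: "card U < n" "finite U"
    and expand: "\<And>X. X \<subseteq> W \<Longrightarrow> card X \<le> 2 * n \<Longrightarrow> (d + 1) * card X \<le> card (R `` X \<inter> W)"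
    and fd: "\<And>x. f x \<le> d"
    and res: "reserves W R (2 * n) U f"
    and v: "v \<in> U" "v \<in> W" "0 < f v"
  shows "\<exists>y \<in> W - U. (v, y) \<in> R \<and> reserves W R (2 * n) (insert y U) (f(v := f v - 1, y := f y - 1))"
proof (rule ccontr)
  assume contra: "\<not> ?thesis"
  let ?g = "\<lambda>X. R `` X \<inter> W - U"
  have fing: "finite (?g Z)" for Z using fin by auto
  define tight where "tight X \<longleftrightarrow> X \<subseteq> W \<and> card X \<le> 2 * n \<and> card (?g X) = sum f X" for X
  have tight_small: "card X < n" if "tight X" for X
  proof -
    have "(d + 1) * card X \<le> card (R `` X \<inter> W)"
      using expand that unfolding tight_def by blast
    also have "\<dots> \<le> card (?g X) + card U"
    proof -
      have "card (R `` X \<inter> W) \<le> card (?g X \<union> U)"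
        using fing U by (intro card_mono) auto
      also have "\<dots> \<le> card (?g X) + card U" by (rule card_Un_le)
      finally show ?thesis .
    qed
    also have "card (?g X) = sum f X" using that unfolding tight_def by simp
    also have "sum f X \<le> d * card X"
      using sum_bounded_above[of X f d] fd by (simp add: mult.commute)
    finally have "(d + 1) * card X \<le> d * card X + card U" by simp
    then show ?thesis using U by simp
  qed
  have tight_Un: "tight (X \<union> Y)" if "tight X" "tight Y" for X Y
  proof -
    have "card (X \<union> Y) \<le> 2 * n"
      using tight_small[OF that(1)] tight_small[OF that(2)] card_Un_le[of X Y] by linarith
    then show ?thesis
      using reserves_tight_Un[OF fin res] that unfolding tight_def by blast
  qed
  define Y where "Y = R `` {v} \<inter> W - U"
  have ex: "\<exists>X. tight X \<and> v \<notin> X \<and> y \<in> R `` X" if y: "y \<in> Y" for y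
  proof -
    let ?f = "f(v := f v - 1, y := f y - 1)"
    have yv: "y \<noteq> v" and y': "y \<in> W" "y \<notin> U" using y v unfolding Y_def by auto
    have "\<not> reserves W R (2 * n) (insert y U) ?f"
      using contra y unfolding Y_def by blast
    then obtain X where X: "X \<subseteq> W" "card X \<le> 2 * n" and
      less: "card (R `` X \<inter> W - insert y U) < sum ?f X"
      unfolding reserves_def by (meson not_le)
    have finX: "finite X" using X fin finite_subset by blast
    have good: "sum f X \<le> card (?g X)" using res X unfolding reserves_def by blast
    have eq: "R `` X \<inter> W - insert y U = ?g X - {y}" by auto
    have le: "sum ?f X \<le> sum f X" by (intro sum_mono) auto
    have yin: "y \<in> ?g X"
    proof (rule ccontr)
      assume "y \<notin> ?g X"
      then have "?g X - {y} = ?g X" by simp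
      then show False using less le good eq by simp
    qed
    then have c: "card (?g X - {y}) = card (?g X) - 1" "0 < card (?g X)"
      using fing by (auto simp: card_gt_0_iff)
    \<comment> \<open>Using \<open>y\<close> costs \<open>X\<close> one neighbour, so the inequality
      can only break if it was an equality and the demand of \<open>X\<close> did not drop. The
      latter keeps \<open>v\<close> out of \<open>X\<close>.\<close>
    have lt: "sum f X = sum ?f X"
    proof (rule ccontr)
      assume "sum f X \<noteq> sum ?f X"
      then have "sum ?f X < sum f X" using le by simp
      then show False using less good eq c by simp
    qed
    have "card (?g X) = sum f X" using lt less[unfolded eq] good c by linarith
    then have tX: "tight X" using X unfolding tight_def by simp
    have "v \<notin> X"
    proof
      assume "v \<in> X"
      have "sum ?f X < sum f X"
        using finX \<open>v \<in> X\<close> v yv by (intro sum_strict_mono_ex1) (auto intro!: bexI[of _ v])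
      then show False using lt by simp
    qed
    then show ?thesis using tX yin by auto
  qed
  define F where "F y = (SOME X. tight X \<and> v \<notin> X \<and> y \<in> R `` X)" for y
  have F: "tight (F y)" "v \<notin> F y" "y \<in> R `` F y" if "y \<in> Y" for y
    using someI_ex[OF ex[OF that]] unfolding F_def by auto
  have finY: "finite Y" using fin unfolding Y_def by auto
  have tU: "tight (\<Union>(F ` Z))" if "finite Z" "Z \<subseteq> Y" for Z
    using that
  proof (induction Z)
    case empty
    then show ?case by (simp add: tight_def)
  next
    case (insert y Z)
    then have "tight (F y \<union> \<Union>(F ` Z))" using tight_Un F by auto
    then show ?case by simp
  qed
  define X where "X = \<Union>(F ` Y)"
  have tX: "tight X" using tU[OF finY] unfolding X_def by blast
  have vX: "v \<notin> X" using F unfolding X_def by blast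
  have YX: "Y \<subseteq> R `` X" using F unfolding X_def by blast
  have XW: "X \<subseteq> W" "finite X" using tX fin finite_subset unfolding tight_def by auto
  have eq: "?g (insert v X) = ?g X" using YX unfolding Y_def by blast
  have "card (insert v X) \<le> 2 * n" using tight_small[OF tX] XW vX by simp
  then have "sum f (insert v X) \<le> card (?g (insert v X))"
    using res XW v unfolding reserves_def by (meson insert_subset)
  then show False using eq tX vX XW v unfolding tight_def by simp
qed

text \<open>The demand starts at \<open>d + 1\<close> everywhere: \<open>d\<close> for the children
  and one for the edge to the parent. The remaining unit of the factor \<open>d + 2\<close> absorbs
  the image of the root, which is no longer available as a neighbour.\<close>

lemma friedman_pippenger:
  assumes fin: "finite W" and ne: "W \<noteq> {}" and T: "rooted_tree d n par"
    and expand: "\<And>X. X \<subseteq> W \<Longrightarrow> card X \<le> 2 * n \<Longrightarrow> (d + 2) * card X \<le> card (R `` X \<inter> W)"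
  shows "tree_embeds n par W R"
proof -
  have n: "0 < n" and par: "\<And>i. 0 < i \<Longrightarrow> i < n \<Longrightarrow> par i < i"
    and ch: "\<And>j. card {i. 0 < i \<and> i < n \<and> par i = j} \<le> d"
    using T unfolding rooted_tree_def by auto
  define ch_cnt where "ch_cnt l j = card {i. 0 < i \<and> i < l \<and> par i = j}" for l j
  have ch_lt: "ch_cnt l (par l) < d" if "0 < l" "l < n" for l
  proof -
    have "ch_cnt l (par l) < card {i. 0 < i \<and> i < n \<and> par i = par l}"
      unfolding ch_cnt_def using that by (intro psubset_card_mono) auto
    then show ?thesis using ch less_le_trans by blast
  qed
  have main: "\<exists>\<phi> f. inj_on \<phi> {..<l} \<and> \<phi> ` {..<l} \<subseteq> W \<and>
      (\<forall>i. 0 < i \<and> i < l \<longrightarrow> (\<phi> (par i), \<phi> i) \<in> R) \<and>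
      reserves W R (2 * n) (\<phi> ` {..<l}) f \<and> (\<forall>x. f x \<le> d + 1) \<and>
      (\<forall>x. x \<notin> \<phi> ` {..<l} \<longrightarrow> f x = d + 1) \<and>
      (\<forall>j<l. d \<le> f (\<phi> j) + ch_cnt l j)" if "0 < l" "l \<le> n" for l
    using that
  proof (induction l)
    case 0
    then show ?case by simp
  next
    case (Suc l)
    show ?case
    proof (cases "l = 0")
      case True
      obtain w where w: "w \<in> W" using ne by blast
      have "reserves W R (2 * n) {w} (\<lambda>_. d + 1)"
        unfolding reserves_def
      proof (intro allI impI)
        fix X assume X: "X \<subseteq> W" "card X \<le> 2 * n"
        show "(\<Sum>_\<in>X. d + 1) \<le> card (R `` X \<inter> W - {w})"
        proof (cases "X = {}")
          case False
          then have "0 < card X" using X fin finite_subset card_gt_0_iff by blast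
          then have "(d + 1) * card X + 1 \<le> (d + 2) * card X" by simp
          also have "\<dots> \<le> card (R `` X \<inter> W)" using expand X by blast
          also have "\<dots> \<le> card (R `` X \<inter> W - {w}) + 1"
            by (metis card_Diff_singleton_if diff_le_self add_le_mono1 le_diff_conv le_refl)
          finally show ?thesis by (simp add: mult.commute)
        qed simp
      qed
      then show ?thesis using w True
        by (intro exI[of _ "\<lambda>_. w"] exI[of _ "\<lambda>_. d + 1"]) (auto simp: inj_on_def lessThan_Suc)
    next
      case False
      then obtain \<phi> f where IH: "inj_on \<phi> {..<l}" "\<phi> ` {..<l} \<subseteq> W"
        "\<And>i. 0 < i \<Longrightarrow> i < l \<Longrightarrow> (\<phi> (par i), \<phi> i) \<in> R"
        "reserves W R (2 * n) (\<phi> ` {..<l}) f" "\<And>x. f x \<le> d + 1"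
        "\<And>x. x \<notin> \<phi> ` {..<l} \<Longrightarrow> f x = d + 1" "\<And>j. j < l \<Longrightarrow> d \<le> f (\<phi> j) + ch_cnt l j"
        using Suc by auto
      have l: "0 < l" "l < n" using False Suc.prems by auto
      have pl: "par l < l" using par l by blast
      have 1: "card (\<phi> ` {..<l}) < n"
        using card_image_le[of "{..<l}" \<phi>] l by simp
      have 2: "0 < f (\<phi> (par l))" using IH(7)[OF pl] ch_lt[OF l] by simp
      have "\<exists>y \<in> W - \<phi> ` {..<l}. (\<phi> (par l), y) \<in> R \<and> reserves W R (2 * n) (insert y (\<phi> ` {..<l}))
          (f(\<phi> (par l) := f (\<phi> (par l)) - 1, y := f y - 1))"
        by (rule reserves_extend[OF fin 1 _ _ IH(5) IH(4)]) (use expand IH 2 pl in auto)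
      then obtain y where y: "y \<in> W" "y \<notin> \<phi> ` {..<l}" "(\<phi> (par l), y) \<in> R"
        and res: "reserves W R (2 * n) (insert y (\<phi> ` {..<l}))
          (f(\<phi> (par l) := f (\<phi> (par l)) - 1, y := f y - 1))" (is "reserves _ _ _ _ ?f")
        by blast
      let ?\<phi> = "\<phi>(l := y)"
      have im: "?\<phi> ` {..<Suc l} = insert y (\<phi> ` {..<l})"
        by (auto simp: lessThan_Suc)
      have inj: "inj_on ?\<phi> {..<Suc l}"
        using IH(1) y by (auto simp: lessThan_Suc inj_on_def)
      have edge: "(?\<phi> (par i), ?\<phi> i) \<in> R" if "0 < i" "i < Suc l" for i
        using that IH(3)[of i] y(3) par[of i] l by (cases "i = l") auto
      have cnt: "ch_cnt (Suc l) j = (if j = par l then Suc (ch_cnt l j) else ch_cnt l j)" for j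
      proof -
        have "{i. 0 < i \<and> i < Suc l \<and> par i = j} =
          (if j = par l then insert l {i. 0 < i \<and> i < l \<and> par i = j} else {i. 0 < i \<and> i < l \<and> par i = j})"
          using l by (auto simp: less_Suc_eq)
        then show ?thesis unfolding ch_cnt_def by simp
      qed
      have cap: "d \<le> ?f (?\<phi> j) + ch_cnt (Suc l) j" if j: "j < Suc l" for j
      proof (cases "j = l")
        case True
        then show ?thesis using IH(6)[OF y(2)] by simp
      next
        case False
        then have jl: "j < l" using j by simp
        have ne: "\<phi> j \<noteq> y" using y(2) jl by auto
        have "\<phi> j = \<phi> (par l) \<longleftrightarrow> j = par l"
          using IH(1) jl pl by (auto simp: inj_on_def)
        then show ?thesis using IH(7)[OF jl] cnt[of j] ne False by auto
      qed
      have le: "?f x \<le> d + 1" for x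
        using IH(5) by (simp add: diff_le_self le_trans[OF diff_le_self])
      have out: "?f x = d + 1" if "x \<notin> ?\<phi> ` {..<Suc l}" for x
        using that IH(6)[of x] pl unfolding im by auto
      show ?thesis
      proof (intro exI conjI allI impI)
        show "inj_on ?\<phi> {..<Suc l}" by (rule inj)
        show "?\<phi> ` {..<Suc l} \<subseteq> W" using im y IH(2) by auto
        show "reserves W R (2 * n) (?\<phi> ` {..<Suc l}) ?f" using res im by simp
      qed (use edge cap le out in blast)+
    qed
  qed
  show ?thesis using main[of n] n unfolding tree_embeds_def by blast
qed

section \<open>Separated sets in graphs that do not contain the tree\<close>

text \<open>Take a largest set \<open>Z\<close> of at most \<open>2 * a\<close> vertices that fails
  to expand. If it has \<open>a\<close> elements, then \<open>Z\<close> and the vertices outside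
  \<open>Z\<close> and its neighbourhood form the gap; \<open>2 * d + 7 = 2 * (d + 3) + 1\<close>
  leaves \<open>a\<close> of the latter. Otherwise the graph without \<open>Z\<close> expands, since
  a set violating this could be added to \<open>Z\<close>.\<close>

lemma tree_embeds_or_gap:
  assumes fin: "finite W" and T: "rooted_tree d n par" and na: "2 * n \<le> a"
    and big: "(2 * d + 7) * a \<le> card W" and no: "\<not> tree_embeds n par W R"
  shows "\<exists>A B. A \<subseteq> W \<and> B \<subseteq> W \<and> A \<inter> B = {} \<and> a \<le> card A \<and> a \<le> card B \<and> (\<forall>x\<in>A. \<forall>y\<in>B. (x, y) \<notin> R)"
proof -
  have n: "0 < n" using T unfolding rooted_tree_def by blast
  define bad where "bad Z \<longleftrightarrow> Z \<subseteq> W \<and> card Z \<le> 2 * a \<and> card (R `` Z \<inter> W - Z) \<le> (d + 2) * card Z" for Z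
  have "bad {}" by (simp add: bad_def)
  moreover have "\<forall>Z. bad Z \<longrightarrow> card Z < Suc (2 * a)" unfolding bad_def by auto
  ultimately have "\<exists>Z. bad Z \<and> (\<forall>Z'. bad Z' \<longrightarrow> card Z' \<le> card Z)"
    by (rule ex_has_greatest_nat)
  then obtain Z where Z: "bad Z" and max: "\<And>Z'. bad Z' \<Longrightarrow> card Z' \<le> card Z"
    by blast
  have ZW: "Z \<subseteq> W" "finite Z" "card Z \<le> 2 * a" "card (R `` Z \<inter> W - Z) \<le> (d + 2) * card Z"
    using Z fin finite_subset unfolding bad_def by auto
  show ?thesis
  proof (cases "a \<le> card Z")
    case True
    define B where "B = W - (Z \<union> (R `` Z \<inter> W - Z))"
    have "card (Z \<union> (R `` Z \<inter> W - Z)) \<le> card Z + (d + 2) * card Z"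
      using card_Un_le[of Z "R `` Z \<inter> W - Z"] ZW by linarith
    also have "\<dots> = (d + 3) * card Z" by (simp add: algebra_simps)
    also have "\<dots> \<le> (d + 3) * (2 * a)" using ZW by (intro mult_left_mono) auto
    finally have "card W - card (Z \<union> (R `` Z \<inter> W - Z)) \<ge> a"
      using big by (simp add: algebra_simps)
    then have "a \<le> card B" unfolding B_def
      using card_Diff_subset[of "Z \<union> (R `` Z \<inter> W - Z)" W] ZW fin by auto
    then show ?thesis using True ZW
      by (intro exI[of _ Z] exI[of _ B]) (auto simp: B_def)
  next
    case False
    define W' where "W' = W - Z"
    have "a \<le> (2 * d + 7) * a" by simp
    then have "card Z < card W" using big False by linarith
    then have ne: "W' \<noteq> {}" unfolding W'_def using ZW card_mono leD by (metis Diff_eq_empty_iff)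
    have "tree_embeds n par W' R"
    proof (rule friedman_pippenger[OF _ ne T])
      show "finite W'" using fin unfolding W'_def by simp
      fix X assume X: "X \<subseteq> W'" "card X \<le> 2 * n"
      have finX: "finite X" using X fin finite_subset unfolding W'_def by blast
      show "(d + 2) * card X \<le> card (R `` X \<inter> W')"
      proof (rule ccontr)
        assume c: "\<not> ?thesis"
        then have X0: "0 < card X" by (cases "card X") auto
        have cu: "card (Z \<union> X) = card Z + card X"
          using X finX ZW unfolding W'_def by (intro card_Un_disjoint) auto
        have sub: "R `` (Z \<union> X) \<inter> W - (Z \<union> X) \<subseteq> (R `` Z \<inter> W - Z) \<union> (R `` X \<inter> W')"
          unfolding W'_def by auto
        have "card (R `` (Z \<union> X) \<inter> W - (Z \<union> X)) \<le> card ((R `` Z \<inter> W - Z) \<union> (R `` X \<inter> W'))"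
          by (rule card_mono[OF _ sub]) (use fin W'_def in auto)
        also have "\<dots> \<le> (d + 2) * card Z + (d + 2) * card X"
          using card_Un_le[of "R `` Z \<inter> W - Z" "R `` X \<inter> W'"] ZW c by linarith
        \<comment> \<open>The size bound holds because \<open>card Z < a\<close> and
          \<open>card X \<le> 2 * n \<le> a\<close>.\<close>
        finally have "bad (Z \<union> X)"
          unfolding bad_def using cu ZW X False na W'_def by (auto simp: algebra_simps)
        from max[OF this] show False using cu X0 by simp
      qed
    qed
    then have "tree_embeds n par W R" by (rule tree_embeds_mono) (auto simp: W'_def)
    then show ?thesis using no by simp
  qed
qed

text \<open>Neither side of a gap contains the tree, so both can be split again; every round costs a
  factor \<open>2 * d + 7\<close>. Symmetry of \<open>R\<close> turns the one-sided gap into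
  separation in both orders.\<close>

lemma tree_embeds_or_separated_parts:
  fixes W :: "'x set"
  assumes "finite W" and T: "rooted_tree d n par" and na: "2 * n \<le> a" and sym: "sym R"
    and "(2 * d + 7) ^ j * a \<le> card W" and "\<not> tree_embeds n par W R"
  shows "\<exists>P :: nat \<Rightarrow> 'x set. (\<forall>i<2^j. P i \<subseteq> W \<and> a \<le> card (P i)) \<and>
    (\<forall>i<2^j. \<forall>l<2^j. i \<noteq> l \<longrightarrow> P i \<inter> P l = {} \<and> (\<forall>x\<in>P i. \<forall>y\<in>P l. (x, y) \<notin> R))"
  using assms(1,5,6)
proof (induction j arbitrary: W)
  case 0
  then show ?case by (intro exI[of _ "\<lambda>_. W"]) auto
next
  case (Suc j)
  let ?b = "(2 * d + 7) ^ j * a"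
  have "a \<le> ?b" by simp
  then have nb: "2 * n \<le> ?b" using na by linarith
  have bW: "(2 * d + 7) * ?b \<le> card W" using Suc.prems(2) by (simp only: power_Suc mult.assoc)
  obtain A B where AB: "A \<subseteq> W" "B \<subseteq> W" "A \<inter> B = {}" "?b \<le> card A" "?b \<le> card B"
    "\<And>x y. x \<in> A \<Longrightarrow> y \<in> B \<Longrightarrow> (x, y) \<notin> R"
    using tree_embeds_or_gap[OF Suc.prems(1) T nb bW Suc.prems(3)] by metis
  have BA: "\<And>x y. x \<in> A \<Longrightarrow> y \<in> B \<Longrightarrow> (y, x) \<notin> R" using AB(6) sym by (meson symD)
  have no: "\<not> tree_embeds n par A R" "\<not> tree_embeds n par B R"
    using tree_embeds_mono[OF _ AB(1) subset_refl] tree_embeds_mono[OF _ AB(2) subset_refl] Suc.prems(3)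
    by metis+
  obtain P :: "nat \<Rightarrow> 'x set" where P: "\<forall>i<2^j. P i \<subseteq> A \<and> a \<le> card (P i)"
    "\<forall>i<2^j. \<forall>l<2^j. i \<noteq> l \<longrightarrow> P i \<inter> P l = {} \<and> (\<forall>x\<in>P i. \<forall>y\<in>P l. (x, y) \<notin> R)"
    using Suc.IH[OF finite_subset[OF AB(1) Suc.prems(1)] AB(4) no(1)] by metis
  obtain Q :: "nat \<Rightarrow> 'x set" where Q: "\<forall>i<2^j. Q i \<subseteq> B \<and> a \<le> card (Q i)"
    "\<forall>i<2^j. \<forall>l<2^j. i \<noteq> l \<longrightarrow> Q i \<inter> Q l = {} \<and> (\<forall>x\<in>Q i. \<forall>y\<in>Q l. (x, y) \<notin> R)"
    using Suc.IH[OF finite_subset[OF AB(2) Suc.prems(1)] AB(5) no(2)] by metis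
  define S where "S i = (if i < 2^j then P i else Q (i - 2^j))" for i
  have S: "S i \<subseteq> A \<and> S i = P i \<and> i < 2^j \<or> S i \<subseteq> B \<and> S i = Q (i - 2^j) \<and> i - 2^j < 2^j \<and> 2^j \<le> i"
    if "i < 2 ^ Suc j" for i
    using that P Q unfolding S_def by auto
  have "S i \<inter> S l = {} \<and> (\<forall>x\<in>S i. \<forall>y\<in>S l. (x, y) \<notin> R)"
    if "i < 2 ^ Suc j" "l < 2 ^ Suc j" "i \<noteq> l" for i l
  proof -
    consider "i < 2^j" "l < 2^j" | "i < 2^j" "2^j \<le> l" | "2^j \<le> i" "l < 2^j" | "2^j \<le> i" "2^j \<le> l"
      by linarith
    then show ?thesis
    proof cases
      case 1
      then show ?thesis using P(2) that(3) by (simp add: S_def)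
    next
      case 2
      then have "S i \<subseteq> A" "S l \<subseteq> B" using S[OF that(1)] S[OF that(2)] by auto
      then show ?thesis using AB(3,6) by blast
    next
      case 3
      then have "S i \<subseteq> B" "S l \<subseteq> A" using S[OF that(1)] S[OF that(2)] by auto
      then show ?thesis using AB(3) BA by blast
    next
      case 4
      then have "i - 2^j \<noteq> l - 2^j" "i - 2^j < 2^j" "l - 2^j < 2^j" using that by auto
      then show ?thesis using Q(2) 4 by (simp add: S_def)
    qed
  qed
  moreover have "S i \<subseteq> W \<and> a \<le> card (S i)" if "i < 2 ^ Suc j" for i
    using S[OF that] P(1) Q(1) AB(1,2) by auto
  ultimately show ?case by (intro exI[of _ S] conjI allI impI) blast+
qed

section \<open>Local selection and Ramsey-type lemmas\<close>

text \<open>Processing the pairs in \<open>Q\<close> one at a time costs each vertex one application of the loss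
  function \<open>f\<close> per pair that contains it.\<close>

lemma local_selection_pairs:
  fixes good :: "'x \<Rightarrow> 'x \<Rightarrow> 'v set \<Rightarrow> 'v set \<Rightarrow> bool"
  assumes "finite Q"
    and deg: "\<And>x. card {e \<in> Q. fst e = x \<or> snd e = x} \<le> D"
    and QX: "\<And>x y. (x, y) \<in> Q \<Longrightarrow> x \<in> X \<and> y \<in> X \<and> x \<noteq> y"
    and A: "\<And>x. x \<in> X \<Longrightarrow> (f ^^ D) m \<le> card (A x)"
    and step: "\<And>x y S T k l. (x, y) \<in> Q \<Longrightarrow> S \<subseteq> A x \<Longrightarrow> T \<subseteq> A y \<Longrightarrow> f k \<le> card S \<Longrightarrow> f l \<le> card T \<Longrightarrow>
        \<exists>S' T'. S' \<subseteq> S \<and> T' \<subseteq> T \<and> k \<le> card S' \<and> l \<le> card T' \<and> good x y S' T'"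
    and hered: "\<And>x y S T S' T'. good x y S T \<Longrightarrow> S' \<subseteq> S \<Longrightarrow> T' \<subseteq> T \<Longrightarrow> good x y S' T'"
  shows "\<exists>A'. (\<forall>x. A' x \<subseteq> A x) \<and>
    (\<forall>x\<in>X. (f ^^ (D - card {e \<in> Q. fst e = x \<or> snd e = x})) m \<le> card (A' x)) \<and>
    (\<forall>x y. (x, y) \<in> Q \<longrightarrow> good x y (A' x) (A' y))"
  using assms(1-3,5)
proof (induction Q)
  case empty
  then show ?case using A by (intro exI[of _ A]) auto
next
  case (insert e Q)
  obtain x y where e: "e = (x, y)" by (cases e)
  let ?d = "\<lambda>Q x. card {e \<in> Q. fst e = x \<or> snd e = x}"
  have sub: "?d Q z \<le> ?d (insert e Q) z" for z
    using insert.hyps(1) by (intro card_mono) auto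
  have dQ: "?d Q z \<le> D" for z using sub insert.prems(1) le_trans by blast
  have "\<exists>A'. (\<forall>x. A' x \<subseteq> A x) \<and> (\<forall>z\<in>X. (f ^^ (D - ?d Q z)) m \<le> card (A' z)) \<and>
    (\<forall>x y. (x, y) \<in> Q \<longrightarrow> good x y (A' x) (A' y))"
    by (rule insert.IH[OF dQ]) (use insert.prems in auto)
  then obtain A' where A': "\<And>x. A' x \<subseteq> A x" "\<And>z. z \<in> X \<Longrightarrow> (f ^^ (D - ?d Q z)) m \<le> card (A' z)"
    "\<And>x y. (x, y) \<in> Q \<Longrightarrow> good x y (A' x) (A' y)"
    by blast
  have xy: "x \<in> X" "y \<in> X" "x \<noteq> y" using insert.prems(2)[of x y] e by auto
  have d1: "?d (insert e Q) z = (if z = x \<or> z = y then Suc (?d Q z) else ?d Q z)" for z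
  proof -
    have "{e' \<in> insert e Q. fst e' = z \<or> snd e' = z} =
      (if z = x \<or> z = y then insert e {e \<in> Q. fst e = z \<or> snd e = z} else {e \<in> Q. fst e = z \<or> snd e = z})"
      using e by auto
    then show ?thesis using insert.hyps by simp
  qed
  \<comment> \<open>The sizes to be kept after \<open>e\<close> is treated: one application of
    \<open>f\<close> fewer for its two endpoints, unchanged for all others.\<close>
  define k where "k z = (f ^^ (D - ?d (insert e Q) z)) m" for z
  have fk: "f (k z) \<le> card (A' z)" if "z = x \<or> z = y" for z
  proof -
    have "D - ?d Q z = Suc (D - ?d (insert e Q) z)"
      using d1[of z] that insert.prems(1)[of z] by simp
    then have "f (k z) = (f ^^ (D - ?d Q z)) m" unfolding k_def by simp
    then show ?thesis using A'(2)[of z] xy that by auto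
  qed
  obtain S T where ST: "S \<subseteq> A' x" "T \<subseteq> A' y" "k x \<le> card S" "k y \<le> card T" "good x y S T"
    using insert.prems(3)[of x y "A' x" "A' y" "k x" "k y"] A'(1) fk e by auto
  define A'' where "A'' = A'(x := S, y := T)"
  have A''sub: "A'' z \<subseteq> A' z" for z using ST unfolding A''_def by auto
  have "k z \<le> card (A'' z)" if "z \<in> X" for z
  proof (cases "z = x \<or> z = y")
    case True
    then show ?thesis using ST xy unfolding A''_def by auto
  next
    case False
    then have "k z = (f ^^ (D - ?d Q z)) m" using d1[of z] unfolding k_def by simp
    then show ?thesis using A'(2)[OF that] False unfolding A''_def by simp
  qed
  moreover have "good u v (A'' u) (A'' v)" if "(u, v) \<in> insert e Q" for u v
  proof (cases "(u, v) = e")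
    case True
    then show ?thesis using ST xy e unfolding A''_def by auto
  next
    case False
    then show ?thesis using that A'(3)[of u v] hered A''sub by blast
  qed
  moreover have "A'' z \<subseteq> A z" for z using A''sub A'(1) by blast
  ultimately show ?case unfolding k_def by (intro exI[of _ A'']) blast
qed

text \<open>Serves twice: to make close pairs of cliques homogeneous and to make index sets of close
  tuples disjoint. The size required depends on the local degree \<open>D\<close> and not on
  \<open>card X\<close>, which keeps the cliques of constant size.\<close>

lemma local_selection:
  fixes good :: "nat \<Rightarrow> nat \<Rightarrow> 'v set \<Rightarrow> 'v set \<Rightarrow> bool"
  assumes fin: "finite X" and sym: "sym P"
    and deg: "\<And>x. x \<in> X \<Longrightarrow> card (P `` {x} \<inter> X) \<le> D"
    and A: "\<And>x. x \<in> X \<Longrightarrow> (f ^^ D) m \<le> card (A x)"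
    and inc: "\<And>k. k \<le> f k"
    and step: "\<And>x y S T k l. x \<in> X \<Longrightarrow> y \<in> X \<Longrightarrow> x < y \<Longrightarrow> (x, y) \<in> P \<Longrightarrow> S \<subseteq> A x \<Longrightarrow> T \<subseteq> A y \<Longrightarrow>
        f k \<le> card S \<Longrightarrow> f l \<le> card T \<Longrightarrow>
        \<exists>S' T'. S' \<subseteq> S \<and> T' \<subseteq> T \<and> k \<le> card S' \<and> l \<le> card T' \<and> good x y S' T'"
    and hered: "\<And>x y S T S' T'. good x y S T \<Longrightarrow> S' \<subseteq> S \<Longrightarrow> T' \<subseteq> T \<Longrightarrow> good x y S' T'"
  shows "\<exists>A'. (\<forall>x\<in>X. A' x \<subseteq> A x \<and> m \<le> card (A' x)) \<and>
    (\<forall>x\<in>X. \<forall>y\<in>X. x < y \<longrightarrow> (x, y) \<in> P \<longrightarrow> good x y (A' x) (A' y))"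
proof -
  define Q where "Q = {(x, y) \<in> X \<times> X. x < y \<and> (x, y) \<in> P}"
  let ?d = "\<lambda>x. card {e \<in> Q. fst e = x \<or> snd e = x}"
  have finQ: "finite Q" unfolding Q_def using fin by (auto intro: finite_subset[of _ "X \<times> X"])
  have d: "?d x \<le> D" for x
  proof (cases "x \<in> X")
    case True
    let ?g = "\<lambda>e. if fst e = x then snd e else fst e"
    have inj: "inj_on ?g {e \<in> Q. fst e = x \<or> snd e = x}"
      unfolding inj_on_def Q_def by (auto split: if_splits)
    have "?g ` {e \<in> Q. fst e = x \<or> snd e = x} \<subseteq> P `` {x} \<inter> X"
      unfolding Q_def using sym by (auto dest: symD)
    then have "?d x \<le> card (P `` {x} \<inter> X)"
      using card_inj_on_le[OF inj] fin by blast
    then show ?thesis using deg[OF True] by simp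
  next
    case False
    then have "{e \<in> Q. fst e = x \<or> snd e = x} = {}" unfolding Q_def by auto
    then show ?thesis by (simp only: card.empty le0)
  qed
  have "\<exists>A'. (\<forall>x. A' x \<subseteq> A x) \<and> (\<forall>x\<in>X. (f ^^ (D - ?d x)) m \<le> card (A' x)) \<and>
    (\<forall>x y. (x, y) \<in> Q \<longrightarrow> good x y (A' x) (A' y))"
    by (rule local_selection_pairs[OF finQ d _ A _ hered])
      (use step in \<open>auto simp: Q_def\<close>)
  then obtain A' where A': "\<And>x. A' x \<subseteq> A x" "\<And>x. x \<in> X \<Longrightarrow> (f ^^ (D - ?d x)) m \<le> card (A' x)"
    "\<And>x y. (x, y) \<in> Q \<Longrightarrow> good x y (A' x) (A' y)"
    by blast
  have "m \<le> (f ^^ i) m" for i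
    by (induction i) (use le_trans[OF _ inc] in auto)
  then have "m \<le> card (A' x)" if "x \<in> X" for x using A'(2)[OF that] le_trans by blast
  then show ?thesis using A' by (intro exI[of _ A']) (auto simp: Q_def)
qed

text \<open>The side with the smaller target chooses first; removing its choice costs the other side
  no more than the other side's own target.\<close>

lemma disjoint_selection:
  fixes S T :: "'a set"
  assumes "finite S" "finite T" "2 * k \<le> card S" "2 * l \<le> card T"
  shows "\<exists>S' T'. S' \<subseteq> S \<and> T' \<subseteq> T \<and> k \<le> card S' \<and> l \<le> card T' \<and> S' \<inter> T' = {}"
proof (cases "l \<le> k")
  case True
  obtain T' where T': "T' \<subseteq> T" "card T' = l" "finite T'"
    using obtain_subset_with_card_n[of l T] assms by auto
  then have "k \<le> card (S - T')" using assms True diff_card_le_card_Diff[of T' S] by linarith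
  then show ?thesis using T' by (intro exI[of _ "S - T'"] exI[of _ T']) auto
next
  case False
  obtain S' where S': "S' \<subseteq> S" "card S' = k" "finite S'"
    using obtain_subset_with_card_n[of k S] assms by auto
  then have "l \<le> card (T - S')" using assms False diff_card_le_card_Diff[of S' T] by linarith
  then show ?thesis using S' by (intro exI[of _ S'] exI[of _ "T - S'"]) auto
qed

text \<open>Pigeonhole: \<open>2 * l\<close> fixed elements of \<open>T\<close> admit
  \<open>4 ^ l\<close> patterns, so \<open>k\<close> elements of \<open>S\<close> share one, and
  this pattern or its complement has \<open>l\<close> elements.\<close>

lemma homogeneous_pair_asym:
  assumes fin: "finite S" "finite T" and S: "k * 4 ^ l \<le> card S" and T: "2 * l \<le> card T"
  shows "\<exists>S' T'. S' \<subseteq> S \<and> T' \<subseteq> T \<and> k \<le> card S' \<and> l \<le> card T' \<and>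
    ((\<forall>x\<in>S'. \<forall>y\<in>T'. r x y) \<or> (\<forall>x\<in>S'. \<forall>y\<in>T'. \<not> r x y))"
proof -
  obtain T0 where T0: "T0 \<subseteq> T" "card T0 = 2 * l" "finite T0"
    using obtain_subset_with_card_n[OF T] by auto
  define pat where "pat x = {y \<in> T0. r x y}" for x
  have "\<exists>p \<in> Pow T0. k \<le> card {x \<in> S. pat x = p}"
  proof (rule ccontr)
    assume "\<not> ?thesis"
    then have lt: "\<And>p. p \<in> Pow T0 \<Longrightarrow> card {x \<in> S. pat x = p} < k" by (meson not_le)
    have "pat x \<in> Pow T0" for x unfolding pat_def by blast
    then have "S = (\<Union>p \<in> Pow T0. {x \<in> S. pat x = p})" by blast
    also have "card \<dots> \<le> (\<Sum>p \<in> Pow T0. card {x \<in> S. pat x = p})"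
      using T0 by (intro card_UN_le) simp
    also have "\<dots> < (\<Sum>p \<in> Pow T0. k)"
      using lt T0 by (intro sum_strict_mono) auto
    also have "\<dots> = k * 4 ^ l"
      using T0 by (simp add: card_Pow power_mult)
    finally show False using S by simp
  qed
  then obtain p where p: "p \<subseteq> T0" "k \<le> card {x \<in> S. pat x = p}" by auto
  have "card p + card (T0 - p) = 2 * l"
    using p T0 by (metis card_Diff_subset card_mono finite_subset le_add_diff_inverse)
  then consider "l \<le> card p" | "l \<le> card (T0 - p)" by linarith
  then show ?thesis
  proof cases
    case 1
    then show ?thesis using p T0
      by (intro exI[of _ "{x \<in> S. pat x = p}"] exI[of _ p]) (auto simp: pat_def)
  next
    case 2
    then show ?thesis using p T0
      by (intro exI[of _ "{x \<in> S. pat x = p}"] exI[of _ "T0 - p"]) (auto simp: pat_def)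
  qed
qed

text \<open>The smaller target serves as the exponent in the asymmetric version. The size required
  of either side then depends on its own target only, which is the form of loss that
  \<open>local_selection\<close> allows.\<close>

lemma homogeneous_pair:
  assumes fin: "finite S" "finite T" and S: "2 * k + k * 4 ^ k \<le> card S" and T: "2 * l + l * 4 ^ l \<le> card T"
  shows "\<exists>S' T'. S' \<subseteq> S \<and> T' \<subseteq> T \<and> k \<le> card S' \<and> l \<le> card T' \<and>
    ((\<forall>x\<in>S'. \<forall>y\<in>T'. r x y) \<or> (\<forall>x\<in>S'. \<forall>y\<in>T'. \<not> r x y))"
proof (cases "l \<le> k")
  case True
  then have "k * 4 ^ l \<le> k * (4::nat) ^ k" by (intro mult_left_mono power_increasing) auto
  then have "k * 4 ^ l \<le> card S" "2 * l \<le> card T" using S T by linarith+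
  then show ?thesis using homogeneous_pair_asym[OF fin] by blast
next
  case False
  then have "l * 4 ^ k \<le> l * (4::nat) ^ l" by (intro mult_left_mono power_increasing) auto
  then have "l * 4 ^ k \<le> card T" "2 * k \<le> card S" using S T by linarith+
  then obtain T' S' where "T' \<subseteq> T" "S' \<subseteq> S" "l \<le> card T'" "k \<le> card S'"
    "(\<forall>y\<in>T'. \<forall>x\<in>S'. r x y) \<or> (\<forall>y\<in>T'. \<forall>x\<in>S'. \<not> r x y)"
    using homogeneous_pair_asym[OF fin(2,1), of l k "\<lambda>y x. r x y"] by blast
  then show ?thesis by blast
qed

text \<open>Ramsey's theorem after numbering the colours in \<open>K\<close>. With
  \<open>2 \<le> L\<close> the clique contains a pair, and this is what places its colour in
  \<open>K\<close>. The bound \<open>t\<close> is uniform in \<open>S\<close>, \<open>K\<close> and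
  \<open>\<chi>\<close>.\<close>

lemma monochromatic_clique:
  fixes L s :: nat
  assumes L: "2 \<le> L"
  shows "\<exists>t. \<forall>(S :: 'v set) (K :: nat set) \<chi>. finite S \<and> t \<le> card S \<and> finite K \<and> card K \<le> s \<and>
     (\<forall>u\<in>S. \<forall>v\<in>S. u \<noteq> v \<longrightarrow> \<chi> {u, v} \<in> K) \<longrightarrow>
     (\<exists>S' i. S' \<subseteq> S \<and> card S' = L \<and> i \<in> K \<and> (\<forall>u\<in>S'. \<forall>v\<in>S'. u \<noteq> v \<longrightarrow> \<chi> {u, v} = i))"
proof -
  obtain N :: nat where N: "partn_lst {..<N} (replicate (Suc s) L) 2"
    using ramsey_full by blast
  show ?thesis
  proof (rule exI[of _ N], intro allI impI)
    fix S :: "'v set" and K :: "nat set" and \<chi> :: "'v set \<Rightarrow> nat"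
    assume H: "finite S \<and> N \<le> card S \<and> finite K \<and> card K \<le> s \<and>
     (\<forall>u\<in>S. \<forall>v\<in>S. u \<noteq> v \<longrightarrow> \<chi> {u, v} \<in> K)"
    then obtain g where g: "bij_betw g {..<card S} S"
      using ex_bij_betw_nat_finite by (metis atLeast0LessThan)
    obtain e where e: "bij_betw e K {..<card K}"
      using ex_bij_betw_finite_nat H by (metis atLeast0LessThan)
    have inj: "inj_on g {..<N}"
      using g H by (auto simp: bij_betw_def intro: inj_on_subset)
    have gS: "g ` {..<N} \<subseteq> S" using g H by (auto simp: bij_betw_def)
    define \<psi> where "\<psi> p = e (\<chi> (g ` p))" for p
    have col: "\<chi> (g ` p) \<in> K" if p: "p \<in> [{..<N}]\<^bsup>2\<^esup>" for p
    proof -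
      obtain x y where xy: "p = {x, y}" "x \<in> {..<N}" "y \<in> {..<N}" "x \<noteq> y"
        using p by (auto elim: nsets2_E)
      then have "g x \<noteq> g y" "g x \<in> S" "g y \<in> S" using inj gS by (auto simp: inj_on_def)
      then show ?thesis using H xy by auto
    qed
    have "\<psi> \<in> [{..<N}]\<^bsup>2\<^esup> \<rightarrow> {..<Suc s}"
    proof
      fix p assume "p \<in> [{..<N}]\<^bsup>2\<^esup>"
      then have "\<psi> p \<in> {..<card K}" using col e unfolding \<psi>_def bij_betw_def by auto
      then show "\<psi> p \<in> {..<Suc s}" using H by auto
    qed
    then obtain i H' where "i < Suc s" "H' \<in> [{..<N}]\<^bsup>(replicate (Suc s) L ! i)\<^esup>"
      and psi: "\<psi> ` [H']\<^bsup>2\<^esup> \<subseteq> {i}"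
      by (rule partn_lstE[OF N]) auto
    then have iH: "H' \<in> [{..<N}]\<^bsup>L\<^esup>" by (simp del: replicate_Suc)
    have H'N: "H' \<subseteq> {..<N}" "card H' = L" using iH by (auto simp: nsets_def)
    have injH: "inj_on g H'" using inj H'N inj_on_subset by blast
    have pair: "\<chi> {g x, g y} \<in> K \<and> e (\<chi> {g x, g y}) = i" if "x \<in> H'" "y \<in> H'" "x \<noteq> y" for x y
    proof -
      have p: "{x, y} \<in> [H']\<^bsup>2\<^esup>" using that by simp
      then have "{x, y} \<in> [{..<N}]\<^bsup>2\<^esup>" using H'N that by auto
      then have "\<chi> (g ` {x, y}) \<in> K" by (rule col)
      moreover have "\<psi> {x, y} = i" using p psi by blast
      ultimately show ?thesis by (simp add: \<psi>_def)
    qed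
    have "\<exists>j \<in> K. \<forall>u\<in>g ` H'. \<forall>v\<in>g ` H'. u \<noteq> v \<longrightarrow> \<chi> {u, v} = j"
    proof -
      have "finite H'" "\<not> card H' \<le> Suc 0" using L H'N by (auto intro: finite_subset)
      then obtain x y where xy: "x \<in> H'" "y \<in> H'" "x \<noteq> y"
        by (auto simp: card_le_Suc0_iff_eq)
      have "\<chi> {g u, g v} = \<chi> {g x, g y}" if "u \<in> H'" "v \<in> H'" "u \<noteq> v" for u v
        using pair[OF that] pair[OF xy] e by (auto simp: bij_betw_def inj_on_def)
      then show ?thesis using pair[OF xy] by (intro bexI[of _ "\<chi> {g x, g y}"]) auto
    qed
    then show "\<exists>S' i. S' \<subseteq> S \<and> card S' = L \<and> i \<in> K \<and> (\<forall>u\<in>S'. \<forall>v\<in>S'. u \<noteq> v \<longrightarrow> \<chi> {u, v} = i)"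
      using H'N gS card_image[OF injH] by (intro exI[of _ "g ` H'"]) auto
  qed
qed

lemma card_relpow_Image_le:
  assumes "\<And>x. finite (E `` {x})" "\<And>x. card (E `` {x}) \<le> D"
  shows "finite ((E\<^sup>= ^^ r) `` {x}) \<and> card ((E\<^sup>= ^^ r) `` {x}) \<le> (D + 1) ^ r"
proof (induction r)
  case 0
  then show ?case by simp
next
  case (Suc r)
  have eq: "(E\<^sup>= ^^ Suc r) `` {x} = (\<Union>y \<in> (E\<^sup>= ^^ r) `` {x}. insert y (E `` {y}))"
    by (auto simp: relcomp_unfold)
  have 1: "card (insert y (E `` {y})) \<le> D + 1" for y
    using card_insert_le_m1[of "D + 1" "E `` {y}" y] assms by simp
  have "card ((E\<^sup>= ^^ Suc r) `` {x}) \<le> (\<Sum>y \<in> (E\<^sup>= ^^ r) `` {x}. card (insert y (E `` {y})))"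
    unfolding eq using Suc by (intro card_UN_le) auto
  also have "\<dots> \<le> card ((E\<^sup>= ^^ r) `` {x}) * (D + 1)"
    using sum_bounded_above[of "(E\<^sup>= ^^ r) `` {x}", OF 1] by simp
  also have "\<dots> \<le> (D + 1) ^ r * (D + 1)" using Suc by (intro mult_right_mono) auto
  finally have "card ((E\<^sup>= ^^ Suc r) `` {x}) \<le> (D + 1) ^ Suc r" by (simp add: mult.commute)
  moreover have "finite ((E\<^sup>= ^^ Suc r) `` {x})" unfolding eq using Suc assms by auto
  ultimately show ?case by blast
qed

section \<open>Sparse joined graphs\<close>

definition joined :: "nat \<Rightarrow> 'x set \<Rightarrow> ('x \<times> 'x) set \<Rightarrow> bool" where
  "joined h X E \<longleftrightarrow> (\<forall>A B. A \<subseteq> X \<and> B \<subseteq> X \<and> card X \<le> h * card A \<and> card X \<le> h * card B \<longrightarrow>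
     (\<exists>a\<in>A. \<exists>b\<in>B. (a, b) \<in> E))"

lemma joinedD:
  assumes "joined h X E" "A \<subseteq> X" "B \<subseteq> X" "card X \<le> h * card A" "card X \<le> h * card B"
  shows "\<exists>a\<in>A. \<exists>b\<in>B. (a, b) \<in> E"
  using assms unfolding joined_def by simp

text \<open>For the union bound: \<open>2 * g * card V\<close> random edges miss a fixed pair of
  sets with probability below \<open>(1 / 4) ^ card V\<close>, and there are at most
  \<open>4 ^ card V\<close> pairs.\<close>

lemma one_minus_inverse_power_less_quarter:
  assumes "0 < (g::nat)"
  shows "(1 - 1 / real g) ^ (2 * g) < 1 / 4"
proof -
  have "1 + (- 1 / real g) \<le> exp (- 1 / real g)" by (rule exp_ge_add_one_self)
  then have "(1 - 1 / real g) ^ (2 * g) \<le> exp (- 1 / real g) ^ (2 * g)"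
    using assms by (intro power_mono) auto
  also have "\<dots> = exp (- 2)" using assms by (simp flip: exp_of_nat_mult)
  also have "\<dots> < 1 / 4"
  proof -
    have "1 + 2 + 2\<^sup>2 / 2 \<le> exp (2::real)" by (rule exp_lower_Taylor_quadratic) simp
    then show ?thesis by (simp add: exp_minus field_simps)
  qed
  finally show ?thesis .
qed

text \<open>First moment method, phrased as counting the maps from an index set of size
  \<open>2 * g * card V\<close> to \<open>Q\<close>.\<close>

lemma sparse_hitting_subset:
  assumes fin: "finite V" "V \<noteq> {}" and Q: "Q \<subseteq> V \<times> V" "Q \<noteq> {}" and F: "F \<subseteq> Pow V"
    and g: "0 < g"
    and hit: "\<And>S T. S \<in> F \<Longrightarrow> T \<in> F \<Longrightarrow> card Q \<le> g * card (Q \<inter> S \<times> T)"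
  shows "\<exists>E \<subseteq> Q. card E \<le> 2 * g * card V \<and> (\<forall>S\<in>F. \<forall>T\<in>F. E \<inter> S \<times> T \<noteq> {})"
proof (rule ccontr)
  assume contra: "\<not> ?thesis"
  define k where "k = 2 * g * card V"
  define c where "c = card Q"
  have finQ: "finite Q" using Q fin finite_subset by blast
  have c0: "0 < c" unfolding c_def using finQ Q by (simp add: card_gt_0_iff)
  have finF: "finite F" by (rule finite_subset[OF F]) (use fin in simp)
  have V0: "0 < card V" using fin by (simp add: card_gt_0_iff)
  \<comment> \<open>The samples that avoid the rectangle given by \<open>p\<close>. If no sample met
    all rectangles, these sets would cover all samples.\<close>
  let ?Bad = "\<lambda>p. {..<k} \<rightarrow>\<^sub>E (Q - fst p \<times> snd p)"
  have "{..<k} \<rightarrow>\<^sub>E Q \<subseteq> (\<Union>p \<in> F \<times> F. ?Bad p)"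
  proof
    fix f assume f: "f \<in> {..<k} \<rightarrow>\<^sub>E Q"
    have "f ` {..<k} \<subseteq> Q" using f by (meson PiE_mem image_subsetI)
    moreover have "card (f ` {..<k}) \<le> k" using card_image_le[of "{..<k}" f] by simp
    ultimately obtain S T where ST: "S \<in> F" "T \<in> F" "f ` {..<k} \<inter> S \<times> T = {}"
      using contra unfolding k_def by blast
    then have "f \<in> ?Bad (S, T)" using f by (fastforce simp: PiE_iff)
    then show "f \<in> (\<Union>p \<in> F \<times> F. ?Bad p)" using ST by blast
  qed
  then have "card ({..<k} \<rightarrow>\<^sub>E Q) \<le> card (\<Union>p \<in> F \<times> F. ?Bad p)"
    using finF finQ by (intro card_mono finite_UN_I finite_PiE) auto
  also have "\<dots> \<le> (\<Sum>p \<in> F \<times> F. card (?Bad p))"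
    using finF by (intro card_UN_le) auto
  finally have le: "c ^ k \<le> (\<Sum>p \<in> F \<times> F. card (Q - fst p \<times> snd p) ^ k)"
    by (simp add: card_PiE c_def)
  let ?q = "(1 - 1 / real g) ^ k"
  have each: "real (card (Q - fst p \<times> snd p) ^ k) \<le> real c ^ k * ?q" if p: "p \<in> F \<times> F" for p
  proof -
    have "card (Q - fst p \<times> snd p) + card (Q \<inter> fst p \<times> snd p) = c"
      unfolding c_def using finQ by (metis add.commute card_Int_Diff)
    moreover have "real c \<le> real g * real (card (Q \<inter> fst p \<times> snd p))"
      using hit[of "fst p" "snd p"] p unfolding c_def by (metis mem_Times_iff of_nat_le_iff of_nat_mult)
    then have "real c / real g \<le> real (card (Q \<inter> fst p \<times> snd p))"
      using g by (simp add: field_simps)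
    ultimately have "real (card (Q - fst p \<times> snd p)) \<le> real c * (1 - 1 / real g)"
      by (simp add: algebra_simps)
    then have "real (card (Q - fst p \<times> snd p)) ^ k \<le> (real c * (1 - 1 / real g)) ^ k"
      by (intro power_mono) auto
    then show ?thesis by (simp add: power_mult_distrib)
  qed
  have q0: "0 \<le> ?q" using g by simp
  have cardF: "card (F \<times> F) \<le> 4 ^ card V"
  proof -
    have "card F \<le> card (Pow V)" using fin by (intro card_mono[OF _ F]) simp
    then have "card F \<le> 2 ^ card V" unfolding card_Pow[OF fin(1)] .
    from mult_le_mono[OF this this] have "card F * card F \<le> 2 ^ card V * 2 ^ card V" .
    then show ?thesis by (simp add: card_cartesian_product flip: power_mult_distrib)
  qed
  have "real c ^ k \<le> real (\<Sum>p \<in> F \<times> F. card (Q - fst p \<times> snd p) ^ k)"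
    using le unfolding of_nat_power[symmetric] of_nat_le_iff .
  also have "\<dots> \<le> (\<Sum>p \<in> F \<times> F. real c ^ k * ?q)"
    unfolding of_nat_sum by (rule sum_mono) (rule each)
  also have "\<dots> = real (card (F \<times> F)) * (real c ^ k * ?q)" by simp
  also have "\<dots> \<le> real (4 ^ card V) * (real c ^ k * ?q)"
    using cardF q0 by (intro mult_right_mono) (auto simp flip: of_nat_le_iff)
  also have "\<dots> = real c ^ k * (4 * (1 - 1 / real g) ^ (2 * g)) ^ card V"
    unfolding k_def power_mult power_mult_distrib[of "4 :: real"] of_nat_power by simp
  also have "\<dots> < real c ^ k * 1"
  proof (rule mult_strict_left_mono)
    have "0 \<le> 4 * (1 - 1 / real g) ^ (2 * g)" using g by simp
    moreover have "4 * (1 - 1 / real g) ^ (2 * g) < 1"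
      using one_minus_inverse_power_less_quarter[OF g] by linarith
    ultimately show "(4 * (1 - 1 / real g) ^ (2 * g)) ^ card V < 1"
      using V0 by (subst power_less_one_iff) auto
  qed (use c0 in simp)
  finally show False by simp
qed

text \<open>A hitting set of \<open>2 * g * card V\<close> pairs, made symmetric, has average degree
  at most \<open>4 * g\<close>, so at most half of the vertices exceed \<open>8 * g\<close>; these
  are deleted. A \<open>1 / h\<close> fraction of the rest is a \<open>1 / (2 * h)\<close> fraction
  of \<open>V\<close>, hence the \<open>2 * h\<close> in \<open>hit\<close>.\<close>

lemma sparse_joined_subgraph:
  assumes fin: "finite V" "V \<noteq> {}" and Q: "Q \<subseteq> V \<times> V" "Q \<noteq> {}" and g: "0 < g"
    and hit: "\<And>S T. S \<subseteq> V \<Longrightarrow> T \<subseteq> V \<Longrightarrow> card V \<le> 2 * h * card S \<Longrightarrow> card V \<le> 2 * h * card T \<Longrightarrow>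
      card Q \<le> g * card (Q \<inter> S \<times> T)"
  shows "\<exists>X E. X \<subseteq> V \<and> card V \<le> 2 * card X \<and> E \<subseteq> X \<times> X \<and> sym E \<and> E \<subseteq> Q \<union> Q\<inverse> \<and>
    (\<forall>x\<in>X. card (E `` {x}) \<le> 8 * g) \<and> joined h X E"
proof -
  define F where "F = {S. S \<subseteq> V \<and> card V \<le> 2 * h * card S}"
  have "\<exists>E \<subseteq> Q. card E \<le> 2 * g * card V \<and> (\<forall>S\<in>F. \<forall>T\<in>F. E \<inter> S \<times> T \<noteq> {})"
    by (rule sparse_hitting_subset[OF fin Q _ g]) (use hit in \<open>auto simp: F_def\<close>)
  then obtain E0 where E0: "E0 \<subseteq> Q" "card E0 \<le> 2 * g * card V" "\<And>S T. S \<in> F \<Longrightarrow> T \<in> F \<Longrightarrow> E0 \<inter> S \<times> T \<noteq> {}"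
    by blast
  define E1 where "E1 = E0 \<union> E0\<inverse>"
  have E1V: "E1 \<subseteq> V \<times> V" using E0 Q unfolding E1_def by auto
  have finE1: "finite E1" using E1V fin finite_subset by blast
  have cE1: "card E1 \<le> 4 * g * card V"
    using card_Un_le[of E0 "E0\<inverse>"] E0(2) by (simp add: E1_def)
  have "E1 = Sigma V (\<lambda>x. E1 `` {x})" using E1V by auto
  moreover have "card (Sigma V (\<lambda>x. E1 `` {x})) = (\<Sum>x\<in>V. card (E1 `` {x}))"
    using fin finE1 by (intro card_SigmaI) auto
  ultimately have sum: "(\<Sum>x\<in>V. card (E1 `` {x})) = card E1" by simp
  define H where "H = {x \<in> V. 8 * g < card (E1 `` {x})}"
  have HV: "H \<subseteq> V" "finite H" using fin unfolding H_def by auto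
  have "card H * (8 * g) \<le> (\<Sum>x\<in>H. card (E1 `` {x}))"
    using sum_bounded_below[of H "8 * g" "\<lambda>x. card (E1 `` {x})"] unfolding H_def by auto
  also have "\<dots> \<le> (\<Sum>x\<in>V. card (E1 `` {x}))"
    using HV fin by (intro sum_mono2) auto
  also have "\<dots> \<le> 4 * g * card V" using sum cE1 by simp
  finally have "(4 * g) * (2 * card H) \<le> (4 * g) * card V" by (simp add: algebra_simps)
  then have H2: "2 * card H \<le> card V" using g by simp
  define X where "X = V - H"
  have cX: "card V \<le> 2 * card X" using H2 HV card_Diff_subset[of H V] unfolding X_def by auto
  define E where "E = E1 \<inter> X \<times> X"
  have "card (E `` {x}) \<le> 8 * g" if "x \<in> X" for x
  proof -
    have "card (E `` {x}) \<le> card (E1 `` {x})"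
      using finE1 unfolding E_def by (intro card_mono) auto
    then show ?thesis using that unfolding X_def H_def by auto
  qed
  moreover have "joined h X E" unfolding joined_def
  proof (intro allI impI, elim conjE)
    fix A B assume A: "A \<subseteq> X" "card X \<le> h * card A" and B: "B \<subseteq> X" "card X \<le> h * card B"
    have "A \<in> F" "B \<in> F" using A B cX unfolding F_def X_def by auto
    then show "\<exists>a\<in>A. \<exists>b\<in>B. (a, b) \<in> E"
      using E0(3) A B unfolding E_def E1_def by blast
  qed
  moreover have "sym E" unfolding E_def E1_def by (auto simp: sym_def)
  ultimately show ?thesis using E0(1) cX
    by (intro exI[of _ X] exI[of _ E]) (auto simp: E_def E1_def X_def)
qed

section \<open>Edge counts between large sets, extremal pairs and local tuples\<close>

text \<open>Fewer than \<open>card X / h\<close> vertices of \<open>A\<close> have no neighbour in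
  \<open>B\<close>, and \<open>A\<close> has at least twice as many elements; each of the others
  yields an edge.\<close>

lemma joined_edge_count:
  assumes fin: "finite X" "X \<noteq> {}" and E: "finite E" and J: "joined h X E" and A: "A \<subseteq> X" "2 * card X \<le> h * card A"
    and B: "B \<subseteq> X" "2 * card X \<le> h * card B"
  shows "card X \<le> h * card (E \<inter> A \<times> B)"
proof -
  define A0 where "A0 = {a \<in> A. \<forall>b\<in>B. (a, b) \<notin> E}"
  have A0X: "A0 \<subseteq> X" using A(1) by (auto simp: A0_def)
  have hB: "card X \<le> h * card B" using B by simp
  have "\<not> card X \<le> h * card A0"
    using joinedD[OF J A0X B(1) _ hB] unfolding A0_def by auto
  moreover have finA: "finite A" by (rule finite_subset[OF A(1) fin(1)])
  have A0A: "A0 \<subseteq> A" by (auto simp: A0_def)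
  have "card A = card A0 + card (A - A0)"
    using card_Diff_subset[OF finite_subset[OF A0A finA] A0A] card_mono[OF finA A0A] by simp
  ultimately have "card X \<le> h * card (A - A0)" using A by (simp add: algebra_simps)
  also have "card (A - A0) \<le> card (fst ` (E \<inter> A \<times> B))"
    using E by (intro card_mono) (force simp: A0_def image_iff)+
  also have "\<dots> \<le> card (E \<inter> A \<times> B)" using E by (intro card_image_le) auto
  finally show ?thesis by simp
qed

text \<open>The pair minimises \<open>e(A, B) / card A ^ \<gamma>\<close>. Comparing with \<open>(Y, Y)\<close>
  shows that it cannot be small.\<close>

lemma extremal_pair:
  assumes fin: "finite X" "X \<noteq> {}" and E: "E \<subseteq> X \<times> X" and J: "joined h X E" and Y: "Y \<subseteq> X" "2 * card X \<le> h * card Y"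
    and deg: "\<And>x. x \<in> X \<Longrightarrow> card (E `` {x}) \<le> D" and D: "D * h \<le> w ^ \<gamma>" and \<gamma>: "0 < \<gamma>"
  shows "\<exists>A B. A \<subseteq> Y \<and> B \<subseteq> Y \<and> card A = card B \<and> card Y \<le> w * card A \<and>
    (\<forall>A' B' l. A' \<subseteq> A \<and> B' \<subseteq> B \<and> card A \<le> l * card A' \<and> card A \<le> l * card B' \<and>
       2 * card X \<le> h * card A' \<and> 2 * card X \<le> h * card B' \<longrightarrow>
       0 < card (E \<inter> A' \<times> B') \<and> card (E \<inter> A \<times> B) \<le> l ^ \<gamma> * card (E \<inter> A' \<times> B'))"
proof -
  have finY: "finite Y" using Y fin finite_subset by blast
  have finE: "finite E" using E fin finite_subset by blast
  have X0: "0 < card X" using fin by (simp add: card_gt_0_iff)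
  define e where "e p = card (E \<inter> fst p \<times> snd p)" for p
  define \<Phi> where "\<Phi> p = real (e p) / real (card (fst p)) ^ \<gamma>" for p
  \<comment> \<open>Equal sizes let \<open>\<Phi>\<close> depend on one cardinality only, and the
    lower bound on the size makes \<open>joined_edge_count\<close> applicable.\<close>
  define \<S> where "\<S> = {p \<in> Pow Y \<times> Pow Y. card (fst p) = card (snd p) \<and> 2 * card X \<le> h * card (fst p)}"
  have finS: "finite \<S>" unfolding \<S>_def using finY by auto
  have YS: "(Y, Y) \<in> \<S>" unfolding \<S>_def using Y by auto
  obtain p where p: "p \<in> \<S>" and min: "\<And>p'. p' \<in> \<S> \<Longrightarrow> \<Phi> p \<le> \<Phi> p'"
    using ex_min_if_finite[of "\<Phi> ` \<S>"] finS YS by (metis (no_types, opaque_lifting) empty_iff finite_imageI image_iff linorder_not_less)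
  obtain A B where AB: "p = (A, B)" by (cases p)
  have AY: "A \<subseteq> Y" "B \<subseteq> Y" "card A = card B" "2 * card X \<le> h * card A"
    using p unfolding \<S>_def AB by auto
  have cmp: "e (A, B) * card A' ^ \<gamma> \<le> e (A', B') * card A ^ \<gamma>" if "(A', B') \<in> \<S>" for A' B'
  proof -
    have pos: "0 < card A'" "0 < card A"
      using that AY X0 unfolding \<S>_def by (auto intro: Nat.gr0I)
    have "real (e (A, B)) / real (card A) ^ \<gamma> \<le> real (e (A', B')) / real (card A') ^ \<gamma>"
      using min[OF that] unfolding \<Phi>_def AB by simp
    then have "real (e (A, B)) * real (card A') ^ \<gamma> \<le> real (e (A', B')) * real (card A) ^ \<gamma>"
      using pos by (simp add: field_simps)
    then show ?thesis by (metis of_nat_le_iff of_nat_mult of_nat_power)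
  qed
  have Y0: "0 < card Y" using Y X0 by (auto intro: Nat.gr0I)
  have eY: "e (Y, Y) \<le> card Y * D"
  proof -
    have "E \<inter> Y \<times> Y = Sigma Y (\<lambda>x. E `` {x} \<inter> Y)" by auto
    then have "e (Y, Y) = (\<Sum>x\<in>Y. card (E `` {x} \<inter> Y))"
      unfolding e_def using finY by simp
    also have "\<dots> \<le> (\<Sum>x\<in>Y. D)"
    proof (rule sum_mono)
      fix x assume "x \<in> Y"
      then have "card (E `` {x}) \<le> D" using Y deg by auto
      moreover have "card (E `` {x} \<inter> Y) \<le> card (E `` {x})"
        using finE by (intro card_mono) auto
      ultimately show "card (E `` {x} \<inter> Y) \<le> D" by simp
    qed
    finally show ?thesis by simp
  qed
  have count: "card X \<le> h * e (A', B')" if "A' \<subseteq> Y" "B' \<subseteq> Y" "2 * card X \<le> h * card A'" "2 * card X \<le> h * card B'" for A' B'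
    unfolding e_def using joined_edge_count[OF fin finE J] that Y by auto
  have "card Y * card Y ^ \<gamma> \<le> card X * card Y ^ \<gamma>"
    using Y fin by (intro mult_right_mono card_mono) auto
  also have "\<dots> \<le> (h * e (A, B)) * card Y ^ \<gamma>"
    using count[of A B] AY by (intro mult_right_mono) auto
  also have "\<dots> \<le> h * (e (Y, Y) * card A ^ \<gamma>)"
    using mult_left_mono[OF cmp[OF YS], of h] by (simp add: algebra_simps)
  also have "\<dots> \<le> h * (card Y * D * card A ^ \<gamma>)"
    using eY by (intro mult_left_mono mult_right_mono) auto
  also have "\<dots> = card Y * ((D * h) * card A ^ \<gamma>)" by simp
  also have "\<dots> \<le> card Y * (w ^ \<gamma> * card A ^ \<gamma>)"
    using D by (intro mult_left_mono mult_right_mono) auto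
  finally have "card Y ^ \<gamma> \<le> (w * card A) ^ \<gamma>" using Y0 by (simp add: power_mult_distrib)
  then have big: "card Y \<le> w * card A" using \<gamma> by (simp add: power_mono_iff)
  have res: "0 < e (A', B') \<and> e (A, B) \<le> l ^ \<gamma> * e (A', B')"
    if H: "A' \<subseteq> A" "B' \<subseteq> B" "card A \<le> l * card A'" "card A \<le> l * card B'"
      "2 * card X \<le> h * card A'" "2 * card X \<le> h * card B'" for A' B' l
  proof -
    \<comment> \<open>\<open>A'\<close> and \<open>B'\<close> may differ in size. Trimming both to
      the smaller size gives a competitor in \<open>\<S>\<close> and can only lose edges.\<close>
    define a where "a = min (card A') (card B')"
    obtain A'' where A'': "A'' \<subseteq> A'" "card A'' = a"
      using obtain_subset_with_card_n[of a A'] unfolding a_def by (metis min.cobounded1)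
    obtain B'' where B'': "B'' \<subseteq> B'" "card B'' = a"
      using obtain_subset_with_card_n[of a B'] unfolding a_def by (metis min.cobounded2)
    have a: "card A \<le> l * a" "2 * card X \<le> h * a" using H unfolding a_def by (auto simp: min_def)
    have "(A'', B'') \<in> \<S>" unfolding \<S>_def using A'' B'' H AY a by auto
    from cmp[OF this] have "e (A, B) * a ^ \<gamma> \<le> e (A'', B'') * card A ^ \<gamma>" using A'' by simp
    also have "\<dots> \<le> e (A'', B'') * (l * a) ^ \<gamma>" using a by (intro mult_left_mono power_mono) auto
    finally have "e (A, B) * a ^ \<gamma> \<le> (l ^ \<gamma> * e (A'', B'')) * a ^ \<gamma>"
      by (simp add: power_mult_distrib algebra_simps)
    moreover have "0 < a" using a X0 by (auto intro: Nat.gr0I)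
    ultimately have 1: "e (A, B) \<le> l ^ \<gamma> * e (A'', B'')" by simp
    have 2: "e (A'', B'') \<le> e (A', B')"
      unfolding e_def using finE A'' B'' by (intro card_mono) auto
    have "card X \<le> h * e (A'', B'')" using count[of A'' B''] A'' B'' H AY a by auto
    then have "0 < e (A'', B'')" using X0 by (auto intro: Nat.gr0I)
    then show ?thesis using 1 2 by (meson le_trans less_le_trans mult_le_mono2)
  qed
  show ?thesis
  proof (rule exI[of _ A], rule exI[of _ B], intro conjI allI impI)
    fix A' B' l
    assume "A' \<subseteq> A \<and> B' \<subseteq> B \<and> card A \<le> l * card A' \<and> card A \<le> l * card B' \<and>
       2 * card X \<le> h * card A' \<and> 2 * card X \<le> h * card B'"
    then have "0 < e (A', B') \<and> e (A, B) \<le> l ^ \<gamma> * e (A', B')" by (intro res) simp_all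
    then show "0 < card (E \<inter> A' \<times> B')" "card (E \<inter> A \<times> B) \<le> l ^ \<gamma> * card (E \<inter> A' \<times> B')"
      unfolding e_def by simp_all
  qed (use AY big in simp_all)
qed

text \<open>Greedy choice. Without the vertices already used, each \<open>U i\<close> still has a
  \<open>1 / h\<close> fraction of \<open>X\<close>, so fewer than \<open>card X / h\<close>
  vertices have no neighbour in it. As \<open>p < h\<close>, some \<open>z\<close> has a neighbour
  in every coordinate; these neighbours form the next tuple.\<close>

lemma disjoint_local_tuples:
  assumes fin: "finite X" "X \<noteq> {}" and J: "joined h X E" and p: "p < h"
    and U: "\<And>i. i < p \<Longrightarrow> U i \<subseteq> X \<and> card X + h * M \<le> h * card (U i)"
  shows "\<exists>u. (\<forall>\<tau><M. \<forall>i<p. u \<tau> i \<in> U i) \<and> (\<forall>i<p. inj_on (\<lambda>\<tau>. u \<tau> i) {..<M}) \<and>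
    (\<forall>\<tau><M. \<exists>z. \<forall>i<p. (z, u \<tau> i) \<in> E)"
  using U
proof (induction M)
  case 0
  then show ?case by auto
next
  case (Suc M)
  have "U i \<subseteq> X \<and> card X + h * M \<le> h * card (U i)" if "i < p" for i
    using Suc.prems[OF that] by simp
  then have "\<exists>u. (\<forall>\<tau><M. \<forall>i<p. u \<tau> i \<in> U i) \<and> (\<forall>i<p. inj_on (\<lambda>\<tau>. u \<tau> i) {..<M}) \<and>
    (\<forall>\<tau><M. \<exists>z. \<forall>i<p. (z, u \<tau> i) \<in> E)"
    by (rule Suc.IH)
  then obtain u where
    u0: "\<forall>\<tau><M. \<forall>i<p. u \<tau> i \<in> U i" "\<forall>i<p. inj_on (\<lambda>\<tau>. u \<tau> i) {..<M}"
    "\<forall>\<tau><M. \<exists>z. \<forall>i<p. (z, u \<tau> i) \<in> E"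
    by (elim exE conjE)
  have u: "u \<tau> i \<in> U i" if "\<tau> < M" "i < p" for \<tau> i using u0(1) that by simp
  define U' where "U' i = U i - (\<lambda>\<tau>. u \<tau> i) ` {..<M}" for i
  define Z where "Z i = {z \<in> X. \<forall>v \<in> U' i. (z, v) \<notin> E}" for i
  have Z: "h * card (Z i) \<le> card X" if "i < p" for i
  proof -
    have "card (U i) \<le> card (U' i) + M"
      using diff_card_le_card_Diff[of "(\<lambda>\<tau>. u \<tau> i) ` {..<M}" "U i"] card_image_le[of "{..<M}" "\<lambda>\<tau>. u \<tau> i"]
      unfolding U'_def by simp
    then have "h * card (U i) \<le> h * card (U' i) + h * M"
      by (metis add_mult_distrib2 mult_le_mono2)
    then have hU: "card X \<le> h * card (U' i)" using Suc.prems[OF that] by simp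
    have UX: "U' i \<subseteq> X" using Suc.prems[OF that] unfolding U'_def by auto
    have ZX: "Z i \<subseteq> X" unfolding Z_def by auto
    have "\<not> card X \<le> h * card (Z i)"
      using joinedD[OF J ZX UX _ hU] unfolding Z_def by auto
    then show ?thesis by simp
  qed
  have "h * card (\<Union>i<p. Z i) \<le> h * (\<Sum>i<p. card (Z i))"
    by (intro mult_left_mono card_UN_le) auto
  also have "\<dots> \<le> (\<Sum>i<p. card X)" unfolding sum_distrib_left by (intro sum_mono) (use Z in auto)
  also have "\<dots> < h * card X" using p fin by (simp add: card_gt_0_iff)
  finally have "card (\<Union>i<p. Z i) < card X" by simp
  moreover have "finite (\<Union>i<p. Z i)" using fin unfolding Z_def by auto
  ultimately have "\<not> X \<subseteq> (\<Union>i<p. Z i)" using card_mono leD by blast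
  then obtain z where z: "z \<in> X" "\<And>i. i < p \<Longrightarrow> z \<notin> Z i" by auto
  then have "\<forall>i. \<exists>v. i < p \<longrightarrow> v \<in> U' i \<and> (z, v) \<in> E" unfolding Z_def by auto
  then obtain v where v: "\<And>i. i < p \<Longrightarrow> v i \<in> U' i \<and> (z, v i) \<in> E" by metis
  let ?u = "u(M := v)"
  have "?u \<tau> i \<in> U i" if "\<tau> < Suc M" "i < p" for \<tau> i
    using that u[of \<tau> i] v[of i] unfolding U'_def by (auto simp: less_Suc_eq)
  moreover have "inj_on (\<lambda>\<tau>. ?u \<tau> i) {..<Suc M}" if "i < p" for i
  proof -
    have "v i \<noteq> u \<tau> i" if "\<tau> < M" for \<tau> using v[OF \<open>i < p\<close>] that unfolding U'_def by auto
    moreover have "inj_on (\<lambda>\<tau>. u \<tau> i) {..<M}" using u0(2) that by simp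
    ultimately show ?thesis by (auto simp: inj_on_def less_Suc_eq) metis+
  qed
  moreover have "\<exists>z. \<forall>i<p. (z, ?u \<tau> i) \<in> E" if "\<tau> < Suc M" for \<tau>
    using that u0(3) v by (cases "\<tau> = M") auto
  ultimately show ?case by (intro exI[of _ ?u]) simp
qed

text \<open>Sampling from all pairs: two sets of density \<open>1 / (2 * h)\<close> span a
  \<open>1 / (2 * h) ^ 2\<close> fraction of them, which gives degree
  \<open>8 * (2 * h) ^ 2\<close>. This is the degree bound with \<open>B = 32\<close> and
  \<open>b = 2\<close> from which the final host is built.\<close>

lemma sparse_joined_graph_exists:
  assumes "0 < N" "0 < h"
  shows "\<exists>X E. X \<subseteq> {..<N} \<and> N \<le> 2 * card X \<and> E \<subseteq> X \<times> X \<and> sym E \<and>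
    (\<forall>x\<in>X. card (E `` {x}) \<le> 32 * h ^ 2) \<and> joined h X E"
proof -
  have "\<exists>X E. X \<subseteq> {..<N} \<and> card {..<N} \<le> 2 * card X \<and> E \<subseteq> X \<times> X \<and> sym E \<and>
    E \<subseteq> {..<N} \<times> {..<N} \<union> ({..<N} \<times> {..<N})\<inverse> \<and>
    (\<forall>x\<in>X. card (E `` {x}) \<le> 8 * (2 * h) ^ 2) \<and> joined h X E"
  proof (rule sparse_joined_subgraph)
    fix S T assume S: "S \<subseteq> {..<N}" "T \<subseteq> {..<N}" "card {..<N} \<le> 2 * h * card S" "card {..<N} \<le> 2 * h * card T"
    have "N * N \<le> (2 * h * card S) * (2 * h * card T)"
      using S by (intro mult_mono) auto
    moreover have "{..<N} \<times> {..<N} \<inter> S \<times> T = S \<times> T" using S by auto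
    ultimately show "card ({..<N} \<times> {..<N}) \<le> (2 * h)\<^sup>2 * card ({..<N} \<times> {..<N} \<inter> S \<times> T)"
      by (simp add: card_cartesian_product power2_eq_square algebra_simps)
  qed (use assms in auto)
  then show ?thesis by (auto simp: power_mult_distrib)
qed

section \<open>Monochromatic blow-ups\<close>

definition mono_blowup :: "nat \<Rightarrow> (nat set \<Rightarrow> nat) \<Rightarrow> nat set \<Rightarrow> nat \<Rightarrow> (nat \<Rightarrow> nat) \<Rightarrow> bool" where
  "mono_blowup m \<chi> K n par \<longleftrightarrow> (\<exists>i\<in>K. \<exists>D.
     (\<forall>j<n. finite (D j) \<and> m \<le> card (D j)) \<and> (\<forall>j<n. \<forall>l<n. j \<noteq> l \<longrightarrow> D j \<inter> D l = {}) \<and>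
     (\<forall>j<n. \<forall>u\<in>D j. \<forall>v\<in>D j. u \<noteq> v \<longrightarrow> \<chi> {u, v} = i) \<and>
     (\<forall>j. 0 < j \<and> j < n \<longrightarrow> (\<forall>u\<in>D (par j). \<forall>v\<in>D j. \<chi> {u, v} = i)))"

text \<open>No host graph is kept: a pair counts as an edge if its colour lies in \<open>K\<close>,
  so replacing \<open>K\<close> by \<open>K - {i}\<close> deletes a colour class. Walks of length
  \<open>r\<close> in the reflexive closure express distance at most \<open>r\<close>, and the case
  \<open>x = y\<close> covers the inside of a clique.\<close>

definition blown_up ::
  "nat \<Rightarrow> nat \<Rightarrow> nat set \<Rightarrow> (nat \<times> nat) set \<Rightarrow> (nat \<Rightarrow> nat set) \<Rightarrow> nat set \<Rightarrow> (nat set \<Rightarrow> nat) \<Rightarrow> bool" where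
  "blown_up t r X E C K \<chi> \<longleftrightarrow>
     (\<forall>x\<in>X. finite (C x) \<and> t \<le> card (C x)) \<and> (\<forall>x\<in>X. \<forall>y\<in>X. x \<noteq> y \<longrightarrow> C x \<inter> C y = {}) \<and>
     (\<forall>x\<in>X. \<forall>y\<in>X. (x, y) \<in> E\<^sup>= ^^ r \<longrightarrow> (\<forall>u\<in>C x. \<forall>v\<in>C y. u \<noteq> v \<longrightarrow> \<chi> {u, v} \<in> K))"

text \<open>\<open>B\<close> and \<open>b\<close> fix the form of the degree bound before
  \<open>h\<close> is chosen; \<open>z\<close> is the number of cliques required per vertex of the
  tree.\<close>

definition ramsey_host :: "nat \<Rightarrow> nat \<Rightarrow> nat \<Rightarrow> nat \<Rightarrow> nat \<Rightarrow> nat \<Rightarrow> nat \<Rightarrow> nat \<Rightarrow> nat \<Rightarrow> bool" where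
  "ramsey_host m d s B b h r t z \<longleftrightarrow> (\<forall>X E C K \<chi> n par.
     finite X \<and> E \<subseteq> X \<times> X \<and> sym E \<and> (\<forall>x\<in>X. card (E `` {x}) \<le> B * h ^ b) \<and> joined h X E \<and>
     blown_up t r X E C K \<chi> \<and> finite K \<and> card K \<le> s \<and> rooted_tree d n par \<and> z * n \<le> card X \<longrightarrow>
     mono_blowup m \<chi> K n par)"

lemma reflcl_relpow_refl: "(x, x) \<in> E\<^sup>= ^^ r"
  by (induction r) auto

lemma relpow_subset_reflcl_relpow: "E ^^ i \<subseteq> E\<^sup>= ^^ i"
  by (induction i) auto

lemma sym_reflcl_relpow:
  fixes E :: "('a \<times> 'a) set"
  assumes "sym E"
  shows "sym (E\<^sup>= ^^ r)"
proof -
  have "(R ^^ r)\<inverse> = R ^^ r" if "R\<inverse> = R" for R :: "('a \<times> 'a) set"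
    by (induction r) (simp_all add: converse_relcomp that relpow_commute)
  moreover have "(E\<^sup>=)\<inverse> = E\<^sup>=" using assms by (auto simp: sym_def)
  ultimately have "(E\<^sup>= ^^ r)\<inverse> = E\<^sup>= ^^ r" by blast
  then show ?thesis by (simp add: sym_conv_converse_eq)
qed

lemma pigeonhole_fibre:
  assumes "finite X" "X \<noteq> {}" "finite K" "\<kappa> ` X \<subseteq> K"
  shows "\<exists>i\<in>K. card X \<le> card K * card {x \<in> X. \<kappa> x = i}"
proof (rule ccontr)
  assume "\<not> ?thesis"
  then have lt: "\<And>i. i \<in> K \<Longrightarrow> card K * card {x \<in> X. \<kappa> x = i} < card X" by (meson not_le)
  have "K \<noteq> {}" using assms by auto
  have "X = (\<Union>i\<in>K. {x \<in> X. \<kappa> x = i})" using assms(4) by auto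
  also have "card \<dots> \<le> (\<Sum>i\<in>K. card {x \<in> X. \<kappa> x = i})" using assms(3) by (intro card_UN_le)
  finally have "card K * card X \<le> (\<Sum>i\<in>K. card K * card {x \<in> X. \<kappa> x = i})"
    by (simp flip: sum_distrib_left)
  also have "\<dots> < (\<Sum>i\<in>K. card X)" using lt \<open>K \<noteq> {}\<close> assms(3) by (intro sum_strict_mono) auto
  finally show False by simp
qed

section \<open>Passing to one colour\<close>

text \<open>The majority colour costs the factor \<open>s\<close>. A clique has at most
  \<open>(D + 1) ^ r\<close> cliques within distance \<open>r\<close>, and each of them may cost one
  application of the loss function of \<open>homogeneous_pair\<close>; hence the iterate in the size
  of the monochromatic cliques.\<close>

lemma refine_to_one_colour:
  assumes fin: "finite X" "X \<noteq> {}" and E: "E \<subseteq> X \<times> X" "sym E"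
    and deg: "\<And>x. x \<in> X \<Longrightarrow> card (E `` {x}) \<le> D"
    and mc: "\<And>(S :: nat set) (K :: nat set) \<chi>. finite S \<and> t \<le> card S \<and> finite K \<and> card K \<le> s \<and>
       (\<forall>u\<in>S. \<forall>v\<in>S. u \<noteq> v \<longrightarrow> \<chi> {u, v} \<in> K) \<longrightarrow>
       (\<exists>S' i. S' \<subseteq> S \<and> card S' = ((\<lambda>k. 2 * k + k * 4 ^ k) ^^ ((D + 1) ^ r)) m \<and> i \<in> K \<and>
          (\<forall>u\<in>S'. \<forall>v\<in>S'. u \<noteq> v \<longrightarrow> \<chi> {u, v} = i))"
    and bl: "blown_up t r X E C K \<chi>" and K: "finite K" "card K \<le> s"
  shows "\<exists>i\<in>K. \<exists>W A. W \<subseteq> X \<and> card X \<le> s * card W \<and>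
    (\<forall>x\<in>W. A x \<subseteq> C x \<and> m \<le> card (A x) \<and> (\<forall>u\<in>A x. \<forall>v\<in>A x. u \<noteq> v \<longrightarrow> \<chi> {u, v} = i)) \<and>
    (\<forall>x\<in>W. \<forall>y\<in>W. x \<noteq> y \<longrightarrow> (x, y) \<in> E\<^sup>= ^^ r \<longrightarrow>
      (\<forall>u\<in>A x. \<forall>v\<in>A y. \<chi> {u, v} = i) \<or> (\<forall>u\<in>A x. \<forall>v\<in>A y. \<chi> {u, v} \<noteq> i))"
proof -
  define f where "f = (\<lambda>k::nat. 2 * k + k * 4 ^ k)"
  let ?P = "E\<^sup>= ^^ r"
  define Pr where "Pr x S' i \<longleftrightarrow> S' \<subseteq> C x \<and> card S' = (f ^^ ((D + 1) ^ r)) m \<and> i \<in> K \<and>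
          (\<forall>u\<in>S'. \<forall>v\<in>S'. u \<noteq> v \<longrightarrow> \<chi> {u, v} = i)" for x S' i
  have "\<forall>x\<in>X. \<exists>S' i. Pr x S' i"
  proof
    fix x assume "x \<in> X"
    then show "\<exists>S' i. Pr x S' i"
      unfolding f_def Pr_def
      by (intro mp[OF mc]) (use bl K reflcl_relpow_refl[of x r E] in \<open>auto simp: blown_up_def\<close>)
  qed
  then have "\<exists>S. \<forall>x\<in>X. \<exists>i. Pr x (S x) i" by (rule bchoice)
  then obtain S where "\<forall>x\<in>X. \<exists>i. Pr x (S x) i" by (elim exE)
  then have "\<exists>\<kappa>. \<forall>x\<in>X. Pr x (S x) (\<kappa> x)" by (rule bchoice)
  then obtain \<kappa> where "\<forall>x\<in>X. Pr x (S x) (\<kappa> x)" by (elim exE)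
  then have S: "\<And>x. x \<in> X \<Longrightarrow> S x \<subseteq> C x" "\<And>x. x \<in> X \<Longrightarrow> card (S x) = (f ^^ ((D + 1) ^ r)) m"
    "\<And>x. x \<in> X \<Longrightarrow> \<kappa> x \<in> K" "\<And>x u v. x \<in> X \<Longrightarrow> u \<in> S x \<Longrightarrow> v \<in> S x \<Longrightarrow> u \<noteq> v \<Longrightarrow> \<chi> {u, v} = \<kappa> x"
    unfolding Pr_def by simp_all
  obtain i where i: "i \<in> K" "card X \<le> card K * card {x \<in> X. \<kappa> x = i}"
    using pigeonhole_fibre[OF fin K(1), of \<kappa>] S(3) by blast
  define W where "W = {x \<in> X. \<kappa> x = i}"
  have WX: "W \<subseteq> X" "finite W" using fin unfolding W_def by auto
  have cW: "card X \<le> s * card W"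
    using i(2) K(2) unfolding W_def by (meson le_trans mult_le_mono1)
  have finE: "finite E" using E fin finite_subset by blast
  have degE: "card (E `` {x}) \<le> D" for x
  proof (cases "x \<in> X")
    case False
    then have "E `` {x} = {}" using E by auto
    then show ?thesis by simp
  qed (rule deg)
  have finE1: "finite (E `` {x})" for x using finE by (rule finite_Image)
  have degP: "card (?P `` {x} \<inter> W) \<le> (D + 1) ^ r" for x
  proof -
    have fp: "finite (?P `` {x})" "card (?P `` {x}) \<le> (D + 1) ^ r"
      using card_relpow_Image_le[OF finE1 degE] by auto
    have "card (?P `` {x} \<inter> W) \<le> card (?P `` {x})" using fp by (intro card_mono) auto
    then show ?thesis using fp by simp
  qed
  have finS: "finite (S x)" if "x \<in> X" for x
    using S(1)[OF that] bl that finite_subset unfolding blown_up_def by blast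
  have "\<exists>A. (\<forall>x\<in>W. A x \<subseteq> S x \<and> m \<le> card (A x)) \<and>
    (\<forall>x\<in>W. \<forall>y\<in>W. x < y \<longrightarrow> (x, y) \<in> ?P \<longrightarrow>
      (\<forall>u\<in>A x. \<forall>v\<in>A y. \<chi> {u, v} = i) \<or> (\<forall>u\<in>A x. \<forall>v\<in>A y. \<chi> {u, v} \<noteq> i))"
  proof (rule local_selection[OF WX(2) sym_reflcl_relpow[OF E(2)] degP, where f = f and
      good = "\<lambda>x y S T. (\<forall>u\<in>S. \<forall>v\<in>T. \<chi> {u, v} = i) \<or> (\<forall>u\<in>S. \<forall>v\<in>T. \<chi> {u, v} \<noteq> i)"])
    show "(f ^^ (D + 1) ^ r) m \<le> card (S x)" if "x \<in> W" for x using S(2) WX that by auto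
    show "k \<le> f k" for k unfolding f_def by simp
    fix x y S' T k l
    assume H: "x \<in> W" "y \<in> W" "S' \<subseteq> S x" "T \<subseteq> S y" "f k \<le> card S'" "f l \<le> card T"
    have "finite S'" "finite T" using H finS WX finite_subset by blast+
    then show "\<exists>S'' T'. S'' \<subseteq> S' \<and> T' \<subseteq> T \<and> k \<le> card S'' \<and> l \<le> card T' \<and>
      ((\<forall>u\<in>S''. \<forall>v\<in>T'. \<chi> {u, v} = i) \<or> (\<forall>u\<in>S''. \<forall>v\<in>T'. \<chi> {u, v} \<noteq> i))"
      by (rule homogeneous_pair) (use H in \<open>auto simp: f_def\<close>)
  qed blast
  then obtain A where A0: "\<forall>x\<in>W. A x \<subseteq> S x \<and> m \<le> card (A x)"
    "\<forall>x\<in>W. \<forall>y\<in>W. x < y \<longrightarrow> (x, y) \<in> ?P \<longrightarrow>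
      (\<forall>u\<in>A x. \<forall>v\<in>A y. \<chi> {u, v} = i) \<or> (\<forall>u\<in>A x. \<forall>v\<in>A y. \<chi> {u, v} \<noteq> i)"
    by (elim exE conjE)
  note A = bspec[OF A0(1)] A0(2)[rule_format]
  have pairs: "(\<forall>u\<in>A x. \<forall>v\<in>A y. \<chi> {u, v} = i) \<or> (\<forall>u\<in>A x. \<forall>v\<in>A y. \<chi> {u, v} \<noteq> i)"
    if "x \<in> W" "y \<in> W" "x \<noteq> y" "(x, y) \<in> ?P" for x y
  proof (cases "x < y")
    case True
    show ?thesis by (rule A(2)[OF that(1,2) True that(4)])
  next
    case False
    then have "y < x" "(y, x) \<in> ?P" using that sym_reflcl_relpow[OF E(2)] by (auto dest: symD)
    from A(2)[OF that(2,1) this] show ?thesis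
    proof
      assume H: "\<forall>u\<in>A y. \<forall>v\<in>A x. \<chi> {u, v} = i"
      have "\<chi> {u, v} = i" if "u \<in> A x" "v \<in> A y" for u v
        using H that by (subst insert_commute) simp
      then show ?thesis by simp
    next
      assume H: "\<forall>u\<in>A y. \<forall>v\<in>A x. \<chi> {u, v} \<noteq> i"
      have "\<chi> {u, v} \<noteq> i" if "u \<in> A x" "v \<in> A y" for u v
        using H that by (subst insert_commute) simp
      then show ?thesis by simp
    qed
  qed
  have "A x \<subseteq> C x \<and> m \<le> card (A x) \<and> (\<forall>u\<in>A x. \<forall>v\<in>A x. u \<noteq> v \<longrightarrow> \<chi> {u, v} = i)" if "x \<in> W" for x
  proof -
    have "x \<in> X" "\<kappa> x = i" using that unfolding W_def by auto
    then show ?thesis using A(1)[OF that] S(1,4) by blast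
  qed
  then show ?thesis using i(1) WX cW pairs
    by - (rule bexI[of _ i], rule exI[of _ W], rule exI[of _ A], simp_all)
qed

section \<open>The new host on tuples\<close>

text \<open>Besides its \<open>q\<close> entries in the parts, every tuple gets two auxiliary
  coordinates, in the extremal sets \<open>A\<close> and \<open>B\<close>. Tuples are linked when
  the first auxiliary coordinate of one is adjacent to the second of the other, so large sets of
  tuples become large subsets of \<open>A\<close> and \<open>B\<close>, where extremality supplies
  edges. Thus \<open>w\<close> influences the number of tuples but not the degree bound.\<close>

lemma tuple_graph:
  fixes X :: "'x set"
  assumes fin: "finite X" and E: "E \<subseteq> X \<times> X" "sym E" and J: "joined (w\<^sup>2) X E"
    and deg: "\<And>x. x \<in> X \<Longrightarrow> card (E `` {x}) \<le> D" and D: "D * w\<^sup>2 \<le> w ^ \<gamma>" and \<gamma>: "0 < \<gamma>"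
    and P: "\<And>i. i < q \<Longrightarrow> P i \<subseteq> X \<and> x0 \<le> card (P i)"
    and q: "q + 2 < w\<^sup>2" and x0: "0 < x0" "x0 \<le> card X" "card X \<le> 2 * y * x0"
    and w: "16 * y * h \<le> w" "w\<^sup>2 \<le> card X" and h: "0 < h"
  shows "\<exists>(u :: nat \<Rightarrow> nat \<Rightarrow> 'x) X' E'. finite X' \<and> x0 \<le> 4 * w * card X' \<and> E' \<subseteq> X' \<times> X' \<and> sym E' \<and>
    (\<forall>x\<in>X'. card (E' `` {x}) \<le> 8 * (4 * h) ^ \<gamma>) \<and> joined h X' E' \<and>
    (\<forall>\<tau>\<in>X'. \<forall>i<q. u \<tau> i \<in> P i) \<and> (\<forall>i<q. inj_on (\<lambda>\<tau>. u \<tau> i) X') \<and>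
    (\<forall>\<tau>\<in>X'. \<forall>i<q. \<forall>j<q. (u \<tau> i, u \<tau> j) \<in> E ^^ 2) \<and>
    (\<forall>\<tau> \<sigma>. (\<tau>, \<sigma>) \<in> E' \<longrightarrow> (\<forall>i<q. \<forall>j<q. (u \<tau> i, u \<sigma> j) \<in> E ^^ 5))"
proof -
  let ?N = "card X"
  have ne: "X \<noteq> {}" using x0 by auto
  have finE: "finite E" using E(1) by (rule finite_subset) (use fin in simp)
  have y0: "0 < y" using x0 by (auto intro: Nat.gr0I)
  have wx: "8 * h * ?N \<le> w * x0"
  proof -
    have "8 * h * ?N \<le> 8 * h * (2 * y * x0)" using x0 by (intro mult_left_mono) auto
    also have "\<dots> = (16 * y * h) * x0" by simp
    also have "\<dots> \<le> w * x0" using w by (intro mult_right_mono) auto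
    finally show ?thesis .
  qed
  have w0: "0 < w" using w h y0 by (auto intro: Nat.gr0I)
  \<comment> \<open>Any set of this size will do; it makes \<open>A\<close> no larger than a part,
    so that the greedy choice has the same room in all coordinates.\<close>
  obtain Y where Y: "Y \<subseteq> X" "card Y = x0" using obtain_subset_with_card_n[OF x0(2)] by auto
  have "2 * ?N \<le> 8 * h * ?N" using h by simp
  also have "\<dots> \<le> w * x0" by (rule wx)
  also have "\<dots> \<le> w\<^sup>2 * card Y" using w0 Y by (simp add: power2_eq_square)
  finally have hY: "2 * ?N \<le> w\<^sup>2 * card Y" .
  have "\<exists>A B. A \<subseteq> Y \<and> B \<subseteq> Y \<and> card A = card B \<and> card Y \<le> w * card A \<and>
    (\<forall>A' B' l. A' \<subseteq> A \<and> B' \<subseteq> B \<and> card A \<le> l * card A' \<and> card A \<le> l * card B' \<and>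
       2 * ?N \<le> w\<^sup>2 * card A' \<and> 2 * ?N \<le> w\<^sup>2 * card B' \<longrightarrow>
       0 < card (E \<inter> A' \<times> B') \<and> card (E \<inter> A \<times> B) \<le> l ^ \<gamma> * card (E \<inter> A' \<times> B'))"
    by (rule extremal_pair[OF fin ne E(1) J Y(1) hY deg D \<gamma>])
  then obtain A B where AB: "A \<subseteq> Y" "B \<subseteq> Y" "card A = card B" "card Y \<le> w * card A"
    and ext: "\<forall>A' B' l. A' \<subseteq> A \<and> B' \<subseteq> B \<and> card A \<le> l * card A' \<and> card A \<le> l * card B' \<and>
       2 * ?N \<le> w\<^sup>2 * card A' \<and> 2 * ?N \<le> w\<^sup>2 * card B' \<longrightarrow>
       0 < card (E \<inter> A' \<times> B') \<and> card (E \<inter> A \<times> B) \<le> l ^ \<gamma> * card (E \<inter> A' \<times> B')"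
    by (elim exE conjE)
  define a where "a = card A"
  \<comment> \<open>Using only half of \<open>A\<close> leaves room for the greedy choice of the
    tuples; \<open>w\<^sup>2 \<le> card X\<close>, between backticks as a hypothesis of the lemma,
    absorbs the rounding.\<close>
  define M where "M = (a + 1) div 2"
  have aM: "a \<le> 2 * M" "2 * M \<le> a + 1" unfolding M_def by auto
  have wa: "8 * h * ?N \<le> w\<^sup>2 * a"
  proof -
    have "8 * h * ?N \<le> w * x0" by (rule wx)
    also have "\<dots> \<le> w * (w * a)" using AB(4) Y unfolding a_def by (intro mult_left_mono) auto
    finally show ?thesis by (simp add: power2_eq_square)
  qed
  have N0: "0 < ?N" using x0 by simp
  have "0 < a" using wa N0 h by (auto intro: Nat.gr0I)
  then have M0: "0 < M" using aM by simp
  have ax: "a \<le> x0" using AB(1) Y fin unfolding a_def by (metis card_mono finite_subset)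
  have room: "?N + w\<^sup>2 * M \<le> w\<^sup>2 * a"
  proof -
    have "8 * ?N \<le> 8 * h * ?N" using h by simp
    then have "3 * ?N \<le> w\<^sup>2 * a" using wa by linarith
    moreover have "w\<^sup>2 * (2 * M) \<le> w\<^sup>2 * (a + 1)" using aM by (intro mult_left_mono) auto
    ultimately show ?thesis using w(2) by (simp add: algebra_simps)
  qed
  define U where "U i = (if i = 0 then A else if i = 1 then B else P (i - 2))" for i :: nat
  have Ui: "U i \<subseteq> X \<and> ?N + w\<^sup>2 * M \<le> w\<^sup>2 * card (U i)" if "i < q + 2" for i
  proof -
    consider "i = 0" | "i = 1" | "2 \<le> i" by linarith
    then have "U i \<subseteq> X \<and> a \<le> card (U i)"
    proof cases
      case 3
      then have "i - 2 < q" using that by linarith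
      then show ?thesis using P[of "i - 2"] ax 3 unfolding U_def by simp
    qed (use AB(1-3) Y(1) in \<open>auto simp: U_def a_def\<close>)
    moreover from this
    have "w\<^sup>2 * a \<le> w\<^sup>2 * card (U i)" by (intro mult_left_mono) auto
    ultimately show ?thesis using room by linarith
  qed
  have "\<exists>v. (\<forall>\<tau><M. \<forall>i<q+2. v \<tau> i \<in> U i) \<and> (\<forall>i<q+2. inj_on (\<lambda>\<tau>. v \<tau> i) {..<M}) \<and>
    (\<forall>\<tau><M. \<exists>z. \<forall>i<q+2. (z, v \<tau> i) \<in> E)"
    by (rule disjoint_local_tuples[OF fin ne J q Ui])
  then obtain v where v0: "\<forall>\<tau><M. \<forall>i<q+2. v \<tau> i \<in> U i" "\<forall>i<q+2. inj_on (\<lambda>\<tau>. v \<tau> i) {..<M}"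
    "\<forall>\<tau><M. \<exists>z. \<forall>i<q+2. (z, v \<tau> i) \<in> E"
    by (elim exE conjE) simp
  have vA: "v \<tau> 0 \<in> A" "v \<tau> 1 \<in> B" if "\<tau> < M" for \<tau> using v0(1) that by (force simp: U_def)+
  have inj0: "inj_on (\<lambda>\<tau>. v \<tau> 0) {..<M}" and inj1: "inj_on (\<lambda>\<tau>. v \<tau> 1) {..<M}" using v0(2) by auto
  have two: "(v \<tau> i, v \<tau> j) \<in> E ^^ 2" if H: "\<tau> < M" "i < q + 2" "j < q + 2" for \<tau> i j
  proof -
    obtain z where "(z, v \<tau> i) \<in> E" "(z, v \<tau> j) \<in> E" using v0(3) H by blast
    then have "(v \<tau> i, z) \<in> E" "(z, v \<tau> j) \<in> E" using E(2) by (auto dest: symD)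
    then show ?thesis by (auto simp: numeral_2_eq_2)
  qed
  define Q where "Q = {(\<tau>, \<sigma>) \<in> {..<M} \<times> {..<M}. (v \<tau> 0, v \<sigma> 1) \<in> E}"
  define g where "g = (\<lambda>(\<tau>, \<sigma>). (v \<tau> 0, v \<sigma> 1))"
  have injg: "inj_on g ({..<M} \<times> {..<M})"
    using inj0 inj1 unfolding g_def inj_on_def by auto
  have gQ: "card (Q \<inter> S \<times> T) = card (E \<inter> (\<lambda>\<tau>. v \<tau> 0) ` S \<times> (\<lambda>\<tau>. v \<tau> 1) ` T)"
    if "S \<subseteq> {..<M}" "T \<subseteq> {..<M}" for S T
  proof -
    have "g ` (Q \<inter> S \<times> T) = E \<inter> (\<lambda>\<tau>. v \<tau> 0) ` S \<times> (\<lambda>\<tau>. v \<tau> 1) ` T"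
    proof
      show "g ` (Q \<inter> S \<times> T) \<subseteq> E \<inter> (\<lambda>\<tau>. v \<tau> 0) ` S \<times> (\<lambda>\<tau>. v \<tau> 1) ` T"
        unfolding g_def Q_def by auto
      show "E \<inter> (\<lambda>\<tau>. v \<tau> 0) ` S \<times> (\<lambda>\<tau>. v \<tau> 1) ` T \<subseteq> g ` (Q \<inter> S \<times> T)"
      proof
        fix e assume "e \<in> E \<inter> (\<lambda>\<tau>. v \<tau> 0) ` S \<times> (\<lambda>\<tau>. v \<tau> 1) ` T"
        then obtain \<tau> \<sigma> where "e = (v \<tau> 0, v \<sigma> 1)" "e \<in> E" "\<tau> \<in> S" "\<sigma> \<in> T" by auto
        then show "e \<in> g ` (Q \<inter> S \<times> T)"
          using that unfolding g_def Q_def by (intro image_eqI[of _ _ "(\<tau>, \<sigma>)"]) auto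
      qed
    qed
    moreover have "inj_on g (Q \<inter> S \<times> T)" by (rule inj_on_subset[OF injg]) (auto simp: Q_def)
    ultimately show ?thesis using card_image by metis
  qed
  have QM: "Q \<subseteq> {..<M} \<times> {..<M}" unfolding Q_def by auto
  have Qle: "card Q \<le> card (E \<inter> A \<times> B)"
  proof -
    have "card Q = card (Q \<inter> {..<M} \<times> {..<M})" using QM by (simp add: Int_absorb2)
    also have "\<dots> \<le> card (E \<inter> A \<times> B)"
      unfolding gQ[OF subset_refl subset_refl] using finE vA by (intro card_mono) auto
    finally show ?thesis .
  qed
  \<comment> \<open>The tuples use at least half of \<open>A\<close>, so a
    \<open>1 / (2 * h)\<close> fraction of them covers a \<open>1 / (4 * h)\<close> fraction of
    \<open>A\<close> or \<open>B\<close>, and extremality applies with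
    \<open>l = 4 * h\<close>.\<close>
  have hit: "0 < card (Q \<inter> S \<times> T) \<and> card Q \<le> (4 * h) ^ \<gamma> * card (Q \<inter> S \<times> T)"
    if H: "S \<subseteq> {..<M}" "T \<subseteq> {..<M}" "M \<le> 2 * h * card S" "M \<le> 2 * h * card T" for S T
  proof -
    let ?A = "(\<lambda>\<tau>. v \<tau> 0) ` S" and ?B = "(\<lambda>\<tau>. v \<tau> 1) ` T"
    have c: "card ?A = card S" "card ?B = card T"
      using H inj_on_subset[OF inj0] inj_on_subset[OF inj1] by (auto simp: card_image)
    have big: "2 * ?N \<le> w\<^sup>2 * k" if "a \<le> 4 * h * k" for k
    proof -
      have "(4 * h) * (2 * ?N) \<le> w\<^sup>2 * a" using wa by simp
      also have "\<dots> \<le> w\<^sup>2 * (4 * h * k)" using that by (intro mult_left_mono) auto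
      finally have "(4 * h) * (2 * ?N) \<le> (4 * h) * (w\<^sup>2 * k)" by (simp only: mult.left_commute)
      then show ?thesis using h by (subst (asm) mult_le_cancel1) simp
    qed
    have "a \<le> 4 * h * card S" "a \<le> 4 * h * card T" using aM H by linarith+
    then have "0 < card (E \<inter> ?A \<times> ?B) \<and> card (E \<inter> A \<times> B) \<le> (4 * h) ^ \<gamma> * card (E \<inter> ?A \<times> ?B)"
      using H vA c big by (intro ext[rule_format]) (auto simp flip: a_def)
    then show ?thesis using Qle gQ[OF H(1,2)] by simp
  qed
  have Qne: "Q \<noteq> {}" using hit[of "{..<M}" "{..<M}"] h by auto
  have "\<exists>X' E'. X' \<subseteq> {..<M} \<and> card {..<M} \<le> 2 * card X' \<and> E' \<subseteq> X' \<times> X' \<and> sym E' \<and> E' \<subseteq> Q \<union> Q\<inverse> \<and>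
    (\<forall>x\<in>X'. card (E' `` {x}) \<le> 8 * (4 * h) ^ \<gamma>) \<and> joined h X' E'"
    by (rule sparse_joined_subgraph[OF _ _ QM Qne]) (use M0 h hit in auto)
  then obtain X' E' where X': "X' \<subseteq> {..<M}" "M \<le> 2 * card X'" "E' \<subseteq> X' \<times> X'" "sym E'" "E' \<subseteq> Q \<union> Q\<inverse>"
    "\<forall>x\<in>X'. card (E' `` {x}) \<le> 8 * (4 * h) ^ \<gamma>" "joined h X' E'"
    by (elim exE conjE) simp
  define u where "u \<tau> i = v \<tau> (i + 2)" for \<tau> i
  \<comment> \<open>Two steps inside \<open>\<tau>\<close> to an auxiliary coordinate, one edge
    across, and two steps inside \<open>\<sigma>\<close>.\<close>
  have step: "(u \<tau> i, u \<sigma> j) \<in> E ^^ 5" if "(\<tau>, \<sigma>) \<in> E'" "i < q" "j < q" for \<tau> \<sigma> i j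
  proof -
    have M: "\<tau> < M" "\<sigma> < M" using that X'(1,3) by auto
    have "(\<tau>, \<sigma>) \<in> Q \<or> (\<sigma>, \<tau>) \<in> Q" using that X'(5) by auto
    then obtain k l where kl: "k < q + 2" "l < q + 2" "(v \<tau> k, v \<sigma> l) \<in> E"
    proof
      assume "(\<tau>, \<sigma>) \<in> Q"
      then show thesis using that[of 0 1] by (auto simp: Q_def)
    next
      assume "(\<sigma>, \<tau>) \<in> Q"
      then have "(v \<tau> 1, v \<sigma> 0) \<in> E" using E(2) by (auto simp: Q_def dest: symD)
      then show thesis using that[of 1 0] by auto
    qed
    have 1: "(v \<tau> (i + 2), v \<tau> k) \<in> E ^^ 2" using two M that kl by simp
    have 2: "(v \<sigma> l, v \<sigma> (j + 2)) \<in> E ^^ 2" using two M that kl by simp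
    have "E ^^ 3 = E O E ^^ 2" by (simp add: numeral_3_eq_3 numeral_2_eq_2 O_assoc)
    then have eq: "E ^^ 5 = E ^^ 2 O (E O E ^^ 2)"
      using relpow_add[of 2 3 E] by simp
    show ?thesis unfolding eq u_def using 1 2 kl(3) by blast
  qed
  have "x0 \<le> w * a" using AB(4) Y a_def by simp
  also have "\<dots> \<le> w * (4 * card X')" using aM X'(2) by (intro mult_left_mono) auto
  finally have "x0 \<le> 4 * w * card X'" by simp
  moreover have "finite X'" using X'(1) by (rule finite_subset) simp
  moreover have "u \<tau> i \<in> P i" if "\<tau> \<in> X'" "i < q" for \<tau> i
  proof -
    have "\<tau> < M" "i + 2 < q + 2" using that X'(1) by auto
    then have "v \<tau> (i + 2) \<in> U (i + 2)" using v0(1) by blast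
    then show ?thesis unfolding u_def U_def by simp
  qed
  moreover have "inj_on (\<lambda>\<tau>. u \<tau> i) X'" if "i < q" for i
  proof -
    have "i + 2 < q + 2" using that by simp
    then have "inj_on (\<lambda>\<tau>. v \<tau> (i + 2)) {..<M}" using v0(2) by blast
    then show ?thesis unfolding u_def by (rule inj_on_subset) (rule X'(1))
  qed
  moreover have "(u \<tau> i, u \<tau> j) \<in> E ^^ 2" if "\<tau> \<in> X'" "i < q" "j < q" for \<tau> i j
    unfolding u_def by (rule two) (use that X'(1) in auto)
  ultimately show ?thesis using X' step
    by - (rule exI[of _ u], rule exI[of _ X'], rule exI[of _ E'], simp)
qed

section \<open>Induction on the number of colours\<close>

lemma mono_blowup_mono: "mono_blowup m \<chi> K n par \<Longrightarrow> K \<subseteq> K' \<Longrightarrow> mono_blowup m \<chi> K' n par"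
  unfolding mono_blowup_def by (elim bexE) (rule bexI, assumption, rule subsetD)

lemma mono_blowup_of_embedding:
  assumes emb: "tree_embeds n par W R" and i: "i \<in> K"
    and A: "\<And>x. x \<in> W \<Longrightarrow> finite (A x) \<and> m \<le> card (A x)"
    and disj: "\<And>x y. x \<in> W \<Longrightarrow> y \<in> W \<Longrightarrow> x \<noteq> y \<Longrightarrow> A x \<inter> A y = {}"
    and inner: "\<And>x u v. x \<in> W \<Longrightarrow> u \<in> A x \<Longrightarrow> v \<in> A x \<Longrightarrow> u \<noteq> v \<Longrightarrow> \<chi> {u, v} = i"
    and cross: "\<And>x y u v. (x, y) \<in> R \<Longrightarrow> u \<in> A x \<Longrightarrow> v \<in> A y \<Longrightarrow> \<chi> {u, v} = i"
  shows "mono_blowup m \<chi> K n par"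
proof -
  obtain \<phi> where \<phi>: "inj_on \<phi> {..<n}" "\<phi> ` {..<n} \<subseteq> W" "\<forall>j. 0 < j \<and> j < n \<longrightarrow> (\<phi> (par j), \<phi> j) \<in> R"
    using emb unfolding tree_embeds_def by (elim exE conjE)
  have W: "\<phi> j \<in> W" if "j < n" for j using \<phi>(2) that by auto
  have ne: "\<phi> j \<noteq> \<phi> l" if "j < n" "l < n" "j \<noteq> l" for j l using \<phi>(1) that by (auto simp: inj_on_def)
  show ?thesis unfolding mono_blowup_def
  proof (rule bexI[OF _ i], rule exI[of _ "\<lambda>j. A (\<phi> j)"], intro conjI allI impI ballI)
    fix j assume "j < n"
    then show "finite (A (\<phi> j))" "m \<le> card (A (\<phi> j))" using A[OF W] by auto
  next
    fix j l assume "j < n" "l < n" "j \<noteq> l"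
    then show "A (\<phi> j) \<inter> A (\<phi> l) = {}" using disj W ne by simp
  next
    fix j u v assume "j < n" "u \<in> A (\<phi> j)" "v \<in> A (\<phi> j)" "u \<noteq> v"
    then show "\<chi> {u, v} = i" using inner[OF W] by simp
  next
    fix j u v assume "0 < j \<and> j < n" "u \<in> A (\<phi> (par j))" "v \<in> A (\<phi> j)"
    then show "\<chi> {u, v} = i" using cross \<phi>(3) by blast
  qed
qed

text \<open>An edge of \<open>E'\<close> costs five steps in \<open>E\<close>; the summand 2 pays
  once for the change from coordinate \<open>i\<close> to \<open>j\<close> inside
  \<open>\<tau>\<close>.\<close>

lemma tuple_graph_distance:
  assumes two: "\<And>\<tau> i j. \<tau> \<in> X' \<Longrightarrow> i < q \<Longrightarrow> j < q \<Longrightarrow> (u \<tau> i, u \<tau> j) \<in> E ^^ 2"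
    and five: "\<And>\<tau> \<sigma> i j. (\<tau>, \<sigma>) \<in> E' \<Longrightarrow> i < q \<Longrightarrow> j < q \<Longrightarrow> (u \<tau> i, u \<sigma> j) \<in> E ^^ 5"
    and \<tau>: "\<tau> \<in> X'" and ij: "i < q" "j < q"
  shows "(\<tau>, \<sigma>) \<in> E'\<^sup>= ^^ r \<Longrightarrow> (u \<tau> i, u \<sigma> j) \<in> E\<^sup>= ^^ (5 * r + 2)"
proof (induction r arbitrary: \<sigma>)
  case 0
  then have "(u \<tau> i, u \<sigma> j) \<in> E ^^ 2" using two[OF \<tau> ij] by simp
  then have "(u \<tau> i, u \<sigma> j) \<in> E\<^sup>= ^^ 2"
    using relpow_subset_reflcl_relpow[of 2 E] by (rule rev_subsetD)
  then show ?case by (simp only: mult_0_right add_0)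
next
  case (Suc r)
  then obtain \<rho> where \<rho>: "(\<tau>, \<rho>) \<in> E'\<^sup>= ^^ r" "(\<rho>, \<sigma>) \<in> E'\<^sup>=" by auto
  have "(u \<rho> j, u \<sigma> j) \<in> E\<^sup>= ^^ 5"
  proof (cases "\<rho> = \<sigma>")
    case True
    then show ?thesis by (simp only: reflcl_relpow_refl)
  next
    case False
    then have "(u \<rho> j, u \<sigma> j) \<in> E ^^ 5" using \<rho>(2) five ij by simp
    then show ?thesis using relpow_subset_reflcl_relpow[of 5 E] by (rule rev_subsetD)
  qed
  from relcompI[OF Suc.IH[OF \<rho>(1)] this] have "(u \<tau> i, u \<sigma> j) \<in> E\<^sup>= ^^ (5 * r + 2 + 5)"
    unfolding relpow_add .
  then show ?case by (simp add: algebra_simps)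
qed

text \<open>Without colours the hypotheses contradict each other: two vertices in a clique would
  need a colour from the empty set \<open>K\<close>.\<close>

lemma ramsey_host_0: "ramsey_host m d 0 B b 1 1 2 1"
  unfolding ramsey_host_def
proof (intro allI impI, elim conjE)
  fix X E C K \<chi> n par
  assume *: "finite X" "blown_up 2 1 X E C K \<chi>" "finite K" "card K \<le> 0" "rooted_tree d n par" "1 * n \<le> card X"
  then have "0 < card X" by (simp add: rooted_tree_def)
  then obtain x where x: "x \<in> X" by (metis card_gt_0_iff ex_in_conv)
  then have "finite (C x)" "\<not> card (C x) \<le> Suc 0" using *(2) unfolding blown_up_def by auto
  then obtain u v where uv: "u \<in> C x" "v \<in> C x" "u \<noteq> v"
    by (auto simp: card_le_Suc0_iff_eq)
  have "(x, x) \<in> E\<^sup>= ^^ 1" by simp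
  then have "\<chi> {u, v} \<in> K" using *(2) x uv unfolding blown_up_def by blast
  then show "mono_blowup m \<chi> K n par" using * by simp
qed

text \<open>The induction hypothesis is taken for the degree bound
  \<open>8 * (4 * h') ^ \<gamma>\<close>, which \<open>tuple_graph\<close> delivers for every
  \<open>w\<close>. So \<open>h'\<close>, \<open>r'\<close>, \<open>t'\<close> and \<open>z'\<close>
  are available before \<open>w\<close>, and \<open>w\<close> before the clique size
  \<open>t\<close>.\<close>

lemma ramsey_host_Suc:
  assumes IH: "ramsey_host m d s (8 * 4 ^ \<gamma>) \<gamma> h' r' t' z'" and \<gamma>: "\<gamma> = 2 * (b + 2)" and h': "0 < h'"
  shows "\<exists>h r t z. 0 < h \<and> 0 < z \<and> ramsey_host m d (Suc s) B b h r t z"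
proof -
  define D' where "D' = 8 * (4 * h') ^ \<gamma>"
  define d' where "d' = (D' + 1) ^ r'"
  \<comment> \<open>An index set may be halved once for each of at most \<open>d'\<close> close
    tuples and must retain \<open>t'\<close> elements.\<close>
  define q where "q = 2 ^ d' * t'"
  \<comment> \<open>The loss in density: a factor \<open>Suc s\<close> for the majority colour and
    \<open>2 * d + 7\<close> for each of \<open>q\<close> splittings, which yield
    \<open>2 ^ q > q\<close> parts.\<close>
  define y where "y = Suc s * (2 * d + 7) ^ q"
  \<comment> \<open>Large enough for \<open>16 * y * h' \<le> w\<close> and
    \<open>q + 2 < w\<^sup>2\<close> in \<open>tuple_graph\<close>, and for \<open>B \<le> w\<close>
    in the estimate \<open>Dw\<close>.\<close>
  define w where "w = 16 * y * h' + B + q + 3"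
  define D where "D = B * (w\<^sup>2) ^ b"
  define r where "r = 5 * r' + 2"
  \<comment> \<open>The bound 2 gives \<open>2 \<le> L\<close> for
    \<open>monochromatic_clique\<close> and makes every \<open>A x\<close> nonempty.\<close>
  define m' where "m' = max m 2"
  define f where "f = (\<lambda>k::nat. 2 * k + k * 4 ^ k)"
  define L where "L = (f ^^ ((D + 1) ^ r)) m'"
  \<comment> \<open>The summands yield in turn parts of size at least \<open>2 * n\<close>, the
    bound \<open>w\<^sup>2 \<le> card X\<close>, and \<open>z' * n\<close> tuples for the induction
    hypothesis.\<close>
  define z where "z = 4 * y + w\<^sup>2 + 8 * w * y * z'"
  have "m' \<le> (f ^^ i) m'" for i
  proof (induction i)
    case (Suc i)
    have "(f ^^ i) m' \<le> f ((f ^^ i) m')" unfolding f_def by simp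
    then show ?case using Suc by simp
  qed simp
  then have "2 \<le> L" unfolding L_def m'_def by (meson le_trans max.cobounded2)
  from monochromatic_clique[OF this, of "Suc s"] obtain t where
    mc: "\<forall>(S :: nat set) (K :: nat set) \<chi>. finite S \<and> t \<le> card S \<and> finite K \<and> card K \<le> Suc s \<and>
     (\<forall>u\<in>S. \<forall>v\<in>S. u \<noteq> v \<longrightarrow> \<chi> {u, v} \<in> K) \<longrightarrow>
     (\<exists>S' i. S' \<subseteq> S \<and> card S' = L \<and> i \<in> K \<and> (\<forall>u\<in>S'. \<forall>v\<in>S'. u \<noteq> v \<longrightarrow> \<chi> {u, v} = i))"
    by (elim exE)
  have y0: "0 < y" unfolding y_def by simp
  have w0: "3 \<le> w" "B \<le> w" "16 * y * h' \<le> w" "q + 3 \<le> w" unfolding w_def by auto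
  have w2: "w \<le> w\<^sup>2" using w0(1) by (simp add: power2_eq_square)
  have Dw: "D * w\<^sup>2 \<le> w ^ \<gamma>"
  proof -
    have "D * w\<^sup>2 = B * (w\<^sup>2) ^ (b + 1)" unfolding D_def by simp
    also have "\<dots> \<le> w\<^sup>2 * (w\<^sup>2) ^ (b + 1)" using w0(2) w2 by (intro mult_right_mono) auto
    also have "\<dots> = (w\<^sup>2) ^ (b + 2)" by simp
    also have "\<dots> = w ^ \<gamma>" unfolding \<gamma> power_mult ..
    finally show ?thesis .
  qed
  have "ramsey_host m d (Suc s) B b (w\<^sup>2) r t z"
    unfolding ramsey_host_def
  proof (intro allI impI, elim conjE)
    fix X E C K \<chi> n par
    assume fin: "finite X" and E: "E \<subseteq> X \<times> X" "sym E" and deg: "\<forall>x\<in>X. card (E `` {x}) \<le> B * (w\<^sup>2) ^ b"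
      and J: "joined (w\<^sup>2) X E" and bl: "blown_up t r X E C K \<chi>" and K: "finite K" "card K \<le> Suc s"
      and T: "rooted_tree d n par" and zn: "z * n \<le> card X"
    let ?N = "card X"
    have degD: "card (E `` {x}) \<le> D" if "x \<in> X" for x using deg that unfolding D_def by simp
    have n0: "0 < n" using T unfolding rooted_tree_def by simp
    have "z \<le> z * n" using n0 by simp
    then have Nz: "z \<le> ?N" using zn by linarith
    have Nn: "4 * y * n \<le> ?N" "8 * w * y * z' * n \<le> ?N"
      using zn unfolding z_def by (simp_all add: algebra_simps)
    have Nw: "w\<^sup>2 \<le> ?N" "y \<le> ?N" using Nz unfolding z_def by auto
    have ne: "X \<noteq> {}" using Nw y0 by auto
    have "\<exists>i\<in>K. \<exists>W A. W \<subseteq> X \<and> ?N \<le> Suc s * card W \<and>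
      (\<forall>x\<in>W. A x \<subseteq> C x \<and> m' \<le> card (A x) \<and> (\<forall>u\<in>A x. \<forall>v\<in>A x. u \<noteq> v \<longrightarrow> \<chi> {u, v} = i)) \<and>
      (\<forall>x\<in>W. \<forall>y\<in>W. x \<noteq> y \<longrightarrow> (x, y) \<in> E\<^sup>= ^^ r \<longrightarrow>
        (\<forall>u\<in>A x. \<forall>v\<in>A y. \<chi> {u, v} = i) \<or> (\<forall>u\<in>A x. \<forall>v\<in>A y. \<chi> {u, v} \<noteq> i))"
      by (rule refine_to_one_colour[OF fin ne E degD mc[THEN spec, THEN spec, THEN spec, unfolded L_def f_def] bl K])
    then obtain i W A where i: "i \<in> K" and W: "W \<subseteq> X" "?N \<le> Suc s * card W"
      and A0: "\<forall>x\<in>W. A x \<subseteq> C x \<and> m' \<le> card (A x) \<and> (\<forall>u\<in>A x. \<forall>v\<in>A x. u \<noteq> v \<longrightarrow> \<chi> {u, v} = i)"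
      and A1: "\<forall>x\<in>W. \<forall>y\<in>W. x \<noteq> y \<longrightarrow> (x, y) \<in> E\<^sup>= ^^ r \<longrightarrow>
        (\<forall>u\<in>A x. \<forall>v\<in>A y. \<chi> {u, v} = i) \<or> (\<forall>u\<in>A x. \<forall>v\<in>A y. \<chi> {u, v} \<noteq> i)"
      by (elim bexE exE conjE)
    have finW: "finite W" using W(1) fin by (rule finite_subset)
    have AC: "A x \<subseteq> C x" "m' \<le> card (A x)" if "x \<in> W" for x using A0 that by auto
    have finA: "finite (A x)" if "x \<in> W" for x
      using AC(1)[OF that] bl that W(1) unfolding blown_up_def by (auto intro: finite_subset)
    have Cdisj: "C x \<inter> C x' = {}" if "x \<in> X" "x' \<in> X" "x \<noteq> x'" for x x'
      using bl that unfolding blown_up_def by simp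
    \<comment> \<open>The red pairs, red being the colour \<open>i\<close>. By \<open>A1\<close>, a
      close pair of distinct vertices of \<open>W\<close> outside \<open>R\<close> has no edge of
      colour \<open>i\<close> between its cliques.\<close>
    define R where "R = {(x, x'). x \<in> W \<and> x' \<in> W \<and> x \<noteq> x' \<and> (x, x') \<in> E\<^sup>= ^^ r \<and> (\<forall>u\<in>A x. \<forall>v\<in>A x'. \<chi> {u, v} = i)}"
    have symP: "sym (E\<^sup>= ^^ r)" by (rule sym_reflcl_relpow[OF E(2)])
    have symR: "sym R"
    proof (rule symI)
      fix x x' assume "(x, x') \<in> R"
      then have H: "x \<in> W" "x' \<in> W" "x \<noteq> x'" "(x, x') \<in> E\<^sup>= ^^ r" "\<forall>u\<in>A x. \<forall>v\<in>A x'. \<chi> {u, v} = i"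
        unfolding R_def by auto
      have "\<chi> {u, v} = i" if "u \<in> A x'" "v \<in> A x" for u v
        using H(5) that by (subst insert_commute) simp
      then show "(x', x) \<in> R" unfolding R_def using H(1-3) symD[OF symP H(4)] by simp
    qed
    show "mono_blowup m \<chi> K n par"
    proof (cases "tree_embeds n par W R")
      case True
      then show ?thesis
      proof (rule mono_blowup_of_embedding[OF _ i])
        fix x assume "x \<in> W"
        then show "finite (A x) \<and> m \<le> card (A x)" using finA AC(2) unfolding m'_def by auto
      next
        fix x x' assume "x \<in> W" "x' \<in> W" "x \<noteq> x'"
        then show "A x \<inter> A x' = {}" using AC(1)[of x] AC(1)[of x'] Cdisj[of x x'] W(1) by auto
      next
        fix x u v assume "x \<in> W" "u \<in> A x" "v \<in> A x" "u \<noteq> v"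
        then show "\<chi> {u, v} = i" using A0 by simp
      next
        fix x x' u v assume "(x, x') \<in> R" "u \<in> A x" "v \<in> A x'"
        then show "\<chi> {u, v} = i" unfolding R_def by simp
      qed
    next
      case False
      define x0 where "x0 = ?N div y"
      have x0: "0 < x0" "x0 \<le> ?N" "y * x0 \<le> ?N" "?N \<le> 2 * y * x0" "2 * n \<le> x0"
      proof -
        show 1: "0 < x0" unfolding x0_def using Nw(2) y0 by (simp add: div_greater_zero_iff)
        show "x0 \<le> ?N" "y * x0 \<le> ?N" unfolding x0_def by simp_all
        have "?N < y * (x0 + 1)" unfolding x0_def using y0 dividend_less_times_div[of y ?N] by simp
        also have "\<dots> \<le> y * (2 * x0)" using 1 by (intro mult_left_mono) auto
        finally show "?N \<le> 2 * y * x0" by simp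
        have "2 * n * y \<le> ?N" using Nn(1) by (simp add: algebra_simps)
        then show "2 * n \<le> x0" unfolding x0_def using y0 by (simp add: less_eq_div_iff_mult_less_eq)
      qed
      have "Suc s * ((2 * d + 7) ^ q * x0) \<le> Suc s * card W"
        using x0(3) W(2) unfolding y_def mult.assoc by linarith
      then have big: "(2 * d + 7) ^ q * x0 \<le> card W" by (simp only: Suc_mult_le_cancel1)
      have "\<exists>P :: nat \<Rightarrow> nat set. (\<forall>i<2^q. P i \<subseteq> W \<and> x0 \<le> card (P i)) \<and>
        (\<forall>i<2^q. \<forall>l<2^q. i \<noteq> l \<longrightarrow> P i \<inter> P l = {} \<and> (\<forall>x\<in>P i. \<forall>y\<in>P l. (x, y) \<notin> R))"
        by (rule tree_embeds_or_separated_parts[OF finW T x0(5) symR big False])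
      then obtain P :: "nat \<Rightarrow> nat set" where P: "\<forall>i<2^q. P i \<subseteq> W \<and> x0 \<le> card (P i)"
        "\<forall>i<2^q. \<forall>l<2^q. i \<noteq> l \<longrightarrow> P i \<inter> P l = {} \<and> (\<forall>x\<in>P i. \<forall>y\<in>P l. (x, y) \<notin> R)"
        by (elim exE conjE)
      have q2: "i < 2 ^ q" if "i < q" for i using that less_exp[of q] by (rule less_trans)
      have PW: "P i \<subseteq> W" "x0 \<le> card (P i)" if "i < q" for i using P(1) q2[OF that] by simp_all
      have Psep: "P i \<inter> P l = {} \<and> (\<forall>x\<in>P i. \<forall>y\<in>P l. (x, y) \<notin> R)" if "i < q" "l < q" "i \<noteq> l" for i l
        by (rule P(2)[THEN spec, THEN mp, THEN spec, THEN mp, THEN mp]) (use q2 that in simp_all)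
      have PX: "P i \<subseteq> X \<and> x0 \<le> card (P i)" if "i < q" for i using PW[OF that] W(1) by simp
      have \<gamma>0: "0 < \<gamma>" using \<gamma> by simp
      have qw: "q + 2 < w\<^sup>2" using w0(4) w2 by linarith
      have "\<exists>(u :: nat \<Rightarrow> nat \<Rightarrow> nat) X' E'. finite X' \<and> x0 \<le> 4 * w * card X' \<and> E' \<subseteq> X' \<times> X' \<and> sym E' \<and>
        (\<forall>x\<in>X'. card (E' `` {x}) \<le> 8 * (4 * h') ^ \<gamma>) \<and> joined h' X' E' \<and>
        (\<forall>\<tau>\<in>X'. \<forall>i<q. u \<tau> i \<in> P i) \<and> (\<forall>i<q. inj_on (\<lambda>\<tau>. u \<tau> i) X') \<and>
        (\<forall>\<tau>\<in>X'. \<forall>i<q. \<forall>j<q. (u \<tau> i, u \<tau> j) \<in> E ^^ 2) \<and>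
        (\<forall>\<tau> \<sigma>. (\<tau>, \<sigma>) \<in> E' \<longrightarrow> (\<forall>i<q. \<forall>j<q. (u \<tau> i, u \<sigma> j) \<in> E ^^ 5))"
        by (rule tuple_graph[OF fin E J degD Dw \<gamma>0 PX qw x0(1,2,4) w0(3) Nw(1) h'])
      then obtain u :: "nat \<Rightarrow> nat \<Rightarrow> nat" and X' E' where X': "finite X'" "x0 \<le> 4 * w * card X'" "E' \<subseteq> X' \<times> X'" "sym E'"
        "\<forall>x\<in>X'. card (E' `` {x}) \<le> 8 * (4 * h') ^ \<gamma>" "joined h' X' E'"
        and u: "\<forall>\<tau>\<in>X'. \<forall>i<q. u \<tau> i \<in> P i" "\<forall>i<q. inj_on (\<lambda>\<tau>. u \<tau> i) X'"
        "\<forall>\<tau>\<in>X'. \<forall>i<q. \<forall>j<q. (u \<tau> i, u \<tau> j) \<in> E ^^ 2"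
        "\<forall>\<tau> \<sigma>. (\<tau>, \<sigma>) \<in> E' \<longrightarrow> (\<forall>i<q. \<forall>j<q. (u \<tau> i, u \<sigma> j) \<in> E ^^ 5)"
        by (elim exE conjE)
      have uP: "u \<tau> i \<in> P i" if "\<tau> \<in> X'" "i < q" for \<tau> i using u(1) that by simp
      have uW: "u \<tau> i \<in> W" if "\<tau> \<in> X'" "i < q" for \<tau> i using uP[OF that] PW(1)[OF that(2)] by auto
      have u_inj: "\<tau> = \<sigma> \<and> i = j" if "\<tau> \<in> X'" "\<sigma> \<in> X'" "i < q" "j < q" "u \<tau> i = u \<sigma> j" for \<tau> \<sigma> i j
      proof -
        have "i = j"
        proof (rule ccontr)
          assume "i \<noteq> j"
          then have "P i \<inter> P j = {}" using Psep that by simp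
          then show False using uP[OF that(1,3)] uP[OF that(2,4)] that(5) by auto
        qed
        then show ?thesis using u(2) that by (auto simp: inj_on_def)
      qed
      have dist: "(u \<tau> i, u \<sigma> j) \<in> E\<^sup>= ^^ r"
        if "\<tau> \<in> X'" "(\<tau>, \<sigma>) \<in> E'\<^sup>= ^^ r'" "i < q" "j < q" for \<tau> \<sigma> i j
        unfolding r_def
        by (rule tuple_graph_distance[where X' = X' and E' = E' and q = q]) (use u(3,4) that in simp_all)
      define pick where "pick x = (SOME v. v \<in> A x)" for x
      have pick: "pick x \<in> A x" if "x \<in> W" for x
      proof -
        have "A x \<noteq> {}" using AC(2)[OF that] unfolding m'_def by auto
        then show ?thesis unfolding pick_def by (simp add: some_in_eq)
      qed
      have pick_inj: "x = x'" if "x \<in> W" "x' \<in> W" "pick x = pick x'" for x x'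
      proof (rule ccontr)
        assume "x \<noteq> x'"
        then have "C x \<inter> C x' = {}" using Cdisj that W(1) by auto
        then show False using pick[OF that(1)] pick[OF that(2)] AC(1) that by (metis disjoint_iff subsetD)
      qed
      have finE': "finite E'" using X'(3) by (rule finite_subset) (use X'(1) in simp)
      have degE': "card (E' `` {\<tau>}) \<le> D'" for \<tau>
      proof (cases "\<tau> \<in> X'")
        case True
        then show ?thesis using X'(5) unfolding D'_def by simp
      next
        case False
        then have "E' `` {\<tau>} = {}" using X'(3) by auto
        then show ?thesis by simp
      qed
      have degP': "card ((E'\<^sup>= ^^ r') `` {\<tau>} \<inter> X') \<le> d'" for \<tau>
      proof -
        have fp: "finite ((E'\<^sup>= ^^ r') `` {\<tau>}) \<and> card ((E'\<^sup>= ^^ r') `` {\<tau>}) \<le> (D' + 1) ^ r'"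
          by (rule card_relpow_Image_le[OF finite_Image[OF finE'] degE'])
        then have "card ((E'\<^sup>= ^^ r') `` {\<tau>} \<inter> X') \<le> card ((E'\<^sup>= ^^ r') `` {\<tau>})" by (intro card_mono) auto
        then show ?thesis using fp unfolding d'_def by simp
      qed
      \<comment> \<open>Entries from the same part may be joined in colour \<open>i\<close>, so
        close tuples receive disjoint index sets.\<close>
      have "\<exists>I. (\<forall>\<tau>\<in>X'. I \<tau> \<subseteq> {..<q} \<and> t' \<le> card (I \<tau>)) \<and>
        (\<forall>\<tau>\<in>X'. \<forall>\<sigma>\<in>X'. \<tau> < \<sigma> \<longrightarrow> (\<tau>, \<sigma>) \<in> E'\<^sup>= ^^ r' \<longrightarrow> I \<tau> \<inter> I \<sigma> = {})"
      proof (rule local_selection[OF X'(1) sym_reflcl_relpow[OF X'(4)] degP', where f = "\<lambda>k. 2 * k" and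
          good = "\<lambda>_ _ S T. S \<inter> T = {}"])
        have "((\<lambda>k. 2 * k) ^^ j) t' = 2 ^ j * t'" for j by (induction j) auto
        then show "((\<lambda>k. 2 * k) ^^ d') t' \<le> card {..<q}" unfolding q_def by simp
        show "\<exists>S' T'. S' \<subseteq> S \<and> T' \<subseteq> T \<and> k \<le> card S' \<and> l \<le> card T' \<and> S' \<inter> T' = {}"
          if "S \<subseteq> {..<q}" "T \<subseteq> {..<q}" "2 * k \<le> card S" "2 * l \<le> card T" for S T and k l :: nat
          using that by (intro disjoint_selection) (auto intro: finite_subset)
      qed auto
      then obtain I where I0: "\<forall>\<tau>\<in>X'. I \<tau> \<subseteq> {..<q} \<and> t' \<le> card (I \<tau>)"
        "\<forall>\<tau>\<in>X'. \<forall>\<sigma>\<in>X'. \<tau> < \<sigma> \<longrightarrow> (\<tau>, \<sigma>) \<in> E'\<^sup>= ^^ r' \<longrightarrow> I \<tau> \<inter> I \<sigma> = {}"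
        by (elim exE conjE)
      have Iq: "j < q" if "\<tau> \<in> X'" "j \<in> I \<tau>" for \<tau> j using I0(1) that by auto
      have Idisj: "I \<tau> \<inter> I \<sigma> = {}" if "\<tau> \<in> X'" "\<sigma> \<in> X'" "\<tau> \<noteq> \<sigma>" "(\<tau>, \<sigma>) \<in> E'\<^sup>= ^^ r'" for \<tau> \<sigma>
      proof (cases "\<tau> < \<sigma>")
        case True
        then show ?thesis using I0(2) that by simp
      next
        case False
        then have "\<sigma> < \<tau>" "(\<sigma>, \<tau>) \<in> E'\<^sup>= ^^ r'"
          using that symD[OF sym_reflcl_relpow[OF X'(4)]] by auto
        then have "I \<sigma> \<inter> I \<tau> = {}" using I0(2) that by simp
        then show ?thesis by (simp only: Int_commute)
      qed
      define C' where "C' \<tau> = (\<lambda>j. pick (u \<tau> j)) ` I \<tau>" for \<tau>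
      have C'_inj: "\<tau> = \<sigma> \<and> j = l"
        if "\<tau> \<in> X'" "\<sigma> \<in> X'" "j < q" "l < q" "pick (u \<tau> j) = pick (u \<sigma> l)" for \<tau> \<sigma> j l
        using u_inj[OF that(1-4)] pick_inj[OF uW uW] that by simp
      have bl': "blown_up t' r' X' E' C' (K - {i}) \<chi>"
        unfolding blown_up_def
      proof (intro conjI ballI impI)
        fix \<tau> assume \<tau>: "\<tau> \<in> X'"
        have "finite (I \<tau>)" using I0(1) \<tau> by (auto intro: finite_subset)
        then show "finite (C' \<tau>)" unfolding C'_def by simp
        have "inj_on (\<lambda>j. pick (u \<tau> j)) (I \<tau>)"
          unfolding inj_on_def using C'_inj[OF \<tau> \<tau>] Iq[OF \<tau>] by simp
        then have "card (C' \<tau>) = card (I \<tau>)" unfolding C'_def by (rule card_image)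
        then show "t' \<le> card (C' \<tau>)" using I0(1) \<tau> by simp
      next
        fix \<tau> \<sigma> assume H: "\<tau> \<in> X'" "\<sigma> \<in> X'" "\<tau> \<noteq> \<sigma>"
        show "C' \<tau> \<inter> C' \<sigma> = {}"
        proof (rule ccontr)
          assume "C' \<tau> \<inter> C' \<sigma> \<noteq> {}"
          then obtain j l where "j \<in> I \<tau>" "l \<in> I \<sigma>" "pick (u \<tau> j) = pick (u \<sigma> l)" unfolding C'_def by auto
          then show False using C'_inj[OF H(1,2)] Iq H by blast
        qed
      next
        fix \<tau> \<sigma> v1 v2
        assume H: "\<tau> \<in> X'" "\<sigma> \<in> X'" "(\<tau>, \<sigma>) \<in> E'\<^sup>= ^^ r'" "v1 \<in> C' \<tau>" "v2 \<in> C' \<sigma>" "v1 \<noteq> v2"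
        obtain j where j: "j \<in> I \<tau>" "v1 = pick (u \<tau> j)" using H(4) unfolding C'_def by auto
        obtain l where l: "l \<in> I \<sigma>" "v2 = pick (u \<sigma> l)" using H(5) unfolding C'_def by auto
        have jl: "j < q" "l < q" using Iq H j l by auto
        \<comment> \<open>Within one tuple the indices differ because the vertices do, in two close
          tuples because the index sets are disjoint. The vertices therefore come from different
          parts.\<close>
        have "j \<noteq> l"
        proof
          assume "j = l"
          then have "\<tau> \<noteq> \<sigma>" using H(6) j l by auto
          then have "I \<tau> \<inter> I \<sigma> = {}" using Idisj H by simp
          then show False using j l \<open>j = l\<close> by auto
        qed
        let ?x = "u \<tau> j" and ?x' = "u \<sigma> l"
        have xW: "?x \<in> W" "?x' \<in> W" using uW H jl by auto
        have nR: "(?x, ?x') \<notin> R" using Psep[OF jl \<open>j \<noteq> l\<close>] uP[OF H(1) jl(1)] uP[OF H(2) jl(2)] by simp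
        have ne: "?x \<noteq> ?x'" using u_inj[OF H(1,2) jl] \<open>j \<noteq> l\<close> by auto
        have dP: "(?x, ?x') \<in> E\<^sup>= ^^ r" using dist[OF H(1,3) jl] .
        have "(\<forall>u\<in>A ?x. \<forall>v\<in>A ?x'. \<chi> {u, v} = i) \<or> (\<forall>u\<in>A ?x. \<forall>v\<in>A ?x'. \<chi> {u, v} \<noteq> i)"
          using A1 xW ne dP by simp
        moreover have "\<not> (\<forall>u\<in>A ?x. \<forall>v\<in>A ?x'. \<chi> {u, v} = i)" using nR xW ne dP unfolding R_def by simp
        ultimately have "\<forall>u\<in>A ?x. \<forall>v\<in>A ?x'. \<chi> {u, v} \<noteq> i"
          by (elim disjE) (erule (1) notE, assumption)
        then have "\<chi> {v1, v2} \<noteq> i" using pick[OF xW(1)] pick[OF xW(2)] j l by simp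
        moreover have "\<chi> {v1, v2} \<in> K"
        proof -
          have "?x \<in> X" "?x' \<in> X" "v1 \<in> C ?x" "v2 \<in> C ?x'" using xW W(1) pick AC(1) j l by auto
          then show ?thesis using bl dP H(6) unfolding blown_up_def by simp
        qed
        ultimately show "\<chi> {v1, v2} \<in> K - {i}" by simp
      qed
      have "4 * w * (z' * n) \<le> x0"
      proof -
        have "(2 * y) * (4 * w * (z' * n)) = 8 * w * y * z' * n" by simp
        also have "\<dots> \<le> (2 * y) * x0" using Nn(2) x0(4) by linarith
        finally have "(2 * y) * (4 * w * (z' * n)) \<le> (2 * y) * x0" .
        then show ?thesis using y0 by (subst (asm) mult_le_cancel1) simp
      qed
      then have "(4 * w) * (z' * n) \<le> (4 * w) * card X'" using X'(2) by linarith
      then have zX: "z' * n \<le> card X'" using w0(1) by (subst (asm) mult_le_cancel1) simp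
      have dB: "\<forall>x\<in>X'. card (E' `` {x}) \<le> (8 * 4 ^ \<gamma>) * h' ^ \<gamma>"
        using X'(5) by (simp add: power_mult_distrib mult.assoc)
      have "card (K - {i}) \<le> s" using K i by simp
      then have "mono_blowup m \<chi> (K - {i}) n par"
        using IH[unfolded ramsey_host_def, rule_format, of X' E' C' "K - {i}" \<chi> n par] X'(1,3,4,6) dB bl' K(1) T zX
        by simp
      then show ?thesis by (rule mono_blowup_mono) auto
    qed
  qed
  moreover have "0 < w\<^sup>2" "0 < z" using w0(1) y0 unfolding z_def by auto
  ultimately show ?thesis by (intro exI conjI)
qed

text \<open>\<open>B\<close> and \<open>b\<close> are generalised since the step for exponent
  \<open>b\<close> uses the case of one colour less with exponent
  \<open>2 * (b + 2)\<close>.\<close>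

lemma ramsey_host_exists: "\<exists>h r t z. 0 < h \<and> 0 < z \<and> ramsey_host m d s B b h r t z"
proof (induction s arbitrary: B b)
  case 0
  then show ?case using ramsey_host_0 by (intro exI conjI) auto
next
  case (Suc s)
  define \<gamma> where "\<gamma> = 2 * (b + 2)"
  obtain h r t z where "0 < h" "ramsey_host m d s (8 * 4 ^ \<gamma>) \<gamma> h r t z"
    using Suc[of "8 * 4 ^ \<gamma>" \<gamma>] by (elim exE conjE)
  then show ?case using ramsey_host_Suc \<gamma>_def by simp
qed

section \<open>Powers of trees\<close>

text \<open>Edges are left out; parent and depth suffice for the bags. With
  \<open>p root = root\<close> all iterates of \<open>p\<close> are defined, and climbing past the
  root stays there.\<close>

locale rooted_vertices =
  fixes V :: "'a set" and root :: 'a and p :: "'a \<Rightarrow> 'a" and dep :: "'a \<Rightarrow> nat"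
  assumes finite_V: "finite V" and root_in: "root \<in> V" and p_root: "p root = root" and dep_root: "dep root = 0"
    and parent: "\<And>v. v \<in> V \<Longrightarrow> v \<noteq> root \<Longrightarrow> p v \<in> V \<and> dep v = Suc (dep (p v))"
begin

lemma funpow_in: "v \<in> V \<Longrightarrow> (p ^^ i) v \<in> V"
  by (induction i) (use parent p_root root_in in \<open>auto, metis\<close>)

lemma dep_p: "v \<in> V \<Longrightarrow> dep (p v) = dep v - 1"
  using parent[of v] p_root dep_root by (cases "v = root") auto

lemma dep_funpow: "v \<in> V \<Longrightarrow> dep ((p ^^ i) v) = dep v - i"
  by (induction i) (auto simp: dep_p funpow_in)

lemma dep_eq_0: "v \<in> V \<Longrightarrow> dep v = 0 \<Longrightarrow> v = root"
  using parent[of v] by auto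

lemma funpow_root: "(p ^^ i) root = root"
  by (induction i) (auto simp: p_root)

lemma funpow_dep: "v \<in> V \<Longrightarrow> dep v \<le> i \<Longrightarrow> (p ^^ i) v = root"
  using dep_eq_0[OF funpow_in] dep_funpow by simp

lemma card_funpow_fibre:
  assumes "\<And>x. card {v \<in> V. p v = x} \<le> D"
  shows "card {v \<in> V. (p ^^ i) v = x} \<le> D ^ i"
proof (induction i arbitrary: x)
  case 0
  have "{v \<in> V. (p ^^ 0) v = x} \<subseteq> {x}" by auto
  from card_mono[OF _ this] show ?case by simp
next
  case (Suc i)
  have "{v \<in> V. (p ^^ Suc i) v = x} \<subseteq> (\<Union>y \<in> {y \<in> V. p y = x}. {v \<in> V. (p ^^ i) v = y})"
    using funpow_in by auto
  then have "card {v \<in> V. (p ^^ Suc i) v = x} \<le> card (\<Union>y \<in> {y \<in> V. p y = x}. {v \<in> V. (p ^^ i) v = y})"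
    using finite_V by (intro card_mono) auto
  also have "\<dots> \<le> (\<Sum>y \<in> {y \<in> V. p y = x}. card {v \<in> V. (p ^^ i) v = y})"
    using finite_V by (intro card_UN_le) auto
  also have "\<dots> \<le> (\<Sum>y \<in> {y \<in> V. p y = x}. D ^ i)" by (intro sum_mono Suc.IH)
  also have "\<dots> \<le> D * D ^ i" using assms by simp
  finally show ?case by simp
qed

text \<open>Cut the tree into layers of \<open>k\<close> consecutive levels. The bag of \<open>v\<close> is named after the
  ancestor of \<open>v\<close> at the top of the layer above that of \<open>v\<close>, so that vertices whose
  connecting path passes through that layer share a bag.\<close>

definition bag :: "nat \<Rightarrow> 'a \<Rightarrow> 'a" where
  "bag k v = (p ^^ (dep v mod k + k)) v"

lemma bag_in: "v \<in> V \<Longrightarrow> bag k v \<in> V"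
  unfolding bag_def by (rule funpow_in)

lemma bag_root: "bag k root = root"
  unfolding bag_def by (rule funpow_root)

text \<open>Both bags are named after ancestors of the meeting point \<open>x\<close>, reached from
  it in \<open>b + k - i'\<close> and \<open>b' + k - j'\<close> steps. Comparing depths, the layers
  of \<open>u\<close> and \<open>w\<close> differ by at most one, so these numbers are equal or
  differ by exactly \<open>k\<close>.\<close>

lemma bag_adjacent:
  assumes k: "0 < k" and V: "u \<in> V" "w \<in> V" and meet: "(p ^^ i) u = (p ^^ j) w" and ij: "i \<le> k" "j \<le> k"
  shows "bag k u = bag k w \<or> bag k u = (p ^^ k) (bag k w) \<or> bag k w = (p ^^ k) (bag k u)"
proof -
  \<comment> \<open>Truncation at the depth removes idle steps at the root, so that depths decrease
    by exactly \<open>i'\<close> and \<open>j'\<close>.\<close>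
  define i' where "i' = min i (dep u)"
  define j' where "j' = min j (dep w)"
  have trunc: "(p ^^ min a (dep v)) v = (p ^^ a) v" if "v \<in> V" for a v
    using funpow_dep[OF that, of a] funpow_dep[OF that, of "dep v"] by (cases "a \<le> dep v") (auto simp: min_def)
  define x where "x = (p ^^ i') u"
  have x: "x = (p ^^ j') w" unfolding x_def i'_def j'_def using trunc V meet by simp
  have le: "i' \<le> k" "j' \<le> k" "i' \<le> dep u" "j' \<le> dep w" unfolding i'_def j'_def using ij by auto
  have dx: "dep u - i' = dep w - j'"
    using dep_funpow[OF V(1), of i'] dep_funpow[OF V(2), of j'] x x_def by simp
  define a where "a = dep u div k"
  define b where "b = dep u mod k"
  define a' where "a' = dep w div k"
  define b' where "b' = dep w mod k"
  have du: "dep u = a * k + b" "dep w = a' * k + b'" unfolding a_def b_def a'_def b'_def by simp_all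
  have bk: "b < k" "b' < k" unfolding b_def b'_def using k by simp_all
  have bagu: "bag k u = (p ^^ (b + k - i')) x"
    unfolding bag_def x_def b_def[symmetric] funpow_add[symmetric, THEN fun_cong, unfolded comp_def]
    using le by simp
  have bagw: "bag k w = (p ^^ (b' + k - j')) x"
    unfolding bag_def x b'_def[symmetric] funpow_add[symmetric, THEN fun_cong, unfolded comp_def]
    using le by simp
  have shift: "(p ^^ k) ((p ^^ l) x) = (p ^^ (k + l)) x" for l
    by (simp add: funpow_add)
  have eq: "a * k + b + j' = a' * k + b' + i'" using dx le du by linarith
  have "\<not> a + 2 \<le> a'"
  proof
    assume "a + 2 \<le> a'"
    then have "(a + 2) * k \<le> a' * k" by (rule mult_le_mono1)
    then show False using eq bk le by (simp add: algebra_simps)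
  qed
  moreover have "\<not> a' + 2 \<le> a"
  proof
    assume "a' + 2 \<le> a"
    then have "(a' + 2) * k \<le> a * k" by (rule mult_le_mono1)
    then show False using eq bk le by (simp add: algebra_simps)
  qed
  ultimately consider "a = a'" | "a' = a + 1" | "a = a' + 1" by linarith
  then show ?thesis
  proof cases
    case 1
    then have "b + k - i' = b' + k - j'" using eq le by simp
    then show ?thesis using bagu bagw by simp
  next
    case 2
    then have "b + k - i' = k + (b' + k - j')" using eq le by (simp add: algebra_simps)
    then show ?thesis using bagu bagw shift by simp
  next
    case 3
    then have "b' + k - j' = k + (b + k - i')" using eq le by (simp add: algebra_simps)
    then show ?thesis using bagu bagw shift by simp
  qed
qed

text \<open>Below the first two layers, climbing \<open>k\<close> levels preserves the depth modulo
  \<open>k\<close> and so commutes with \<open>bag\<close>; in those two layers the bag is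
  \<open>root\<close>.\<close>

lemma bag_parent:
  assumes k: "0 < k" and v: "v \<in> V" and ne: "bag k v \<noteq> root"
  shows "(p ^^ k) (bag k v) \<in> bag k ` V"
proof -
  have "\<not> dep v \<le> dep v mod k + k" using funpow_dep[OF v] ne unfolding bag_def by blast
  then have "dep ((p ^^ k) v) mod k = dep v mod k"
    using dep_funpow[OF v, of k] by (simp add: le_mod_geq)
  moreover have "(p ^^ a) ((p ^^ b) v) = (p ^^ (b + a)) v" for a b
    by (simp add: funpow_add add.commute)
  ultimately have "bag k ((p ^^ k) v) = (p ^^ k) (bag k v)"
    unfolding bag_def by (simp add: add.commute)
  then show ?thesis using funpow_in[OF v] by (metis image_eqI)
qed

text \<open>The names of the bags are numbered by increasing depth, and the parent of a name is its
  \<open>k\<close>-th iterate under \<open>p\<close>, a name by \<open>bag_parent\<close>. A member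
  reaches the name of its bag in \<open>b + k\<close> steps for some \<open>b < k\<close>, so a bag
  is covered by \<open>k\<close> fibres of size at most \<open>D ^ (2 * k)\<close>.\<close>

lemma bag_tree:
  assumes k: "0 < k" and D: "\<And>x. card {v \<in> V. p v = x} \<le> D" "0 < D"
  shows "\<exists>n par \<beta>. rooted_tree (D ^ k) n par \<and> n \<le> card V \<and> (\<forall>v\<in>V. \<beta> v < n) \<and>
    (\<forall>j. card {v \<in> V. \<beta> v = j} \<le> k * D ^ (2 * k)) \<and>
    (\<forall>u\<in>V. \<forall>w\<in>V. \<forall>i\<le>k. \<forall>j\<le>k. (p ^^ i) u = (p ^^ j) w \<longrightarrow>
       \<beta> u = \<beta> w \<or> 0 < \<beta> w \<and> \<beta> u = par (\<beta> w) \<or> 0 < \<beta> u \<and> \<beta> w = par (\<beta> u))"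
proof -
  define L where "L = bag k ` V"
  have finL: "finite L" unfolding L_def using finite_V by simp
  have LV: "L \<subseteq> V" unfolding L_def using bag_in by auto
  have rootL: "root \<in> L" unfolding L_def using bag_root root_in by (metis image_eqI)
  obtain xs0 where xs0: "set xs0 = L" "distinct xs0" using finite_distinct_list[OF finL] by blast
  define xs where "xs = sort_key dep xs0"
  have xs: "set xs = L" "distinct xs" "sorted (map dep xs)" unfolding xs_def using xs0 by simp_all
  define n where "n = length xs"
  have nL: "n = card L" unfolding n_def using xs(1,2) distinct_card by metis
  have nV: "n \<le> card V" unfolding nL L_def using finite_V by (rule card_image_le)
  have n0: "0 < n" using rootL finL unfolding nL by (auto simp: card_gt_0_iff)
  define idx where "idx x = (SOME i. i < n \<and> xs ! i = x)" for x
  have idx: "idx x < n" "xs ! idx x = x" if "x \<in> L" for x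
  proof -
    have "\<exists>i. i < n \<and> xs ! i = x" using that xs(1) unfolding n_def by (metis in_set_conv_nth)
    from someI_ex[OF this] show "idx x < n" "xs ! idx x = x" unfolding idx_def by auto
  qed
  have idx_nth: "idx (xs ! i) = i" if "i < n" for i
    using idx[of "xs ! i"] that xs(1,2) unfolding n_def by (metis nth_eq_iff_index_eq nth_mem)
  have nthL: "xs ! i \<in> L" if "i < n" for i using that xs(1) unfolding n_def by (metis nth_mem)
  have mono: "dep (xs ! i) \<le> dep (xs ! j)" if "i \<le> j" "j < n" for i j
    using sorted_nth_mono[OF xs(3) that(1)] that unfolding n_def by simp
  have first: "xs ! 0 = root"
  proof -
    have "dep (xs ! 0) \<le> dep root" using mono[of 0 "idx root"] idx[OF rootL] by simp
    then show ?thesis using dep_eq_0 nthL[OF n0] LV dep_root by auto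
  qed
  have not_root: "xs ! i \<noteq> root" if "0 < i" "i < n" for i
    using idx_nth[OF n0] idx_nth[OF that(2)] first that(1) by auto
  have upL: "(p ^^ k) x \<in> L" if "x \<in> L" for x
  proof (cases "x = root")
    case True
    then show ?thesis using rootL funpow_root by simp
  next
    case False
    then show ?thesis using that bag_parent[OF k] unfolding L_def by auto
  qed
  define par where "par i = idx ((p ^^ k) (xs ! i))" for i
  have par: "par i < i" if "0 < i" "i < n" for i
  proof (rule ccontr)
    assume c: "\<not> par i < i"
    have x: "xs ! i \<in> L" using nthL that by simp
    then have xV: "xs ! i \<in> V" using LV by auto
    have up: "(p ^^ k) (xs ! i) \<in> L" using upL x by simp
    have "dep (xs ! i) \<le> dep (xs ! par i)" using mono[of i "par i"] c idx(1)[OF up] unfolding par_def by simp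
    then have "dep (xs ! i) \<le> dep (xs ! i) - k"
      using idx(2)[OF up] dep_funpow[OF xV] unfolding par_def by simp
    then have "dep (xs ! i) = 0" using k by simp
    then show False using dep_eq_0[OF xV] not_root that by simp
  qed
  have ch: "card {i. 0 < i \<and> i < n \<and> par i = j} \<le> D ^ k" for j
  proof -
    have inj: "inj_on ((!) xs) {i. 0 < i \<and> i < n \<and> par i = j}"
      using xs(2) unfolding n_def by (auto simp: inj_on_def nth_eq_iff_index_eq)
    have "(!) xs ` {i. 0 < i \<and> i < n \<and> par i = j} \<subseteq> {v \<in> V. (p ^^ k) v = xs ! j}"
    proof
      fix v assume "v \<in> (!) xs ` {i. 0 < i \<and> i < n \<and> par i = j}"
      then obtain i where i: "v = xs ! i" "i < n" "par i = j" by auto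
      then have "v \<in> L" using nthL by simp
      then show "v \<in> {v \<in> V. (p ^^ k) v = xs ! j}"
        using idx(2)[OF upL] i LV unfolding par_def by auto
    qed
    from card_inj_on_le[OF inj this] have "card {i. 0 < i \<and> i < n \<and> par i = j} \<le> card {v \<in> V. (p ^^ k) v = xs ! j}"
      using finite_V by simp
    then show ?thesis using card_funpow_fibre[OF D(1), of k "xs ! j"] by simp
  qed
  define \<beta> where "\<beta> v = idx (bag k v)" for v
  have bagL: "bag k v \<in> L" if "v \<in> V" for v unfolding L_def using that by simp
  have \<beta>: "\<beta> v < n" "xs ! \<beta> v = bag k v" if "v \<in> V" for v
    unfolding \<beta>_def using idx[OF bagL[OF that]] by auto
  have size: "card {v \<in> V. \<beta> v = j} \<le> k * D ^ (2 * k)" for j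
  proof -
    have "{v \<in> V. \<beta> v = j} \<subseteq> (\<Union>b<k. {v \<in> V. (p ^^ (b + k)) v = xs ! j})"
    proof
      fix v assume v: "v \<in> {v \<in> V. \<beta> v = j}"
      then have "(p ^^ (dep v mod k + k)) v = xs ! j" using \<beta>(2) unfolding bag_def by auto
      moreover have "dep v mod k \<in> {..<k}" using k by simp
      ultimately show "v \<in> (\<Union>b<k. {v \<in> V. (p ^^ (b + k)) v = xs ! j})" using v by blast
    qed
    then have "card {v \<in> V. \<beta> v = j} \<le> card (\<Union>b<k. {v \<in> V. (p ^^ (b + k)) v = xs ! j})"
      using finite_V by (intro card_mono) auto
    also have "\<dots> \<le> (\<Sum>b<k. card {v \<in> V. (p ^^ (b + k)) v = xs ! j})" by (intro card_UN_le) simp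
    also have "\<dots> \<le> (\<Sum>b<k. D ^ (2 * k))"
    proof (rule sum_mono)
      fix b assume "b \<in> {..<k}"
      then have "D ^ (b + k) \<le> D ^ (2 * k)" using D(2) by (intro power_increasing) auto
      then show "card {v \<in> V. (p ^^ (b + k)) v = xs ! j} \<le> D ^ (2 * k)"
        using card_funpow_fibre[OF D(1), of "b + k" "xs ! j"] by linarith
    qed
    finally show ?thesis by simp
  qed
  have up: "\<beta> w = \<beta> u \<or> 0 < \<beta> u \<and> \<beta> w = par (\<beta> u)"
    if H: "u \<in> V" "bag k w = (p ^^ k) (bag k u)" for u w
  proof (cases "\<beta> u = 0")
    case True
    then have "bag k u = root" using \<beta>(2)[OF H(1)] first by simp
    then show ?thesis using H funpow_root unfolding \<beta>_def by simp
  next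
    case False
    then show ?thesis using \<beta>(2)[OF H(1)] H(2) unfolding par_def by (simp add: \<beta>_def)
  qed
  have adj: "\<beta> u = \<beta> w \<or> 0 < \<beta> w \<and> \<beta> u = par (\<beta> w) \<or> 0 < \<beta> u \<and> \<beta> w = par (\<beta> u)"
    if H: "u \<in> V" "w \<in> V" "i \<le> k" "j \<le> k" "(p ^^ i) u = (p ^^ j) w" for u w i j
  proof -
    consider "bag k u = bag k w" | "bag k u = (p ^^ k) (bag k w)" | "bag k w = (p ^^ k) (bag k u)"
      using bag_adjacent[OF k H(1,2,5,3,4)] by blast
    then show ?thesis
    proof cases
      case 1
      then show ?thesis unfolding \<beta>_def by simp
    next
      case 2
      from up[OF H(2) 2] show ?thesis by auto
    next
      case 3
      from up[OF H(1) 3] show ?thesis by auto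
    qed
  qed
  have "rooted_tree (D ^ k) n par" unfolding rooted_tree_def using n0 par ch by simp
  then show ?thesis using nV \<beta>(1) size adj
    by - (rule exI[of _ n], rule exI[of _ par], rule exI[of _ \<beta>], intro conjI ballI allI impI, simp_all)
qed

end

section \<open>Rooting a tree, walks and common ancestors\<close>

lemma simple_graph_edge:
  assumes "simple_graph G" "{u, v} \<in> edges G"
  shows "u \<in> vertices G \<and> v \<in> vertices G \<and> u \<noteq> v"
proof -
  have "{u, v} \<in> [vertices G]\<^bsup>2\<^esup>" using assms unfolding simple_graph_def by blast
  then show ?thesis by simp
qed

lemma simple_graph_finite: "simple_graph G \<Longrightarrow> finite (vertices G) \<and> finite (edges G)"
  unfolding simple_graph_def using finite_imp_finite_nsets finite_subset by blast

text \<open>Breadth-first search: the depth is the distance from \<open>rt\<close>, and a parent is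
  any neighbour that is one step closer.\<close>

lemma connected_graph_rooting:
  assumes G: "simple_graph G" "connected_graph G"
  shows "\<exists>rt p dep. rooted_vertices (vertices G) rt p dep \<and>
    (\<forall>v\<in>vertices G. v \<noteq> rt \<longrightarrow> {v, p v} \<in> edges G)"
proof -
  obtain rt where rt: "rt \<in> vertices G"
    using G(2) unfolding connected_graph_def by blast
  define reach where "reach l v \<longleftrightarrow> (\<exists>xs \<in> walks_between G rt v. length xs = Suc l)" for l v
  have reach_ex: "\<exists>l. reach l v" if v: "v \<in> vertices G" for v
  proof -
    obtain xs where xs: "xs \<in> walks_between G rt v"
      using G(2) rt v unfolding connected_graph_def by blast
    then have "xs \<noteq> []" unfolding walks_between_def is_walk_def by auto
    then have "length xs = Suc (length xs - 1)" by simp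
    then show ?thesis unfolding reach_def using xs by blast
  qed
  have reach_0: "v = rt" if "reach 0 v" for v
    using that unfolding reach_def walks_between_def by (auto simp: length_Suc_conv)
  have reach_step: "reach (Suc l) w" if r: "reach l v" and e: "{v, w} \<in> edges G" for l v w
  proof -
    obtain xs where xs: "xs \<in> walks_between G rt v" "length xs = Suc l" using r unfolding reach_def by blast
    have w: "w \<in> vertices G" using simple_graph_edge[OF G(1) e] by simp
    have "xs @ [w] \<in> walks_between G rt w"
      using xs w e unfolding walks_between_def is_walk_def by (auto simp: successively_append_iff)
    then show ?thesis unfolding reach_def using xs(2) by (intro bexI[of _ "xs @ [w]"]) auto
  qed
  have reach_back: "\<exists>x. reach l x \<and> {x, v} \<in> edges G" if r: "reach (Suc l) v" for l v
  proof -
    obtain xs where xs: "xs \<in> walks_between G rt v" "length xs = Suc (Suc l)" using r unfolding reach_def by blast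
    define ys where "ys = butlast xs"
    have "xs \<noteq> []" "last xs = v" using xs(1) unfolding walks_between_def is_walk_def by auto
    then have ys: "xs = ys @ [v]" using append_butlast_last_id[of xs] unfolding ys_def by simp
    have len: "length ys = Suc l" using xs(2) unfolding ys_def by simp
    then have ne: "ys \<noteq> []" by auto
    have "ys \<in> walks_between G rt (last ys)" "{last ys, v} \<in> edges G"
      using xs(1) ne unfolding ys walks_between_def is_walk_def by (auto simp: successively_append_iff)
    then show ?thesis unfolding reach_def using len by blast
  qed
  define dep where "dep v = (LEAST l. reach l v)" for v
  have dep: "reach (dep v) v" if "v \<in> vertices G" for v
    unfolding dep_def using reach_ex[OF that] by (rule LeastI_ex)
  have dep_le: "dep v \<le> l" if "reach l v" for v l
    unfolding dep_def using that by (rule Least_le)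
  have dep_root: "dep rt = 0"
  proof -
    have "[rt] \<in> walks_between G rt rt" using rt unfolding walks_between_def is_walk_def by simp
    then have "reach 0 rt" unfolding reach_def by (intro bexI[of _ "[rt]"]) auto
    then show ?thesis using dep_le by fastforce
  qed
  have ex: "\<exists>x. x \<in> vertices G \<and> {v, x} \<in> edges G \<and> dep v = Suc (dep x)" if v: "v \<in> vertices G" "v \<noteq> rt" for v
  proof (cases "dep v")
    case 0
    then show ?thesis using dep[OF v(1)] reach_0 v(2) by simp
  next
    case (Suc l)
    then obtain x where x: "reach l x" "{x, v} \<in> edges G" using dep[OF v(1)] reach_back by metis
    have xV: "x \<in> vertices G" using simple_graph_edge[OF G(1) x(2)] by simp
    have "dep v \<le> Suc (dep x)" by (rule dep_le) (rule reach_step[OF dep[OF xV] x(2)])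
    moreover have "dep x \<le> l" using dep_le x(1) by simp
    ultimately show ?thesis using Suc xV x(2) by (intro exI[of _ x]) (auto simp: insert_commute)
  qed
  define p where "p v = (if v = rt then rt else SOME x. x \<in> vertices G \<and> {v, x} \<in> edges G \<and> dep v = Suc (dep x))" for v
  have p: "p v \<in> vertices G \<and> {v, p v} \<in> edges G \<and> dep v = Suc (dep (p v))" if "v \<in> vertices G" "v \<noteq> rt" for v
    using someI_ex[OF ex[OF that]] that(2) unfolding p_def by simp
  have "rooted_vertices (vertices G) rt p dep"
    by unfold_locales (use simple_graph_finite[OF G(1)] rt dep_root p in \<open>auto simp: p_def\<close>)
  then show ?thesis using p by blast
qed

text \<open>Otherwise the paths from \<open>u\<close> and \<open>v\<close> up to their first common
  ancestor, closed by the edge, form a cycle.\<close>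

lemma tree_edge_parent:
  assumes T: "is_tree T" and R: "rooted_vertices (vertices T) rt p dep"
    and pe: "\<And>v. v \<in> vertices T \<Longrightarrow> v \<noteq> rt \<Longrightarrow> {v, p v} \<in> edges T"
    and e: "{u, v} \<in> edges T"
  shows "p u = v \<or> p v = u"
proof (rule ccontr)
  assume contra: "\<not> ?thesis"
  interpret rooted_vertices "vertices T" rt p dep by (rule R)
  have sg: "simple_graph T" using T unfolding is_tree_def by simp
  have uv: "u \<in> vertices T" "v \<in> vertices T" "u \<noteq> v" using simple_graph_edge[OF sg e] by auto
  define i where "i = (LEAST i. \<exists>j. (p ^^ i) u = (p ^^ j) v)"
  have ex: "\<exists>j. (p ^^ dep u) u = (p ^^ j) v"
    using funpow_dep[OF uv(1)] funpow_dep[OF uv(2), of "dep v"] by (intro exI[of _ "dep v"]) simp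
  have i: "\<exists>j. (p ^^ i) u = (p ^^ j) v" "i \<le> dep u"
    unfolding i_def by (rule LeastI, rule ex) (rule Least_le, rule ex)
  have imin: "(p ^^ l) u \<noteq> (p ^^ j) v" if "l < i" for l j
    using not_less_Least[OF that[unfolded i_def]] by blast
  define j where "j = (LEAST j. (p ^^ i) u = (p ^^ j) v)"
  have j: "(p ^^ i) u = (p ^^ j) v" unfolding j_def by (rule LeastI_ex[OF i(1)])
  have jmin: "(p ^^ i) u \<noteq> (p ^^ l) v" if "l < j" for l
    using not_less_Least[OF that[unfolded j_def]] .
  have jd: "j \<le> dep v"
  proof (rule ccontr)
    assume "\<not> j \<le> dep v"
    then have "(p ^^ dep v) v = (p ^^ j) v" using funpow_dep[OF uv(2)] by simp
    then show False using jmin[of "dep v"] j \<open>\<not> j \<le> dep v\<close> by simp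
  qed
  have up: "{(p ^^ l) x, (p ^^ Suc l) x} \<in> edges T" if "x \<in> vertices T" "l < dep x" for x l
  proof -
    have "(p ^^ l) x \<noteq> rt" using dep_funpow[OF that(1), of l] that(2) dep_root by auto
    then show ?thesis using pe[OF funpow_in[OF that(1)]] by simp
  qed
  have inj: "inj_on (\<lambda>l. (p ^^ l) x) {0..<l'}" if "x \<in> vertices T" "l' \<le> Suc (dep x)" for x l'
    using dep_funpow[OF that(1)] that(2) by (intro inj_on_inverseI[of _ "\<lambda>y. dep x - dep y"]) auto
  \<comment> \<open>Up from \<open>u\<close> and down to \<open>v\<close>. The common ancestor is
    listed in the first half only, hence \<open>Suc i\<close> against \<open>j\<close>.\<close>
  define xs where "xs = map (\<lambda>l. (p ^^ l) u) [0..<Suc i] @ rev (map (\<lambda>l. (p ^^ l) v) [0..<j])"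
  have suc1: "successively (\<lambda>x y. {x, y} \<in> edges T) (map (\<lambda>l. (p ^^ l) u) [0..<Suc i])"
    unfolding successively_conv_nth
  proof (intro allI impI)
    fix l assume l: "Suc l < length (map (\<lambda>l. (p ^^ l) u) [0..<Suc i])"
    then have "l < dep u" using i(2) by simp
    then show "{map (\<lambda>l. (p ^^ l) u) [0..<Suc i] ! l, map (\<lambda>l. (p ^^ l) u) [0..<Suc i] ! Suc l} \<in> edges T"
      using up[OF uv(1)] l by (simp del: upt_Suc funpow.simps)
  qed
  have suc2: "successively (\<lambda>x y. {x, y} \<in> edges T) (rev (map (\<lambda>l. (p ^^ l) v) [0..<j]))"
    unfolding successively_rev unfolding successively_conv_nth
  proof (intro allI impI)
    fix l assume l: "Suc l < length (map (\<lambda>l. (p ^^ l) v) [0..<j])"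
    then have "l < dep v" using jd by simp
    then show "{map (\<lambda>l. (p ^^ l) v) [0..<j] ! Suc l, map (\<lambda>l. (p ^^ l) v) [0..<j] ! l} \<in> edges T"
      using up[OF uv(2)] l by (simp del: upt_Suc funpow.simps add: insert_commute)
  qed
  have join: "{last (map (\<lambda>l. (p ^^ l) u) [0..<Suc i]), hd (rev (map (\<lambda>l. (p ^^ l) v) [0..<j]))} \<in> edges T"
    if "0 < j"
  proof -
    have "last (map (\<lambda>l. (p ^^ l) u) [0..<Suc i]) = (p ^^ j) v" using j by simp
    moreover have "hd (rev (map (\<lambda>l. (p ^^ l) v) [0..<j])) = (p ^^ (j - 1)) v"
      using that by (simp add: hd_rev last_map)
    moreover have "{(p ^^ (j - 1)) v, (p ^^ Suc (j - 1)) v} \<in> edges T"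
      using jd that by (intro up[OF uv(2)]) simp
    ultimately show ?thesis using that by (simp add: insert_commute del: funpow.simps)
  qed
  have "successively (\<lambda>x y. {x, y} \<in> edges T) xs"
    unfolding xs_def successively_append_iff using suc1 suc2 join by auto
  moreover have "set xs \<subseteq> vertices T" unfolding xs_def using funpow_in uv by (auto simp del: funpow.simps)
  moreover have xne: "xs \<noteq> []" unfolding xs_def by simp
  ultimately have walk: "is_walk T xs" unfolding is_walk_def by simp
  have "distinct (map (\<lambda>l. (p ^^ l) u) [0..<Suc i])"
    using inj[OF uv(1), of "Suc i"] i(2) by (simp add: distinct_map del: upt_Suc)
  moreover have "distinct (rev (map (\<lambda>l. (p ^^ l) v) [0..<j]))"
    using inj[OF uv(2), of j] jd by (simp add: distinct_map)
  moreover have "(p ^^ l) u \<noteq> (p ^^ l') v" if "l < Suc i" "l' < j" for l l'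
    using that imin[of l l'] jmin[of l'] by (cases "l = i") auto
  ultimately have dist: "distinct xs" unfolding xs_def by (auto simp del: funpow.simps upt_Suc)
  \<comment> \<open>If \<open>i + j \<le> 1\<close>, then \<open>u = v\<close> or one of the two is
    the parent of the other.\<close>
  have len: "3 \<le> length xs"
  proof (rule ccontr)
    assume "\<not> 3 \<le> length xs"
    then have "i + j \<le> 1" unfolding xs_def by simp
    then consider "i = 0" "j = 0" | "i = 1" "j = 0" | "i = 0" "j = 1" by linarith
    then show False using j uv(3) contra by cases auto
  qed
  have hd: "hd xs = u" unfolding xs_def by (simp add: upt_conv_Cons del: upt_Suc)
  have "last xs = v"
  proof (cases "j = 0")
    case True
    then show ?thesis using j unfolding xs_def by simp
  next
    case False
    then show ?thesis unfolding xs_def by (simp add: last_rev hd_map)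
  qed
  then have "is_cycle T xs" unfolding is_cycle_def using walk dist len hd e by (simp add: insert_commute)
  then show False using T unfolding is_tree_def by blast
qed

text \<open>Induction along the walk: a step down to a child raises \<open>j\<close>, and a step up
  lowers \<open>j\<close> or, if \<open>j = 0\<close>, raises \<open>i\<close>.\<close>

lemma walk_meet:
  assumes e: "\<And>u v. {u, v} \<in> edges T \<Longrightarrow> p u = v \<or> p v = u"
  shows "successively (\<lambda>x y. {x, y} \<in> edges T) xs \<Longrightarrow> xs \<noteq> [] \<Longrightarrow>
    \<exists>i j. i + j \<le> length xs - 1 \<and> (p ^^ i) (hd xs) = (p ^^ j) (last xs)"
proof (induction xs rule: rev_induct)
  case Nil
  then show ?case by simp
next
  case (snoc w xs)
  show ?case
  proof (cases "xs = []")
    case True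
    then show ?thesis by simp
  next
    case False
    then have s: "successively (\<lambda>x y. {x, y} \<in> edges T) xs" "{last xs, w} \<in> edges T"
      using snoc.prems by (auto simp: successively_append_iff)
    obtain i j where ij: "i + j \<le> length xs - 1" "(p ^^ i) (hd xs) = (p ^^ j) (last xs)"
      using snoc.IH[OF s(1) False] by blast
    have len: "Suc (i + j) \<le> length xs" using ij(1) False by (cases xs) auto
    show ?thesis
    proof (cases "p w = last xs")
      case True
      then have "(p ^^ i) (hd xs) = (p ^^ Suc j) w" using ij(2) by (simp add: funpow_swap1)
      then show ?thesis using ij(1) False len
        by - (rule exI[of _ i], rule exI[of _ "Suc j"], simp)
    next
      case nw: False
      then have w: "p (last xs) = w" using e[OF s(2)] by auto
      show ?thesis
      proof (cases j)
        case 0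
        then have "(p ^^ Suc i) (hd xs) = (p ^^ 0) w" using ij(2) w by simp
        then show ?thesis using ij(1) False len 0
          by - (rule exI[of _ "Suc i"], rule exI[of _ 0], simp)
      next
        case (Suc j')
        then have "(p ^^ i) (hd xs) = (p ^^ j') w" using ij(2) w by (simp add: funpow_swap1)
        then show ?thesis using ij(1) False len Suc
          by - (rule exI[of _ i], rule exI[of _ j'], simp)
      qed
    qed
  qed
qed

lemma graph_dist_le_walk:
  assumes "graph_dist G u v \<le> enat k"
  obtains xs where "xs \<in> walks_between G u v" "length xs - 1 \<le> k"
proof -
  let ?A = "(\<lambda>xs. enat (length xs - 1)) ` walks_between G u v"
  have "?A \<noteq> {}"
  proof
    assume "?A = {}"
    then have "graph_dist G u v = \<infinity>" unfolding graph_dist_def by (simp add: Inf_enat_def)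
    with assms show False by simp
  qed
  then obtain a where "a \<in> ?A" by blast
  then have "Inf ?A \<in> ?A" unfolding Inf_enat_def by (metis (no_types, lifting) LeastI empty_iff)
  then obtain xs where "xs \<in> walks_between G u v" "graph_dist G u v = enat (length xs - 1)"
    unfolding graph_dist_def by blast
  then show thesis using assms that by simp
qed

lemma tree_power_bags:
  assumes T: "is_tree T" and deg: "max_degree T \<le> \<Delta>" and k: "0 < k"
  shows "\<exists>n par \<beta>. rooted_tree ((\<Delta> + 1) ^ k) n par \<and> n \<le> card (vertices T) \<and> (\<forall>v\<in>vertices T. \<beta> v < n) \<and>
    (\<forall>j. card {v \<in> vertices T. \<beta> v = j} \<le> k * (\<Delta> + 1) ^ (2 * k)) \<and>
    (\<forall>e \<in> edges (graph_power T k). \<exists>u v. e = {u, v} \<and> u \<in> vertices T \<and> v \<in> vertices T \<and> u \<noteq> v \<and>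
       (\<beta> u = \<beta> v \<or> 0 < \<beta> v \<and> \<beta> u = par (\<beta> v)))"
proof -
  have sg: "simple_graph T" and cg: "connected_graph T" using T unfolding is_tree_def by auto
  obtain rt p dep where R: "rooted_vertices (vertices T) rt p dep"
    and pe0: "\<forall>v\<in>vertices T. v \<noteq> rt \<longrightarrow> {v, p v} \<in> edges T"
    using connected_graph_rooting[OF sg cg] by (elim exE conjE)
  have pe: "{v, p v} \<in> edges T" if "v \<in> vertices T" "v \<noteq> rt" for v using pe0 that by simp
  have par: "p u = v \<or> p v = u" if "{u, v} \<in> edges T" for u v
    by (rule tree_edge_parent[OF T R pe that])
  interpret rooted_vertices "vertices T" rt p dep by (rule R)
  \<comment> \<open>The summand 1 allows for the root, which is its own parent.\<close>
  have fibre: "card {v \<in> vertices T. p v = x} \<le> \<Delta> + 1" for x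
  proof (cases "x \<in> vertices T")
    case True
    let ?S = "{v \<in> vertices T. v \<noteq> rt \<and> p v = x}"
    have finE: "finite (edges T)" using simple_graph_finite[OF sg] by simp
    have "inj_on (\<lambda>v. {v, x}) ?S" by (auto simp: inj_on_def doubleton_eq_iff)
    moreover have "(\<lambda>v. {v, x}) ` ?S \<subseteq> {e \<in> edges T. x \<in> e}" using pe by auto
    ultimately have "card ?S \<le> degree T x"
      unfolding degree_def using finE by (intro card_inj_on_le) auto
    also have "degree T x \<le> max_degree T"
      unfolding max_degree_def using finite_V True by (intro Max_ge) auto
    finally have S: "card ?S \<le> \<Delta>" using deg by simp
    have "{v \<in> vertices T. p v = x} \<subseteq> insert rt ?S" by auto
    then have "card {v \<in> vertices T. p v = x} \<le> card (insert rt ?S)"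
      using finite_V by (intro card_mono) auto
    also have "\<dots> \<le> card ?S + 1" using card_insert_le_m1[of "card ?S + 1" ?S rt] by simp
    finally show ?thesis using S by simp
  next
    case False
    then have "{v \<in> vertices T. p v = x} = {}" using funpow_in[of _ 1] by auto
    then show ?thesis by (simp only: card.empty le0)
  qed
  obtain n par \<beta> where B: "rooted_tree ((\<Delta> + 1) ^ k) n par" "n \<le> card (vertices T)" "\<forall>v\<in>vertices T. \<beta> v < n"
    "\<forall>j. card {v \<in> vertices T. \<beta> v = j} \<le> k * (\<Delta> + 1) ^ (2 * k)"
    and adj: "\<forall>u\<in>vertices T. \<forall>w\<in>vertices T. \<forall>i\<le>k. \<forall>j\<le>k. (p ^^ i) u = (p ^^ j) w \<longrightarrow>
       \<beta> u = \<beta> w \<or> 0 < \<beta> w \<and> \<beta> u = par (\<beta> w) \<or> 0 < \<beta> u \<and> \<beta> w = par (\<beta> u)"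
    using bag_tree[OF k fibre] by (elim meta_impE exE conjE) simp_all
  have "\<exists>u v. e = {u, v} \<and> u \<in> vertices T \<and> v \<in> vertices T \<and> u \<noteq> v \<and> (\<beta> u = \<beta> v \<or> 0 < \<beta> v \<and> \<beta> u = par (\<beta> v))"
    if e: "e \<in> edges (graph_power T k)" for e
  proof -
    obtain u v where uv: "e = {u, v}" "u \<in> vertices T" "v \<in> vertices T" "u \<noteq> v" "graph_dist T u v \<le> enat k"
      using e unfolding graph_power_def by auto
    obtain xs where xs: "xs \<in> walks_between T u v" "length xs - 1 \<le> k"
      using graph_dist_le_walk[OF uv(5)] .
    have w: "successively (\<lambda>x y. {x, y} \<in> edges T) xs" "xs \<noteq> []" "hd xs = u" "last xs = v"
      using xs(1) unfolding walks_between_def is_walk_def by auto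
    have "\<exists>i j. i + j \<le> length xs - 1 \<and> (p ^^ i) (hd xs) = (p ^^ j) (last xs)"
      by (rule walk_meet[OF _ w(1,2)]) (rule par)
    then obtain i j where "i + j \<le> length xs - 1" "(p ^^ i) (hd xs) = (p ^^ j) (last xs)"
      by (elim exE conjE)
    then have ij: "i \<le> k" "j \<le> k" "(p ^^ i) u = (p ^^ j) v" using xs(2) w by auto
    have "\<beta> u = \<beta> v \<or> 0 < \<beta> v \<and> \<beta> u = par (\<beta> v) \<or> 0 < \<beta> u \<and> \<beta> v = par (\<beta> u)"
      using adj uv(2,3) ij by blast
    then show ?thesis
    proof (elim disjE)
      assume "0 < \<beta> u \<and> \<beta> v = par (\<beta> u)"
      then show ?thesis using uv by - (rule exI[of _ v], rule exI[of _ u], auto)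
    qed (use uv in blast)+
  qed
  then show ?thesis using B
    by - (rule exI[of _ n], rule exI[of _ par], rule exI[of _ \<beta>], simp)
qed

section \<open>The host graph\<close>

lemma linear_host:
  fixes m d s :: nat
  assumes m: "2 \<le> m"
  shows "\<exists>C. \<forall>n>0. \<exists>G :: nat ugraph. simple_graph G \<and> card (edges G) \<le> C * n \<and>
    (\<forall>c n' par. n' \<le> n \<longrightarrow> rooted_tree d n' par \<longrightarrow> c ` edges G \<subseteq> {..<s} \<longrightarrow>
      (\<exists>i<s. \<exists>D. (\<forall>j<n'. m \<le> card (D j)) \<and> (\<forall>j<n'. D j \<subseteq> vertices G) \<and>
        (\<forall>j<n'. \<forall>l<n'. j \<noteq> l \<longrightarrow> D j \<inter> D l = {}) \<and>
        (\<forall>j<n'. \<forall>u\<in>D j. \<forall>v\<in>D j. u \<noteq> v \<longrightarrow> {u, v} \<in> edges G \<and> c {u, v} = i) \<and>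
        (\<forall>j. 0 < j \<and> j < n' \<longrightarrow> (\<forall>u\<in>D (par j). \<forall>v\<in>D j. {u, v} \<in> edges G \<and> c {u, v} = i))))"
proof -
  obtain h r t z where h: "0 < h" "0 < z" and host: "ramsey_host m d s 32 2 h r t z"
    using ramsey_host_exists[of m d s 32 2] by (elim exE conjE)
  define Dg where "Dg = 32 * h\<^sup>2"
  \<comment> \<open>Vertices of the sparse graph per tree vertex, times cliques in a ball of radius
    \<open>r\<close>, times pairs between two cliques.\<close>
  define C where "C = 2 * z * ((Dg + 1) ^ r * (t * t))"
  show ?thesis
  proof (rule exI[of _ C], intro allI impI)
    fix n :: nat assume n: "0 < n"
    \<comment> \<open>At least half of the \<open>N\<close> vertices survive in \<open>X\<close>,
      that is, \<open>z * n\<close> of them.\<close>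
    define N where "N = 2 * z * n"
    have N0: "0 < N" unfolding N_def using h n by simp
    obtain X E where X: "X \<subseteq> {..<N}" "N \<le> 2 * card X" "E \<subseteq> X \<times> X" "sym E"
      "\<forall>x\<in>X. card (E `` {x}) \<le> 32 * h ^ 2" "joined h X E"
      using sparse_joined_graph_exists[OF N0 h(1)] by (elim exE conjE)
    have finX: "finite X" using X(1) by (rule finite_subset) simp
    have finE: "finite E" using X(3) by (rule finite_subset) (use finX in simp)
    define P where "P = E\<^sup>= ^^ r"
    have degE: "card (E `` {x}) \<le> Dg" for x
    proof (cases "x \<in> X")
      case True
      then show ?thesis using X(5) unfolding Dg_def by simp
    next
      case False
      then have "E `` {x} = {}" using X(3) by auto
      then show ?thesis by simp
    qed
    have ball: "finite (P `` {x}) \<and> card (P `` {x}) \<le> (Dg + 1) ^ r" for x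
      unfolding P_def by (rule card_relpow_Image_le[OF finite_Image[OF finE] degE])
    define Q where "Q x = {x * t..<x * t + t}" for x :: nat
    have Qdisj: "Q x \<inter> Q y = {}" if "x \<noteq> y" for x y
    proof (rule ccontr)
      assume "Q x \<inter> Q y \<noteq> {}"
      then obtain a where "a \<in> Q x" "a \<in> Q y" by blast
      then have a: "x * t \<le> a" "a < x * t + t" "y * t \<le> a" "a < y * t + t" unfolding Q_def by auto
      have "a div t = x" using a by (intro div_nat_eqI) (auto simp: mult.commute)
      moreover have "a div t = y" using a by (intro div_nat_eqI) (auto simp: mult.commute)
      ultimately show False using that by simp
    qed
    define F where "F = (\<Union>x\<in>X. \<Union>y\<in>P `` {x} \<inter> X. Q x \<times> Q y)"
    define Ed where "Ed = {{u, v} | u v. (u, v) \<in> F \<and> u \<noteq> v}"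
    define G where "G = ((\<Union>x\<in>X. Q x), Ed)"
    have edges: "edges G = Ed" "vertices G = (\<Union>x\<in>X. Q x)" unfolding G_def by simp_all
    have finF: "finite F" unfolding F_def using finX ball by (auto simp: Q_def)
    have sg: "simple_graph G"
      unfolding simple_graph_def edges using finX unfolding Ed_def F_def by (auto simp: Q_def)
    have "card F \<le> (\<Sum>x\<in>X. card (\<Union>y\<in>P `` {x} \<inter> X. Q x \<times> Q y))"
      unfolding F_def by (rule card_UN_le[OF finX])
    also have "\<dots> \<le> (\<Sum>x\<in>X. (Dg + 1) ^ r * (t * t))"
    proof (rule sum_mono)
      fix x assume "x \<in> X"
      have "card (\<Union>y\<in>P `` {x} \<inter> X. Q x \<times> Q y) \<le> (\<Sum>y\<in>P `` {x} \<inter> X. card (Q x \<times> Q y))"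
        using ball by (intro card_UN_le) auto
      also have "\<dots> = card (P `` {x} \<inter> X) * (t * t)" by (simp add: Q_def card_cartesian_product)
      also have "\<dots> \<le> (Dg + 1) ^ r * (t * t)"
      proof (rule mult_right_mono)
        have "card (P `` {x} \<inter> X) \<le> card (P `` {x})" using ball by (intro card_mono) auto
        then show "card (P `` {x} \<inter> X) \<le> (Dg + 1) ^ r" using ball[of x] by simp
      qed simp
      finally show "card (\<Union>y\<in>P `` {x} \<inter> X. Q x \<times> Q y) \<le> (Dg + 1) ^ r * (t * t)" .
    qed
    also have "\<dots> = card X * ((Dg + 1) ^ r * (t * t))" by simp
    also have "\<dots> \<le> N * ((Dg + 1) ^ r * (t * t))"
      using card_mono[OF _ X(1)] by (intro mult_right_mono) auto
    also have "\<dots> = C * n" unfolding C_def N_def by simp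
    finally have cF: "card F \<le> C * n" .
    have "Ed \<subseteq> (\<lambda>(u, v). {u, v}) ` F" unfolding Ed_def by auto
    then have "card Ed \<le> card ((\<lambda>(u, v). {u, v}) ` F)" using finF by (intro card_mono) auto
    also have "\<dots> \<le> card F" by (rule card_image_le[OF finF])
    finally have cE: "card (edges G) \<le> C * n" using cF edges by simp
    have ram: "\<exists>i<s. \<exists>D. (\<forall>j<n'. m \<le> card (D j)) \<and> (\<forall>j<n'. D j \<subseteq> vertices G) \<and>
        (\<forall>j<n'. \<forall>l<n'. j \<noteq> l \<longrightarrow> D j \<inter> D l = {}) \<and>
        (\<forall>j<n'. \<forall>u\<in>D j. \<forall>v\<in>D j. u \<noteq> v \<longrightarrow> {u, v} \<in> edges G \<and> c {u, v} = i) \<and>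
        (\<forall>j. 0 < j \<and> j < n' \<longrightarrow> (\<forall>u\<in>D (par j). \<forall>v\<in>D j. {u, v} \<in> edges G \<and> c {u, v} = i))"
      if n': "n' \<le> n" and T: "rooted_tree d n' par" and c: "c ` edges G \<subseteq> {..<s}" for c n' par
    proof -
      \<comment> \<open>Pairs that are not edges get the colour \<open>s\<close>, so a colour in
        \<open>{..<s}\<close> certifies an edge of \<open>G\<close>.\<close>
      define \<chi> where "\<chi> e = (if e \<in> Ed then c e else s)" for e
      have \<chi>: "e \<in> edges G \<and> c e = i" if "\<chi> e = i" "i < s" for e i
        using that unfolding \<chi>_def edges by (auto split: if_splits)
      have bl: "blown_up t r X E Q {..<s} \<chi>"
        unfolding blown_up_def
      proof (intro conjI ballI impI)
        fix x y u v
        assume "x \<in> X" "y \<in> X" "(x, y) \<in> E\<^sup>= ^^ r" "u \<in> Q x" "v \<in> Q y" "u \<noteq> v"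
        then have "(u, v) \<in> F" unfolding F_def P_def by auto
        then have "{u, v} \<in> Ed" unfolding Ed_def using \<open>u \<noteq> v\<close> by blast
        then show "\<chi> {u, v} \<in> {..<s}" using c unfolding \<chi>_def edges by auto
      qed (use Qdisj in \<open>auto simp: Q_def\<close>)
      have "z * n' \<le> z * n" using n' by (rule mult_le_mono2)
      also have "\<dots> \<le> card X" using X(2) unfolding N_def by simp
      finally have zX: "z * n' \<le> card X" .
      have "mono_blowup m \<chi> {..<s} n' par"
        using host[unfolded ramsey_host_def, rule_format, of X E Q "{..<s}" \<chi> n' par] finX X(3-6) bl T zX by simp
      then obtain i D where i: "i \<in> {..<s}" and D: "\<forall>j<n'. finite (D j) \<and> m \<le> card (D j)"
        "\<forall>j<n'. \<forall>l<n'. j \<noteq> l \<longrightarrow> D j \<inter> D l = {}"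
        "\<forall>j<n'. \<forall>u\<in>D j. \<forall>v\<in>D j. u \<noteq> v \<longrightarrow> \<chi> {u, v} = i"
        "\<forall>j. 0 < j \<and> j < n' \<longrightarrow> (\<forall>u\<in>D (par j). \<forall>v\<in>D j. \<chi> {u, v} = i)"
        unfolding mono_blowup_def by (elim bexE exE conjE)
      \<comment> \<open>Since \<open>2 \<le> m\<close>, every vertex of \<open>D j\<close> has a
        partner there, and their pair is an edge of \<open>G\<close>.\<close>
      have "D j \<subseteq> vertices G" if j: "j < n'" for j
      proof
        fix u assume u: "u \<in> D j"
        have "finite (D j)" "\<not> card (D j) \<le> Suc 0" using D(1) j m by auto
        then obtain v where v: "v \<in> D j" "v \<noteq> u" using u by (auto simp: card_le_Suc0_iff_eq)
        then have "\<chi> {u, v} = i" using D(3) j u by simp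
        then have "{u, v} \<in> edges G" using \<chi> i by simp
        then show "u \<in> vertices G" using simple_graph_edge[OF sg] by simp
      qed
      then show ?thesis using i D \<chi>
        by - (rule exI[of _ i], simp, rule exI[of _ D], simp)
    qed
    show "\<exists>G :: nat ugraph. simple_graph G \<and> card (edges G) \<le> C * n \<and>
    (\<forall>c n' par. n' \<le> n \<longrightarrow> rooted_tree d n' par \<longrightarrow> c ` edges G \<subseteq> {..<s} \<longrightarrow>
      (\<exists>i<s. \<exists>D. (\<forall>j<n'. m \<le> card (D j)) \<and> (\<forall>j<n'. D j \<subseteq> vertices G) \<and>
        (\<forall>j<n'. \<forall>l<n'. j \<noteq> l \<longrightarrow> D j \<inter> D l = {}) \<and>
        (\<forall>j<n'. \<forall>u\<in>D j. \<forall>v\<in>D j. u \<noteq> v \<longrightarrow> {u, v} \<in> edges G \<and> c {u, v} = i) \<and>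
        (\<forall>j. 0 < j \<and> j < n' \<longrightarrow> (\<forall>u\<in>D (par j). \<forall>v\<in>D j. {u, v} \<in> edges G \<and> c {u, v} = i))))"
      by (rule exI[of _ G], intro conjI allI impI) (rule sg, rule cE, rule ram)
  qed
qed

text \<open>Each bag is injected into the clique with its index; an edge of \<open>H\<close> stays
  in one bag or joins a bag to its parent, and both kinds have colour \<open>i\<close>.\<close>

lemma mono_copy_of_bags:
  assumes fin: "finite (vertices H)" and \<beta>: "\<forall>v\<in>vertices H. \<beta> v < n"
    and size: "\<forall>j. card {v \<in> vertices H. \<beta> v = j} \<le> m"
    and He: "\<forall>e \<in> edges H. \<exists>u v. e = {u, v} \<and> u \<in> vertices H \<and> v \<in> vertices H \<and> u \<noteq> v \<and>
       (\<beta> u = \<beta> v \<or> 0 < \<beta> v \<and> \<beta> u = par (\<beta> v))"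
    and D: "\<forall>j<n. m \<le> card (D j)" "\<forall>j<n. D j \<subseteq> vertices G" "\<forall>j<n. \<forall>l<n. j \<noteq> l \<longrightarrow> D j \<inter> D l = {}"
      "\<forall>j<n. \<forall>u\<in>D j. \<forall>v\<in>D j. u \<noteq> v \<longrightarrow> {u, v} \<in> edges G \<and> c {u, v} = i"
      "\<forall>j. 0 < j \<and> j < n \<longrightarrow> (\<forall>u\<in>D (par j). \<forall>v\<in>D j. {u, v} \<in> edges G \<and> c {u, v} = i)"
    and finG: "finite (vertices G)"
  shows "mono_copy G c i H"
proof -
  have "\<exists>g. inj_on g {v \<in> vertices H. \<beta> v = j} \<and> g ` {v \<in> vertices H. \<beta> v = j} \<subseteq> D j" if j: "j < n" for j
  proof -
    have "card {v \<in> vertices H. \<beta> v = j} \<le> card (D j)"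
      using size[THEN spec, of j] D(1)[rule_format, OF j] by (rule le_trans)
    moreover have "finite (D j)" using D(2) j finG by (auto intro: finite_subset)
    ultimately show ?thesis using card_le_inj[of "{v \<in> vertices H. \<beta> v = j}" "D j"] fin by auto
  qed
  then have "\<forall>j\<in>{..<n}. \<exists>g. inj_on g {v \<in> vertices H. \<beta> v = j} \<and> g ` {v \<in> vertices H. \<beta> v = j} \<subseteq> D j" by simp
  from bchoice[OF this] obtain g where
    g: "\<forall>j\<in>{..<n}. inj_on (g j) {v \<in> vertices H. \<beta> v = j} \<and> g j ` {v \<in> vertices H. \<beta> v = j} \<subseteq> D j"
    by (elim exE)
  define f where "f v = g (\<beta> v) v" for v
  have fD: "f v \<in> D (\<beta> v)" if "v \<in> vertices H" for v
    using g \<beta> that unfolding f_def by auto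
  have fne: "f u \<noteq> f v" if "u \<in> vertices H" "v \<in> vertices H" "u \<noteq> v" for u v
  proof (cases "\<beta> u = \<beta> v")
    case True
    have "inj_on (g (\<beta> v)) {w \<in> vertices H. \<beta> w = \<beta> v}" using g \<beta> that by simp
    then show ?thesis using that True unfolding f_def by (auto simp: inj_on_def)
  next
    case False
    then have "D (\<beta> u) \<inter> D (\<beta> v) = {}" using D(3) \<beta> that by simp
    then show ?thesis using fD[OF that(1)] fD[OF that(2)] by auto
  qed
  show ?thesis unfolding mono_copy_def
  proof (rule exI[of _ f], intro conjI ballI)
    show "inj_on f (vertices H)" unfolding inj_on_def using fne by blast
    show "f ` vertices H \<subseteq> vertices G"
    proof
      fix y assume "y \<in> f ` vertices H"
      then obtain v where v: "v \<in> vertices H" "y = f v" by auto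
      then have "D (\<beta> v) \<subseteq> vertices G" using D(2) \<beta> by simp
      then show "y \<in> vertices G" using fD[OF v(1)] v(2) by auto
    qed
    fix e assume "e \<in> edges H"
    then have "\<exists>u v. e = {u, v} \<and> u \<in> vertices H \<and> v \<in> vertices H \<and> u \<noteq> v \<and>
       (\<beta> u = \<beta> v \<or> 0 < \<beta> v \<and> \<beta> u = par (\<beta> v))" by (rule bspec[OF He])
    then obtain u v where e: "e = {u, v}" "u \<in> vertices H" "v \<in> vertices H" "u \<noteq> v"
      and adj: "\<beta> u = \<beta> v \<or> 0 < \<beta> v \<and> \<beta> u = par (\<beta> v)" by (elim exE conjE)
    have "{f u, f v} \<in> edges G \<and> c {f u, f v} = i"
      using adj
    proof
      assume "\<beta> u = \<beta> v"
      then have "f u \<in> D (\<beta> v)" using fD[OF e(2)] by simp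
      then show ?thesis using D(4)[rule_format, of "\<beta> v" "f u" "f v"] \<beta> e(3) fD[OF e(3)] fne[OF e(2-4)] by simp
    next
      assume "0 < \<beta> v \<and> \<beta> u = par (\<beta> v)"
      then show ?thesis using D(5)[rule_format, of "\<beta> v" "f u" "f v"] \<beta> e(3) fD[OF e(2)] fD[OF e(3)] by simp
    qed
    then show "f ` e \<in> edges G" "c (f ` e) = i" using e(1) by simp_all
  qed
qed

theorem theorem1p1:
  fixes k \<Delta> s :: nat
  assumes "k > 0" and "\<Delta> > 0" and "s > 0"
  shows "\<exists>C :: nat. \<forall>n > 0. \<forall>T :: 'a ugraph.
           is_tree T \<and> card (vertices T) = n \<and> max_degree T \<le> \<Delta> \<longrightarrow>
           size_ramsey s (graph_power T k) \<le> enat (C * n)"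
proof -
  \<comment> \<open>The size of a bag in \<open>tree_power_bags\<close>, enlarged to satisfy
    \<open>2 \<le> m\<close> in \<open>linear_host\<close>.\<close>
  define m where "m = k * (\<Delta> + 1) ^ (2 * k) + 2"
  define d where "d = (\<Delta> + 1) ^ k"
  have "2 \<le> m" unfolding m_def by simp
  from linear_host[OF this, of d s] obtain C where C: "\<forall>n>0. \<exists>G :: nat ugraph. simple_graph G \<and> card (edges G) \<le> C * n \<and>
    (\<forall>c n' par. n' \<le> n \<longrightarrow> rooted_tree d n' par \<longrightarrow> c ` edges G \<subseteq> {..<s} \<longrightarrow>
      (\<exists>i<s. \<exists>D. (\<forall>j<n'. m \<le> card (D j)) \<and> (\<forall>j<n'. D j \<subseteq> vertices G) \<and>
        (\<forall>j<n'. \<forall>l<n'. j \<noteq> l \<longrightarrow> D j \<inter> D l = {}) \<and>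
        (\<forall>j<n'. \<forall>u\<in>D j. \<forall>v\<in>D j. u \<noteq> v \<longrightarrow> {u, v} \<in> edges G \<and> c {u, v} = i) \<and>
        (\<forall>j. 0 < j \<and> j < n' \<longrightarrow> (\<forall>u\<in>D (par j). \<forall>v\<in>D j. {u, v} \<in> edges G \<and> c {u, v} = i))))"
    by (elim exE)
  show ?thesis
  proof (rule exI[of _ C], intro allI impI, elim conjE)
    fix n :: nat and T :: "'a ugraph"
    assume n: "0 < n" and T: "is_tree T" "card (vertices T) = n" "max_degree T \<le> \<Delta>"
    obtain G :: "nat ugraph" where G: "simple_graph G" "card (edges G) \<le> C * n" and
      ram: "\<forall>c n' par. n' \<le> n \<longrightarrow> rooted_tree d n' par \<longrightarrow> c ` edges G \<subseteq> {..<s} \<longrightarrow>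
      (\<exists>i<s. \<exists>D. (\<forall>j<n'. m \<le> card (D j)) \<and> (\<forall>j<n'. D j \<subseteq> vertices G) \<and>
        (\<forall>j<n'. \<forall>l<n'. j \<noteq> l \<longrightarrow> D j \<inter> D l = {}) \<and>
        (\<forall>j<n'. \<forall>u\<in>D j. \<forall>v\<in>D j. u \<noteq> v \<longrightarrow> {u, v} \<in> edges G \<and> c {u, v} = i) \<and>
        (\<forall>j. 0 < j \<and> j < n' \<longrightarrow> (\<forall>u\<in>D (par j). \<forall>v\<in>D j. {u, v} \<in> edges G \<and> c {u, v} = i)))"
      using C[THEN spec, THEN mp, OF n] by (elim exE conjE)
    let ?H = "graph_power T k"
    have VH: "vertices ?H = vertices T" unfolding graph_power_def by simp
    have finT: "finite (vertices T)" using T(1) unfolding is_tree_def simple_graph_def by simp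
    have finG: "finite (vertices G)" using G(1) unfolding simple_graph_def by simp
    obtain n' par \<beta> where B: "rooted_tree d n' par" "n' \<le> n" "\<forall>v\<in>vertices T. \<beta> v < n'"
      "\<forall>j. card {v \<in> vertices T. \<beta> v = j} \<le> k * (\<Delta> + 1) ^ (2 * k)"
      "\<forall>e \<in> edges ?H. \<exists>u v. e = {u, v} \<and> u \<in> vertices T \<and> v \<in> vertices T \<and> u \<noteq> v \<and>
       (\<beta> u = \<beta> v \<or> 0 < \<beta> v \<and> \<beta> u = par (\<beta> v))"
      using tree_power_bags[OF T(1,3) assms(1)] unfolding T(2) d_def by (elim exE conjE)
    have size: "\<forall>j. card {v \<in> vertices ?H. \<beta> v = j} \<le> m"
      unfolding VH m_def using B(4) by (simp add: le_SucI)
    have "arrows G ?H s"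
      unfolding arrows_def
    proof (intro allI impI)
      fix c assume c: "c ` edges G \<subseteq> {..<s}"
      obtain i D where i: "i < s" and D: "\<forall>j<n'. m \<le> card (D j)" "\<forall>j<n'. D j \<subseteq> vertices G"
        "\<forall>j<n'. \<forall>l<n'. j \<noteq> l \<longrightarrow> D j \<inter> D l = {}"
        "\<forall>j<n'. \<forall>u\<in>D j. \<forall>v\<in>D j. u \<noteq> v \<longrightarrow> {u, v} \<in> edges G \<and> c {u, v} = i"
        "\<forall>j. 0 < j \<and> j < n' \<longrightarrow> (\<forall>u\<in>D (par j). \<forall>v\<in>D j. {u, v} \<in> edges G \<and> c {u, v} = i)"
        using ram[THEN spec, THEN spec, THEN spec, THEN mp, THEN mp, THEN mp, OF B(2,1) c]
        by (elim exE conjE)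
      have "mono_copy G c i ?H"
        by (rule mono_copy_of_bags[OF _ _ size _ D finG]) (use finT B(3,5) in \<open>simp_all only: VH\<close>)
      then show "\<exists>i<s. mono_copy G c i ?H" using i by blast
    qed
    then show "size_ramsey s ?H \<le> enat (C * n)"
      unfolding size_ramsey_le_iff using G by blast
  qed
qed

end
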